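(* Let $\mathcal{C}$ be an additive category with an automorphism $\Sigma$, let $n\ge3$, and let $\mathscr{N}$ be a collection of $n$-$\Sigma$-sequences in $\mathcal{C}$ satisfying the axioms (N1), (N2) and (N3). Then $\mathscr{N}$ satisfies (N4) if and only if $\mathscr{N}$ satisfies (N4* ).
   Context: $\mathcal{C}$ is an additive category, $\Sigma$ an automorphism of $\mathcal{C}$, $n\ge3$. An $n$-$\Sigma$-sequence is a diagram $A_1\xrightarrow{\alpha_1}A_2\to\cdots\xrightarrow{\alpha_{n-1}}A_n\xrightarrow{\alpha_n}\Sigma A_1$; its left rotation is $A_2\xrightarrow{\alpha_2}\cdots\xrightarrow{\alpha_n}\Sigma A_1\xrightarrow{(-1)^n\Sigma\alpha_1}\Sigma A_2$. A morphism $(\varphi_1,\dots,\varphi_n)\colon A_\bullet\to B_\bullet$ consists of $\varphi_i\colon A_i\to B_i$ with $\varphi_{i+1}\alpha_i=\beta_i\varphi_i$ ($1\le i\le n-1$) and $\Sigma\varphi_1\alpha_n=\beta_n\varphi_n$; isomorphisms have all $\varphi_i$ invertible. Direct sums are termwise; $A_\bullet$ is a direct summand of $B_\bullet$ if there are morphisms $\varphi\colon A_\bullet\to B_\bullet$, $\psi\colon B_\bullet\to A_\bullet$ with $\psi_i\varphi_i=1$. The mapping cone of $(\varphi_1,\dots,\varphi_n)$ is $A_2\oplus B_1\xrightarrow{\left[\begin{smallmatrix}-\alpha_2&0\\ \varphi_2&\beta_1\end{smallmatrix}\right]}A_3\oplus B_2\to\cdots\xrightarrow{\left[\begin{smallmatrix}-\alpha_n&0\\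 \varphi_n&\beta_{n-1}\end{smallmatrix}\right]}\Sigma A_1\oplus B_n\xrightarrow{\left[\begin{smallmatrix}-\Sigma\alpha_1&0\\ \Sigma\varphi_1&\beta_n\end{smallmatrix}\right]}\Sigma A_2\oplus\Sigma B_1$ (the map $A_k\oplus B_{k-1}\to A_{k+1}\oplus B_k$ being $\left[\begin{smallmatrix}-\alpha_k&0\\ \varphi_k&\beta_{k-1}\end{smallmatrix}\right]$). Sequences in $\mathscr{N}$ are called $n$-angles. Axioms: (N1)(a) $\mathscr{N}$ is closed under direct sums, direct summands and isomorphisms; (b) $A\xrightarrow{1}A\to0\to\cdots\to0\to\Sigma A$ is in $\mathscr{N}$ for every $A$; (c) every morphism $A_1\to A_2$ is the first morphism of some sequence in $\mathscr{N}$. (N2) a sequence is in $\mathscr{N}$ iff its left rotation is. (N3) given $A_\bullet,B_\bullet\in\mathscr{N}$ and $\varphi_1,\varphi_2$ with $\varphi_2\alpha_1=\beta_1\varphi_1$, there exist $\varphi_3,\dots,\varphi_n$ making $(\varphi_1,\dots,\varphi_n)$ a morphism. (N4) in the situation of (N3), $\varphi_3,\dots,\varphi_n$ can be chosen so that the mapping cone is in $\mathscr{N}$. (N4* ): Suppose given $n$-angles $A_1\xrightarrow{\alpha_1}A_2\xrightarrow{\alpha_2}\cdots\xrightarrow{\alpha_n}\Sigma A_1$, $A_1\xrightarrow{\beta_1}B_2\xrightarrow{\beta_2}B_3\to\cdots\xrightarrow{\beta_n}\Sigma A_1$ and $A_2\xrightarrow{\varphi_2}B_2\xrightarrow{\gamma_2}C_3\xrightarrow{\gamma_3}\cdots\xrightarrow{\gamma_{n-1}}C_n\xrightarrow{\gamma_n}\Sigma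 A_2$ with $\varphi_2\alpha_1=\beta_1$. Then there exist morphisms $\varphi_i\colon A_i\to B_i$ ($3\le i\le n$) and $\psi_j$ ($1\le j\le 2n-5$) such that (1) $(1_{A_1},\varphi_2,\dots,\varphi_n)$ is a morphism of $n$-$\Sigma$-sequences; (2) $\gamma_n\circ\psi_{2n-5}=\Sigma\alpha_1\circ\beta_n$, and the following $n$-$\Sigma$-sequence $D_1\xrightarrow{d_1}D_2\to\cdots\to D_n\xrightarrow{d_n}\Sigma D_1$ is in $\mathscr{N}$. Set $A_i=B_i=C_i=0$ for $i>n$ and $C_i=0$ for $i\le2$; let $D_1=A_3$ and $D_{k+1}=A_{k+3}\oplus B_{k+2}\oplus C_{k+1}$ for $1\le k\le n-1$ (so $D_2=A_4\oplus B_3$, $D_n=C_n$); $d_1=\left[\begin{smallmatrix}\alpha_3\\ \varphi_3\end{smallmatrix}\right]$; for $1\le k\le n-2$, $d_{k+1}\colon D_{k+1}\to D_{k+2}$ is the matrix $\left[\begin{smallmatrix}-\alpha_{k+3}&0&0\\ (-1)^{k+1}\varphi_{k+3}&-\beta_{k+2}&0\\ \psi_{2k}&\psi_{2k-1}&\gamma_{k+1}\end{smallmatrix}\right]$ with the rows and columns belonging to zero summands deleted (so $d_2=\left[\begin{smallmatrix}-\alpha_4&0\\ \varphi_4&-\beta_3\\ \psi_2&\psi_1\end{smallmatrix}\right]$, the map $A_n\oplus B_{n-1}\oplus C_{n-2}\to B_n\oplus C_{n-1}$ is $\left[\begin{smallmatrix}(-1)^n\varphi_n&-\beta_{n-1}&0\\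 \psi_{2n-6}&\psi_{2n-7}&\gamma_{n-2}\end{smallmatrix}\right]$, and the map $B_n\oplus C_{n-1}\to C_n$ is $[\psi_{2n-5}\ \gamma_{n-1}]$); and $d_n=\Sigma\alpha_2\circ\gamma_n\colon C_n\to\Sigma A_3$. (For $n=3$ this sequence is $A_3\xrightarrow{\varphi_3}B_3\xrightarrow{\psi_1}C_3\xrightarrow{\Sigma\alpha_2\circ\gamma_3}\Sigma A_3$.) *)

theory Defs
  imports Main
begin

text \<open>Morphisms carry their domain and codomain. Composition is cmp g f = g o f.\<close>

record ('o, 'm) addcat =
  Ob   :: "'o set"
  Mor  :: "'m set"
  Dom  :: "'m \<Rightarrow> 'o"
  Cod  :: "'m \<Rightarrow> 'o"
  idm  :: "'o \<Rightarrow> 'm"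
  cmp  :: "'m \<Rightarrow> 'm \<Rightarrow> 'm"
  madd :: "'m \<Rightarrow> 'm \<Rightarrow> 'm"
  mneg :: "'m \<Rightarrow> 'm"
  zer  :: "'o \<Rightarrow> 'o \<Rightarrow> 'm"
  zob  :: "'o"
  dsum :: "'o \<Rightarrow> 'o \<Rightarrow> 'o"
  in1  :: "'o \<Rightarrow> 'o \<Rightarrow> 'm"
  in2  :: "'o \<Rightarrow> 'o \<Rightarrow> 'm"
  pj1  :: "'o \<Rightarrow> 'o \<Rightarrow> 'm"
  pj2  :: "'o \<Rightarrow> 'o \<Rightarrow> 'm"

definition hom :: "('o,'m) addcat \<Rightarrow> 'o \<Rightarrow> 'o \<Rightarrow> 'm set" where
  "hom C A B = {f \<in> Mor C. Dom C f = A \<and> Cod C f = B}"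

definition additive_cat :: "('o,'m) addcat \<Rightarrow> bool" where
  "additive_cat C \<longleftrightarrow>
    \<comment> \<open>category\<close>
    (\<forall>f \<in> Mor C. Dom C f \<in> Ob C \<and> Cod C f \<in> Ob C) \<and>
    (\<forall>A \<in> Ob C. idm C A \<in> hom C A A) \<and>
    (\<forall>A \<in> Ob C. \<forall>B \<in> Ob C. \<forall>D \<in> Ob C. \<forall>f \<in> hom C A B. \<forall>g \<in> hom C B D.
        cmp C g f \<in> hom C A D) \<and>
    (\<forall>A \<in> Ob C. \<forall>B \<in> Ob C. \<forall>f \<in> hom C A B.
        cmp C (idm C B) f = f \<and> cmp C f (idm C A) = f) \<and>
    (\<forall>A \<in> Ob C. \<forall>B \<in> Ob C. \<forall>D \<in> Ob C. \<forall>E \<in> Ob C.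
       \<forall>f \<in> hom C A B. \<forall>g \<in> hom C B D. \<forall>h \<in> hom C D E.
        cmp C h (cmp C g f) = cmp C (cmp C h g) f) \<and>
    \<comment> \<open>hom-sets are abelian groups\<close>
    (\<forall>A \<in> Ob C. \<forall>B \<in> Ob C.
        zer C A B \<in> hom C A B \<and>
        (\<forall>f \<in> hom C A B. \<forall>g \<in> hom C A B. madd C f g \<in> hom C A B) \<and>
        (\<forall>f \<in> hom C A B. mneg C f \<in> hom C A B) \<and>
        (\<forall>f \<in> hom C A B. \<forall>g \<in> hom C A B. \<forall>h \<in> hom C A B.
            madd C (madd C f g) h = madd C f (madd C g h)) \<and>
        (\<forall>f \<in> hom C A B. \<forall>g \<in> hom C A B. madd C f g = madd C g f) \<and>
        (\<forall>f \<in> hom C A B. madd C f (zer C A B) = f) \<and>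
        (\<forall>f \<in> hom C A B. madd C f (mneg C f) = zer C A B)) \<and>
    \<comment> \<open>composition is bilinear\<close>
    (\<forall>A \<in> Ob C. \<forall>B \<in> Ob C. \<forall>D \<in> Ob C.
       \<forall>f \<in> hom C A B. \<forall>f' \<in> hom C A B. \<forall>g \<in> hom C B D. \<forall>g' \<in> hom C B D.
        cmp C g (madd C f f') = madd C (cmp C g f) (cmp C g f') \<and>
        cmp C (madd C g g') f = madd C (cmp C g f) (cmp C g' f)) \<and>
    \<comment> \<open>zero object\<close>
    zob C \<in> Ob C \<and>
    (\<forall>A \<in> Ob C. hom C (zob C) A = {zer C (zob C) A} \<and> hom C A (zob C) = {zer C A (zob C)}) \<and>
    \<comment> \<open>binary biproducts\<close>
    (\<forall>A \<in> Ob C. \<forall>B \<in> Ob C.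
        dsum C A B \<in> Ob C \<and>
        in1 C A B \<in> hom C A (dsum C A B) \<and> in2 C A B \<in> hom C B (dsum C A B) \<and>
        pj1 C A B \<in> hom C (dsum C A B) A \<and> pj2 C A B \<in> hom C (dsum C A B) B \<and>
        cmp C (pj1 C A B) (in1 C A B) = idm C A \<and>
        cmp C (pj2 C A B) (in2 C A B) = idm C B \<and>
        cmp C (pj1 C A B) (in2 C A B) = zer C B A \<and>
        cmp C (pj2 C A B) (in1 C A B) = zer C A B \<and>
        madd C (cmp C (in1 C A B) (pj1 C A B)) (cmp C (in2 C A B) (pj2 C A B))
          = idm C (dsum C A B))"

definition cat_automorphism ::
  "('o,'m) addcat \<Rightarrow> ('o \<Rightarrow> 'o) \<Rightarrow> ('m \<Rightarrow> 'm) \<Rightarrow> bool" where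
  "cat_automorphism C SO SM \<longleftrightarrow>
    (\<forall>A \<in> Ob C. \<forall>B \<in> Ob C. \<forall>f \<in> hom C A B. SM f \<in> hom C (SO A) (SO B)) \<and>
    (\<forall>A \<in> Ob C. SM (idm C A) = idm C (SO A)) \<and>
    (\<forall>A \<in> Ob C. \<forall>B \<in> Ob C. \<forall>D \<in> Ob C. \<forall>f \<in> hom C A B. \<forall>g \<in> hom C B D.
        SM (cmp C g f) = cmp C (SM g) (SM f)) \<and>
    bij_betw SO (Ob C) (Ob C) \<and> bij_betw SM (Mor C) (Mor C)"

definition msum :: "('o,'m) addcat \<Rightarrow> 'o \<Rightarrow> 'o \<Rightarrow> 'm list \<Rightarrow> 'm" where
  "msum C X Y fs = foldr (madd C) fs (zer C X Y)"

definition sgnm :: "('o,'m) addcat \<Rightarrow> nat \<Rightarrow> 'm \<Rightarrow> 'm" where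
  "sgnm C k f = (if even k then f else mneg C f)"

text \<open>2x2 matrix [[a,b],[c,d]] : X1 + X2 -> Y1 + Y2 (rows = target summands).\<close>
definition mat2 :: "('o,'m) addcat \<Rightarrow> 'o \<Rightarrow> 'o \<Rightarrow> 'o \<Rightarrow> 'o \<Rightarrow> 'm \<Rightarrow> 'm \<Rightarrow> 'm \<Rightarrow> 'm \<Rightarrow> 'm" where
  "mat2 C X1 X2 Y1 Y2 a b c d = msum C (dsum C X1 X2) (dsum C Y1 Y2)
     [cmp C (in1 C Y1 Y2) (cmp C a (pj1 C X1 X2)),
      cmp C (in1 C Y1 Y2) (cmp C b (pj2 C X1 X2)),
      cmp C (in2 C Y1 Y2) (cmp C c (pj1 C X1 X2)),
      cmp C (in2 C Y1 Y2) (cmp C d (pj2 C X1 X2))]"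

definition tri :: "('o,'m) addcat \<Rightarrow> 'o \<Rightarrow> 'o \<Rightarrow> 'o \<Rightarrow> 'o" where
  "tri C X Y Z = dsum C X (dsum C Y Z)"

definition tin :: "('o,'m) addcat \<Rightarrow> 'o \<Rightarrow> 'o \<Rightarrow> 'o \<Rightarrow> nat \<Rightarrow> 'm" where
  "tin C X Y Z i = (if i = 1 then in1 C X (dsum C Y Z)
       else if i = 2 then cmp C (in2 C X (dsum C Y Z)) (in1 C Y Z)
       else cmp C (in2 C X (dsum C Y Z)) (in2 C Y Z))"

definition tpj :: "('o,'m) addcat \<Rightarrow> 'o \<Rightarrow> 'o \<Rightarrow> 'o \<Rightarrow> nat \<Rightarrow> 'm" where
  "tpj C X Y Z i = (if i = 1 then pj1 C X (dsum C Y Z)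
       else if i = 2 then cmp C (pj1 C Y Z) (pj2 C X (dsum C Y Z))
       else cmp C (pj2 C Y Z) (pj2 C X (dsum C Y Z)))"

definition mat3 :: "('o,'m) addcat \<Rightarrow> 'o \<Rightarrow> 'o \<Rightarrow> 'o \<Rightarrow> 'o \<Rightarrow> 'o \<Rightarrow> 'o
                    \<Rightarrow> (nat \<Rightarrow> nat \<Rightarrow> 'm) \<Rightarrow> 'm" where
  "mat3 C X1 X2 X3 Y1 Y2 Y3 m = msum C (tri C X1 X2 X3) (tri C Y1 Y2 Y3)
     [cmp C (tin C Y1 Y2 Y3 i) (cmp C (m i j) (tpj C X1 X2 X3 j)). i \<leftarrow> [1,2,3], j \<leftarrow> [1,2,3]]"

definition canon :: "('o,'m) addcat \<Rightarrow> ('o \<Rightarrow> 'o) \<Rightarrow> ('m \<Rightarrow> 'm) \<Rightarrow> 'o \<Rightarrow> 'o \<Rightarrow> 'm" where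
  "canon C SO SM X Y = madd C (cmp C (SM (in1 C X Y)) (pj1 C (SO X) (SO Y)))
                              (cmp C (SM (in2 C X Y)) (pj2 C (SO X) (SO Y)))"

text \<open>A sequence A_1 -> ... -> A_n -> Sigma A_1 is a pair of lists of length n:
  objects [A_1,...,A_n] and morphisms [alpha_1,...,alpha_n]; indices are 1-based.\<close>

type_synonym ('o,'m) nseq = "'o list \<times> 'm list"

definition ob :: "('o,'m) nseq \<Rightarrow> nat \<Rightarrow> 'o" where
  "ob S i = fst S ! (i - 1)"

definition mo :: "('o,'m) nseq \<Rightarrow> nat \<Rightarrow> 'm" where
  "mo S i = snd S ! (i - 1)"

definition mkseq :: "nat \<Rightarrow> (nat \<Rightarrow> 'o) \<Rightarrow> (nat \<Rightarrow> 'm) \<Rightarrow> ('o,'m) nseq" where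
  "mkseq n f g = (map f [1..<n+1], map g [1..<n+1])"

definition is_nseq :: "('o,'m) addcat \<Rightarrow> ('o \<Rightarrow> 'o) \<Rightarrow> nat \<Rightarrow> ('o,'m) nseq \<Rightarrow> bool" where
  "is_nseq C SO n S \<longleftrightarrow> length (fst S) = n \<and> length (snd S) = n \<and>
     (\<forall>i \<in> {1..n}. ob S i \<in> Ob C) \<and>
     (\<forall>i. 1 \<le> i \<and> i < n \<longrightarrow> mo S i \<in> hom C (ob S i) (ob S (i+1))) \<and>
     mo S n \<in> hom C (ob S n) (SO (ob S 1))"

definition rot :: "('o,'m) addcat \<Rightarrow> ('o \<Rightarrow> 'o) \<Rightarrow> ('m \<Rightarrow> 'm) \<Rightarrow> nat
                   \<Rightarrow> ('o,'m) nseq \<Rightarrow> ('o,'m) nseq" where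
  "rot C SO SM n S = mkseq n
     (\<lambda>i. if i < n then ob S (i+1) else SO (ob S 1))
     (\<lambda>i. if i < n then mo S (i+1) else sgnm C n (SM (mo S 1)))"

definition seqmor :: "('o,'m) addcat \<Rightarrow> ('m \<Rightarrow> 'm) \<Rightarrow> nat
                      \<Rightarrow> ('o,'m) nseq \<Rightarrow> ('o,'m) nseq \<Rightarrow> (nat \<Rightarrow> 'm) \<Rightarrow> bool" where
  "seqmor C SM n A B \<phi> \<longleftrightarrow>
     (\<forall>i \<in> {1..n}. \<phi> i \<in> hom C (ob A i) (ob B i)) \<and>
     (\<forall>i. 1 \<le> i \<and> i < n \<longrightarrow> cmp C (\<phi> (i+1)) (mo A i) = cmp C (mo B i) (\<phi> i)) \<and>
     cmp C (SM (\<phi> 1)) (mo A n) = cmp C (mo B n) (\<phi> n)"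

definition seqiso :: "('o,'m) addcat \<Rightarrow> ('m \<Rightarrow> 'm) \<Rightarrow> nat
                      \<Rightarrow> ('o,'m) nseq \<Rightarrow> ('o,'m) nseq \<Rightarrow> (nat \<Rightarrow> 'm) \<Rightarrow> bool" where
  "seqiso C SM n A B \<phi> \<longleftrightarrow> seqmor C SM n A B \<phi> \<and>
     (\<forall>i \<in> {1..n}. \<exists>g \<in> hom C (ob B i) (ob A i).
        cmp C g (\<phi> i) = idm C (ob A i) \<and> cmp C (\<phi> i) g = idm C (ob B i))"

definition is_dsum_seq :: "('o,'m) addcat \<Rightarrow> ('m \<Rightarrow> 'm) \<Rightarrow> nat
      \<Rightarrow> ('o,'m) nseq \<Rightarrow> ('o,'m) nseq \<Rightarrow> ('o,'m) nseq \<Rightarrow> bool" where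
  "is_dsum_seq C SM n A B S \<longleftrightarrow>
     (\<exists>i1 i2 p1 p2. seqmor C SM n A S i1 \<and> seqmor C SM n B S i2 \<and>
        seqmor C SM n S A p1 \<and> seqmor C SM n S B p2 \<and>
        (\<forall>i \<in> {1..n}.
           cmp C (p1 i) (i1 i) = idm C (ob A i) \<and> cmp C (p2 i) (i2 i) = idm C (ob B i) \<and>
           cmp C (p1 i) (i2 i) = zer C (ob B i) (ob A i) \<and>
           cmp C (p2 i) (i1 i) = zer C (ob A i) (ob B i) \<and>
           madd C (cmp C (i1 i) (p1 i)) (cmp C (i2 i) (p2 i)) = idm C (ob S i)))"

definition is_summand_seq :: "('o,'m) addcat \<Rightarrow> ('m \<Rightarrow> 'm) \<Rightarrow> nat
      \<Rightarrow> ('o,'m) nseq \<Rightarrow> ('o,'m) nseq \<Rightarrow> bool" where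
  "is_summand_seq C SM n A B \<longleftrightarrow>
     (\<exists>\<phi> \<psi>. seqmor C SM n A B \<phi> \<and> seqmor C SM n B A \<psi> \<and>
        (\<forall>i \<in> {1..n}. cmp C (\<psi> i) (\<phi> i) = idm C (ob A i)))"

text \<open>Mapping cone of phi : A -> B; the last map lands in Sigma(A_2 + B_1) via
  the canonical identification Sigma A_2 + Sigma B_1 = Sigma(A_2 + B_1).\<close>
definition cone :: "('o,'m) addcat \<Rightarrow> ('o \<Rightarrow> 'o) \<Rightarrow> ('m \<Rightarrow> 'm) \<Rightarrow> nat
      \<Rightarrow> ('o,'m) nseq \<Rightarrow> ('o,'m) nseq \<Rightarrow> (nat \<Rightarrow> 'm) \<Rightarrow> ('o,'m) nseq" where
  "cone C SO SM n A B \<phi> =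
    (let RA = (\<lambda>i. if i < n then ob A (i+1) else SO (ob A 1)) in
     mkseq n
      (\<lambda>i. dsum C (RA i) (ob B i))
      (\<lambda>i. if i < n then
             mat2 C (RA i) (ob B i) (RA (i+1)) (ob B (i+1))
               (mneg C (mo A (i+1))) (zer C (ob B i) (RA (i+1)))
               (\<phi> (i+1)) (mo B i)
           else
             cmp C (canon C SO SM (ob A 2) (ob B 1))
               (mat2 C (SO (ob A 1)) (ob B n) (SO (ob A 2)) (SO (ob B 1))
                  (mneg C (SM (mo A 1))) (zer C (ob B n) (SO (ob A 2)))
                  (SM (\<phi> 1)) (mo B n))))"

definition N1 :: "('o,'m) addcat \<Rightarrow> ('o \<Rightarrow> 'o) \<Rightarrow> ('m \<Rightarrow> 'm) \<Rightarrow> nat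
                  \<Rightarrow> ('o,'m) nseq set \<Rightarrow> bool" where
  "N1 C SO SM n N \<longleftrightarrow>
    \<comment> \<open>(a)\<close>
    (\<forall>A \<in> N. \<forall>B \<in> N. \<forall>S. is_nseq C SO n S \<and> is_dsum_seq C SM n A B S \<longrightarrow> S \<in> N) \<and>
    (\<forall>B \<in> N. \<forall>A. is_nseq C SO n A \<and> is_summand_seq C SM n A B \<longrightarrow> A \<in> N) \<and>
    (\<forall>A \<in> N. \<forall>B \<phi>. is_nseq C SO n B \<and> seqiso C SM n A B \<phi> \<longrightarrow> B \<in> N) \<and>
    \<comment> \<open>(b)\<close>
    (\<forall>A \<in> Ob C. mkseq n (\<lambda>i. if i \<le> 2 then A else zob C)
        (\<lambda>i. if i = 1 then idm C A
             else if i = 2 then zer C A (zob C)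
             else if i < n then zer C (zob C) (zob C)
             else zer C (zob C) (SO A)) \<in> N) \<and>
    \<comment> \<open>(c)\<close>
    (\<forall>A1 \<in> Ob C. \<forall>A2 \<in> Ob C. \<forall>f \<in> hom C A1 A2.
        \<exists>S \<in> N. ob S 1 = A1 \<and> ob S 2 = A2 \<and> mo S 1 = f)"

definition N2 :: "('o,'m) addcat \<Rightarrow> ('o \<Rightarrow> 'o) \<Rightarrow> ('m \<Rightarrow> 'm) \<Rightarrow> nat
                  \<Rightarrow> ('o,'m) nseq set \<Rightarrow> bool" where
  "N2 C SO SM n N \<longleftrightarrow>
    (\<forall>S. is_nseq C SO n S \<longrightarrow> (S \<in> N \<longleftrightarrow> rot C SO SM n S \<in> N))"

definition N3 :: "('o,'m) addcat \<Rightarrow> ('o \<Rightarrow> 'o) \<Rightarrow> ('m \<Rightarrow> 'm) \<Rightarrow> nat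
                  \<Rightarrow> ('o,'m) nseq set \<Rightarrow> bool" where
  "N3 C SO SM n N \<longleftrightarrow>
    (\<forall>A \<in> N. \<forall>B \<in> N. \<forall>\<phi>1 \<phi>2.
       \<phi>1 \<in> hom C (ob A 1) (ob B 1) \<and> \<phi>2 \<in> hom C (ob A 2) (ob B 2) \<and>
       cmp C \<phi>2 (mo A 1) = cmp C (mo B 1) \<phi>1 \<longrightarrow>
       (\<exists>\<phi>. \<phi> 1 = \<phi>1 \<and> \<phi> 2 = \<phi>2 \<and> seqmor C SM n A B \<phi>))"

definition N4 :: "('o,'m) addcat \<Rightarrow> ('o \<Rightarrow> 'o) \<Rightarrow> ('m \<Rightarrow> 'm) \<Rightarrow> nat
                  \<Rightarrow> ('o,'m) nseq set \<Rightarrow> bool" where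
  "N4 C SO SM n N \<longleftrightarrow>
    (\<forall>A \<in> N. \<forall>B \<in> N. \<forall>\<phi>1 \<phi>2.
       \<phi>1 \<in> hom C (ob A 1) (ob B 1) \<and> \<phi>2 \<in> hom C (ob A 2) (ob B 2) \<and>
       cmp C \<phi>2 (mo A 1) = cmp C (mo B 1) \<phi>1 \<longrightarrow>
       (\<exists>\<phi>. \<phi> 1 = \<phi>1 \<and> \<phi> 2 = \<phi>2 \<and> seqmor C SM n A B \<phi> \<and>
            cone C SO SM n A B \<phi> \<in> N))"

text \<open>The sequence D of (N4*). Objects/morphisms with indices outside their range are
  replaced by the zero object / zero morphisms ("padding"); a zero summand X + 0
  stands for the deleted summand (this is isomorphic, and N is closed under isomorphism).
  Here Cs is the third n-angle A_2 -> B_2 -> C_3 -> ... -> C_n -> Sigma A_2.\<close>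
definition Dseq :: "('o,'m) addcat \<Rightarrow> ('o \<Rightarrow> 'o) \<Rightarrow> ('m \<Rightarrow> 'm) \<Rightarrow> nat
      \<Rightarrow> ('o,'m) nseq \<Rightarrow> ('o,'m) nseq \<Rightarrow> ('o,'m) nseq
      \<Rightarrow> (nat \<Rightarrow> 'm) \<Rightarrow> (nat \<Rightarrow> 'm) \<Rightarrow> ('o,'m) nseq" where
  "Dseq C SO SM n A B Cs \<phi> \<psi> =
    (let oA = (\<lambda>i. if 1 \<le> i \<and> i \<le> n then ob A i else zob C);
         oB = (\<lambda>i. if 1 \<le> i \<and> i \<le> n then ob B i else zob C);
         oC = (\<lambda>i. if 3 \<le> i \<and> i \<le> n then ob Cs i else zob C);
         al = (\<lambda>i. if 1 \<le> i \<and> i < n then mo A i else zer C (oA i) (oA (i+1)));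
         be = (\<lambda>i. if 1 \<le> i \<and> i < n then mo B i else zer C (oB i) (oB (i+1)));
         ga = (\<lambda>i. if 3 \<le> i \<and> i < n then mo Cs i else zer C (oC i) (oC (i+1)));
         ph = (\<lambda>i. if 1 \<le> i \<and> i \<le> n then \<phi> i else zer C (oA i) (oB i));
         ps = (\<lambda>j. if 1 \<le> j \<and> j \<le> 2*n-5 then \<psi> j
                   else if even j then zer C (oA (j div 2 + 3)) (oC (j div 2 + 2))
                   else zer C (oB ((j+1) div 2 + 2)) (oC ((j+1) div 2 + 2)));
         oD = (\<lambda>i. if i = 1 then ob A 3 else tri C (oA (i+2)) (oB (i+1)) (oC i))
     in mkseq n oD
      (\<lambda>i. if i = 1 then
             \<comment> \<open>d_1 = [alpha_3; phi_3] (third component into C_2 = 0)\<close>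
             msum C (ob A 3) (oD 2)
               [cmp C (tin C (oA 4) (oB 3) (oC 2) 1) (al 3),
                cmp C (tin C (oA 4) (oB 3) (oC 2) 2) (ph 3),
                cmp C (tin C (oA 4) (oB 3) (oC 2) 3) (zer C (ob A 3) (oC 2))]
           else if i < n then
             (let k = i - 1 in
              mat3 C (oA (k+3)) (oB (k+2)) (oC (k+1)) (oA (k+4)) (oB (k+3)) (oC (k+2))
                (\<lambda>r c. if r = 1 then (if c = 1 then mneg C (al (k+3))
                                       else if c = 2 then zer C (oB (k+2)) (oA (k+4))
                                       else zer C (oC (k+1)) (oA (k+4)))
                       else if r = 2 then (if c = 1 then sgnm C (k+1) (ph (k+3))
                                       else if c = 2 then mneg C (be (k+2))
                                       else zer C (oC (k+1)) (oB (k+3)))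
                       else (if c = 1 then ps (2*k)
                             else if c = 2 then ps (2*k-1)
                             else ga (k+1))))
           else
             cmp C (SM (mo A 2)) (cmp C (mo Cs n) (tpj C (oA (n+2)) (oB (n+1)) (oC n) 3))))"

definition N4star :: "('o,'m) addcat \<Rightarrow> ('o \<Rightarrow> 'o) \<Rightarrow> ('m \<Rightarrow> 'm) \<Rightarrow> nat
                  \<Rightarrow> ('o,'m) nseq set \<Rightarrow> bool" where
  "N4star C SO SM n N \<longleftrightarrow>
    (\<forall>A \<in> N. \<forall>B \<in> N. \<forall>Cs \<in> N. \<forall>\<phi>2.
       ob B 1 = ob A 1 \<and> ob Cs 1 = ob A 2 \<and> ob Cs 2 = ob B 2 \<and> mo Cs 1 = \<phi>2 \<and>
       cmp C \<phi>2 (mo A 1) = mo B 1 \<longrightarrow>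
       (\<exists>\<phi> \<psi>. \<phi> 1 = idm C (ob A 1) \<and> \<phi> 2 = \<phi>2 \<and> seqmor C SM n A B \<phi> \<and>
          (\<forall>k. 1 \<le> k \<and> k \<le> n - 2 \<longrightarrow>
               \<psi> (2*k-1) \<in> hom C (ob B (k+2)) (ob Cs (k+2))) \<and>
          (\<forall>k. 1 \<le> k \<and> k \<le> n - 3 \<longrightarrow>
               \<psi> (2*k) \<in> hom C (ob A (k+3)) (ob Cs (k+2))) \<and>
          cmp C (mo Cs n) (\<psi> (2*n-5)) = cmp C (SM (mo A 1)) (mo B n) \<and>
          Dseq C SO SM n A B Cs \<phi> \<psi> \<in> N))"

end

theory Submission
  imports Defs
begin

text \<open>
  For (N4) to (N4*): the mapping cone of a completion \<open>(1, \<phi>\<^sub>2, \<dots>, \<phi>\<^sub>n)\<close> contains the contractible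
  summand \<open>A\<^sub>1 = A\<^sub>1\<close>; splitting it off leaves an n-angle
  \<open>A\<^sub>2 \<rightarrow> A\<^sub>3 \<oplus> B\<^sub>2 \<rightarrow> A\<^sub>4 \<oplus> B\<^sub>3 \<rightarrow> \<dots> \<rightarrow> B\<^sub>n \<rightarrow> \<Sigma>A\<^sub>2\<close>. It maps to the third n-angle by the identity on \<open>A\<^sub>2\<close>
  and the projection \<open>A\<^sub>3 \<oplus> B\<^sub>2 \<rightarrow> B\<^sub>2\<close>; the same reduction applied to a completion of this square,
  followed by splitting off the summand \<open>B\<^sub>2 = B\<^sub>2\<close>, yields the required sequence.

  For (N4*) to (N4): let \<open>Y = A\<^sub>2 \<oplus> B\<^sub>1\<close>. Adding contractible n-angles to \<open>A\<close> and \<open>B\<close> gives n-angles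
  beginning with \<open>A\<^sub>1 \<oplus> B\<^sub>1 \<rightarrow> Y \<oplus> B\<^sub>2\<close> and \<open>[0 \<beta>\<^sub>1] : A\<^sub>1 \<oplus> B\<^sub>1 \<rightarrow> B\<^sub>2\<close>, where the former has components
  \<open>\<alpha>\<^sub>1\<close>, \<open>-\<phi>\<^sub>1\<close> and \<open>1\<close>. The second factors through the first by the split epimorphism
  \<open>[\<phi>\<^sub>2 \<beta>\<^sub>1 1] : Y \<oplus> B\<^sub>2 \<rightarrow> B\<^sub>2\<close>, whose n-angle is \<open>Y \<oplus> B\<^sub>2 \<rightarrow> B\<^sub>2 \<rightarrow> 0 \<rightarrow> \<dots> \<rightarrow> 0 \<rightarrow> \<Sigma>Y \<rightarrow> \<Sigma>(Y \<oplus> B\<^sub>2)\<close>. The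
  sequence that (N4*) provides for these three n-angles is, up to signs, the left rotation of the
  mapping cone of a morphism \<open>(\<phi>\<^sub>1, \<phi>\<^sub>2, \<dots>)\<close>.
\<close>

section \<open>Matrix calculus in additive categories\<close>

locale additive =
  fixes C :: "('o, 'm) addcat"
  assumes additive: "additive_cat C"
begin

abbreviation comp (infixr "\<cdot>" 75) where "g \<cdot> f \<equiv> cmp C g f"
abbreviation plus (infixr "\<oplus>" 65) where "f \<oplus> g \<equiv> madd C f g"
abbreviation neg ("\<ominus> _" [80] 80) where "\<ominus> f \<equiv> mneg C f"
abbreviation MC where "MC \<equiv> Mor C"
abbreviation OC where "OC \<equiv> Ob C"
abbreviation src where "src \<equiv> Dom C"
abbreviation tgt where "tgt \<equiv> Cod C"
abbreviation one where "one \<equiv> idm C"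
abbreviation zero where "zero \<equiv> zer C"
abbreviation zo where "zo \<equiv> zob C"
abbreviation ds where "ds \<equiv> dsum C"

section \<open>Category laws with typing expressed by source and target\<close>

lemma in_hom: "f \<in> hom C A B \<longleftrightarrow> f \<in> MC \<and> src f = A \<and> tgt f = B"
  by (auto simp: hom_def)

lemma src_tgt_Ob [simp]: "f \<in> MC \<Longrightarrow> src f \<in> OC" "f \<in> MC \<Longrightarrow> tgt f \<in> OC"
  using additive by (auto simp: additive_cat_def)

lemma idm_type [simp]:
  "A \<in> OC \<Longrightarrow> one A \<in> MC" "A \<in> OC \<Longrightarrow> src (one A) = A" "A \<in> OC \<Longrightarrow> tgt (one A) = A"
  using additive by (auto simp: additive_cat_def in_hom)

lemma cmp_hom: 
  assumes "f \<in> MC" "g \<in> MC" "src g = tgt f" shows "g \<cdot> f \<in> hom C (src f) (tgt g)"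
proof -
  have "\<forall>A \<in> Ob C. \<forall>B \<in> Ob C. \<forall>D \<in> Ob C. \<forall>f \<in> hom C A B. \<forall>g \<in> hom C B D.
        cmp C g f \<in> hom C A D" using additive unfolding additive_cat_def by (elim conjE) assumption
  moreover have "f \<in> hom C (src f) (tgt f)" "g \<in> hom C (tgt f) (tgt g)" using assms by (auto simp: in_hom)
  ultimately show ?thesis using assms src_tgt_Ob by blast
qed

lemma cmp_type [simp]:
  assumes "f \<in> MC" "g \<in> MC" "src g = tgt f"
  shows "g \<cdot> f \<in> MC" "src (g \<cdot> f) = src f" "tgt (g \<cdot> f) = tgt g"
  using cmp_hom[OF assms] by (auto simp: in_hom)

lemma cmp_idm [simp]:
  "f \<in> MC \<Longrightarrow> tgt f = A \<Longrightarrow> one A \<cdot> f = f" "f \<in> MC \<Longrightarrow> src f = A \<Longrightarrow> f \<cdot> one A = f"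
proof -
  have "\<forall>A \<in> OC. \<forall>B \<in> OC. \<forall>f \<in> hom C A B. one B \<cdot> f = f \<and> f \<cdot> one A = f"
    using additive unfolding additive_cat_def by (elim conjE) assumption
  from this[rule_format, of "src f" "tgt f" f]
  show "f \<in> MC \<Longrightarrow> tgt f = A \<Longrightarrow> one A \<cdot> f = f" "f \<in> MC \<Longrightarrow> src f = A \<Longrightarrow> f \<cdot> one A = f"
    by (auto simp: in_hom)
qed

lemma cmp_assoc [simp]:
  assumes "f \<in> MC" "g \<in> MC" "h \<in> MC" "src g = tgt f" "src h = tgt g"
  shows "(h \<cdot> g) \<cdot> f = h \<cdot> g \<cdot> f"
proof -
  have *: "\<forall>A \<in> Ob C. \<forall>B \<in> Ob C. \<forall>D \<in> Ob C. \<forall>E \<in> Ob C.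
       \<forall>f \<in> hom C A B. \<forall>g \<in> hom C B D. \<forall>h \<in> hom C D E.
        cmp C h (cmp C g f) = cmp C (cmp C h g) f"
    using additive unfolding additive_cat_def by (elim conjE) assumption
  have "f \<in> hom C (src f) (tgt f)" "g \<in> hom C (tgt f) (tgt g)" "h \<in> hom C (tgt g) (tgt h)"
    using assms by (auto simp: in_hom)
  then show ?thesis using * assms src_tgt_Ob by metis
qed

section \<open>The abelian group structure of the hom-sets\<close>

lemma hom_group:
  assumes "A \<in> OC" "B \<in> OC"
  shows "zero A B \<in> hom C A B"
    "f \<in> hom C A B \<Longrightarrow> g \<in> hom C A B \<Longrightarrow> f \<oplus> g \<in> hom C A B"
    "f \<in> hom C A B \<Longrightarrow> \<ominus> f \<in> hom C A B"
    "f \<in> hom C A B \<Longrightarrow> g \<in> hom C A B \<Longrightarrow> h \<in> hom C A B \<Longrightarrow> (f \<oplus> g) \<oplus> h = f \<oplus> g \<oplus> h"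
    "f \<in> hom C A B \<Longrightarrow> g \<in> hom C A B \<Longrightarrow> f \<oplus> g = g \<oplus> f"
    "f \<in> hom C A B \<Longrightarrow> f \<oplus> zero A B = f"
    "f \<in> hom C A B \<Longrightarrow> f \<oplus> \<ominus> f = zero A B"
proof -
  have "\<forall>A \<in> OC. \<forall>B \<in> OC.
        zero A B \<in> hom C A B \<and>
        (\<forall>f \<in> hom C A B. \<forall>g \<in> hom C A B. f \<oplus> g \<in> hom C A B) \<and>
        (\<forall>f \<in> hom C A B. \<ominus> f \<in> hom C A B) \<and>
        (\<forall>f \<in> hom C A B. \<forall>g \<in> hom C A B. \<forall>h \<in> hom C A B. (f \<oplus> g) \<oplus> h = f \<oplus> g \<oplus> h) \<and>
        (\<forall>f \<in> hom C A B. \<forall>g \<in> hom C A B. f \<oplus> g = g \<oplus> f) \<and>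
        (\<forall>f \<in> hom C A B. f \<oplus> zero A B = f) \<and>
        (\<forall>f \<in> hom C A B. f \<oplus> \<ominus> f = zero A B)"
    using additive unfolding additive_cat_def by (elim conjE) assumption
  note ax = bspec[OF bspec[OF this assms(1)] assms(2)]
  show "zero A B \<in> hom C A B"
    "f \<in> hom C A B \<Longrightarrow> g \<in> hom C A B \<Longrightarrow> f \<oplus> g \<in> hom C A B"
    "f \<in> hom C A B \<Longrightarrow> \<ominus> f \<in> hom C A B"
    "f \<in> hom C A B \<Longrightarrow> g \<in> hom C A B \<Longrightarrow> h \<in> hom C A B \<Longrightarrow> (f \<oplus> g) \<oplus> h = f \<oplus> g \<oplus> h"
    "f \<in> hom C A B \<Longrightarrow> g \<in> hom C A B \<Longrightarrow> f \<oplus> g = g \<oplus> f"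
    "f \<in> hom C A B \<Longrightarrow> f \<oplus> zero A B = f"
    "f \<in> hom C A B \<Longrightarrow> f \<oplus> \<ominus> f = zero A B"
    using ax by meson+
qed

lemma zer_type [simp]:
  assumes "A \<in> OC" "B \<in> OC"
  shows "zero A B \<in> MC" "src (zero A B) = A" "tgt (zero A B) = B"
  using hom_group(1) assms by (auto simp: in_hom)

lemma madd_type [simp]:
  assumes "f \<in> MC" "g \<in> MC" "src g = src f" "tgt g = tgt f"
  shows "f \<oplus> g \<in> MC" "src (f \<oplus> g) = src f" "tgt (f \<oplus> g) = tgt f"
  using hom_group(2)[of "src f" "tgt f" f g] assms by (auto simp: in_hom)

lemma mneg_type [simp]:
  assumes "f \<in> MC" shows "\<ominus> f \<in> MC" "src (\<ominus> f) = src f" "tgt (\<ominus> f) = tgt f"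
  using hom_group(3)[of "src f" "tgt f" f] assms by (auto simp: in_hom)

lemma madd_assoc [simp]:
  assumes "f \<in> MC" "g \<in> MC" "h \<in> MC" "src g = src f" "tgt g = tgt f" "src h = src f" "tgt h = tgt f"
  shows "(f \<oplus> g) \<oplus> h = f \<oplus> g \<oplus> h"
  using hom_group(4)[of "src f" "tgt f" f g h] assms by (auto simp: in_hom)

lemma madd_commute:
  assumes "f \<in> MC" "g \<in> MC" "src g = src f" "tgt g = tgt f"
  shows "f \<oplus> g = g \<oplus> f"
  using hom_group(5)[of "src f" "tgt f" f g] assms by (auto simp: in_hom)

lemma madd_left_commute:
  assumes "f \<in> MC" "g \<in> MC" "h \<in> MC" "src g = src f" "tgt g = tgt f" "src h = src f" "tgt h = tgt f"
  shows "f \<oplus> g \<oplus> h = g \<oplus> f \<oplus> h"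
proof -
  have "f \<oplus> g \<oplus> h = (f \<oplus> g) \<oplus> h" using assms by simp
  also have "\<dots> = (g \<oplus> f) \<oplus> h" using madd_commute[of f g] assms by simp
  finally show ?thesis using assms by simp
qed

lemma madd_zer [simp]:
  "f \<in> MC \<Longrightarrow> src f = A \<Longrightarrow> tgt f = B \<Longrightarrow> f \<oplus> zero A B = f"
  "f \<in> MC \<Longrightarrow> src f = A \<Longrightarrow> tgt f = B \<Longrightarrow> zero A B \<oplus> f = f"
proof -
  show *: "f \<in> MC \<Longrightarrow> src f = A \<Longrightarrow> tgt f = B \<Longrightarrow> f \<oplus> zero A B = f"
    using hom_group(6,7)[of "src f" "tgt f" f] by (auto simp: in_hom)
  show "f \<in> MC \<Longrightarrow> src f = A \<Longrightarrow> tgt f = B \<Longrightarrow> zero A B \<oplus> f = f"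
    using * madd_commute[of f "zero A B"] src_tgt_Ob by auto
qed

lemma madd_mneg [simp]:
  "f \<in> MC \<Longrightarrow> f \<oplus> \<ominus> f = zero (src f) (tgt f)"
  "f \<in> MC \<Longrightarrow> \<ominus> f \<oplus> f = zero (src f) (tgt f)"
proof -
  show *: "f \<in> MC \<Longrightarrow> f \<oplus> \<ominus> f = zero (src f) (tgt f)"
    using hom_group(6,7)[of "src f" "tgt f" f] by (auto simp: in_hom)
  show "f \<in> MC \<Longrightarrow> \<ominus> f \<oplus> f = zero (src f) (tgt f)"
    using * madd_commute[of f "\<ominus> f"] by auto
qed

lemma mneg_unique:
  assumes "f \<in> MC" "g \<in> MC" "src g = src f" "tgt g = tgt f" "f \<oplus> g = zero (src f) (tgt f)"
  shows "g = \<ominus> f"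
proof -
  have "\<ominus> f = \<ominus> f \<oplus> (f \<oplus> g)" using assms by simp
  also have "\<dots> = (\<ominus> f \<oplus> f) \<oplus> g" using assms(1-4) madd_assoc[of "\<ominus> f" f g] by simp
  also have "\<dots> = g" using assms by simp
  finally show ?thesis by simp
qed

section \<open>Bilinearity of composition, zeros and negatives\<close>

lemma cmp_madd [simp]:
  assumes "f \<in> MC" "f' \<in> MC" "g \<in> MC" "src g = tgt f" "tgt f' = tgt f" "src f' = src f"
  shows "g \<cdot> (f \<oplus> f') = g \<cdot> f \<oplus> g \<cdot> f'"
proof -
  have *: "\<forall>A \<in> Ob C. \<forall>B \<in> Ob C. \<forall>D \<in> Ob C.
       \<forall>f \<in> hom C A B. \<forall>f' \<in> hom C A B. \<forall>g \<in> hom C B D. \<forall>g' \<in> hom C B D.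
        cmp C g (madd C f f') = madd C (cmp C g f) (cmp C g f') \<and>
        cmp C (madd C g g') f = madd C (cmp C g f) (cmp C g' f)"
    using additive unfolding additive_cat_def by (elim conjE) assumption
  have "f \<in> hom C (src f) (tgt f)" "f' \<in> hom C (src f) (tgt f)" "g \<in> hom C (tgt f) (tgt g)"
    using assms by (auto simp: in_hom)
  then show ?thesis using * assms src_tgt_Ob by meson
qed

lemma madd_cmp [simp]:
  assumes "f \<in> MC" "g \<in> MC" "g' \<in> MC" "src g = tgt f" "tgt g' = tgt g" "src g' = src g"
  shows "(g \<oplus> g') \<cdot> f = g \<cdot> f \<oplus> g' \<cdot> f"
proof -
  have *: "\<forall>A \<in> Ob C. \<forall>B \<in> Ob C. \<forall>D \<in> Ob C.
       \<forall>f \<in> hom C A B. \<forall>f' \<in> hom C A B. \<forall>g \<in> hom C B D. \<forall>g' \<in> hom C B D.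
        cmp C g (madd C f f') = madd C (cmp C g f) (cmp C g f') \<and>
        cmp C (madd C g g') f = madd C (cmp C g f) (cmp C g' f)"
    using additive unfolding additive_cat_def by (elim conjE) assumption
  have "f \<in> hom C (src f) (tgt f)" "g \<in> hom C (tgt f) (tgt g)" "g' \<in> hom C (tgt f) (tgt g)"
    using assms by (auto simp: in_hom)
  then show ?thesis using * assms src_tgt_Ob by meson
qed

text \<open>Cancellation; it is applied to composites with a zero morphism, which bilinearity shows
  to equal their own double.\<close>

lemma madd_idem_zer:
  assumes "f \<in> MC" "f \<oplus> f = f" shows "f = zero (src f) (tgt f)"
proof -
  have "zero (src f) (tgt f) = (f \<oplus> f) \<oplus> \<ominus> f" using assms(2) assms(1) by (simp del: madd_assoc)
  also have "\<dots> = f" using assms(1) by simp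
  finally show ?thesis by simp
qed

lemma cmp_zer [simp]:
  assumes "g \<in> MC" "src g = B" "A \<in> OC" shows "g \<cdot> zero A B = zero A (tgt g)"
proof -
  have B: "B \<in> OC" using assms by auto
  have "g \<cdot> zero A B \<oplus> g \<cdot> zero A B = g \<cdot> (zero A B \<oplus> zero A B)"
    using assms B by (simp del: madd_zer)
  then have "g \<cdot> zero A B \<oplus> g \<cdot> zero A B = g \<cdot> zero A B" using assms B by simp
  from madd_idem_zer[OF _ this] show ?thesis using assms B by simp
qed

lemma zer_cmp [simp]:
  assumes "g \<in> MC" "tgt g = A" "B \<in> OC" shows "zero A B \<cdot> g = zero (src g) B"
proof -
  have A: "A \<in> OC" using assms by auto
  have "zero A B \<cdot> g \<oplus> zero A B \<cdot> g = (zero A B \<oplus> zero A B) \<cdot> g"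
    using assms A by (simp del: madd_zer)
  then have "zero A B \<cdot> g \<oplus> zero A B \<cdot> g = zero A B \<cdot> g" using assms A by simp
  from madd_idem_zer[OF _ this] show ?thesis using assms A by simp
qed

lemma mneg_mneg [simp]: "f \<in> MC \<Longrightarrow> \<ominus> (\<ominus> f) = f"
  using mneg_unique[of "\<ominus> f" f] by simp

lemma mneg_zer [simp]: "A \<in> OC \<Longrightarrow> B \<in> OC \<Longrightarrow> \<ominus> (zero A B) = zero A B"
  using mneg_unique[of "zero A B" "zero A B"] by simp

lemma cmp_mneg [simp]:
  assumes "f \<in> MC" "g \<in> MC" "src g = tgt f" shows "g \<cdot> \<ominus> f = \<ominus> (g \<cdot> f)"
proof -
  have "g \<cdot> f \<oplus> g \<cdot> \<ominus> f = g \<cdot> (f \<oplus> \<ominus> f)" using assms by (simp del: madd_mneg)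
  then show ?thesis using assms mneg_unique[of "g \<cdot> f" "g \<cdot> \<ominus> f"] by simp
qed

lemma mneg_cmp [simp]:
  assumes "f \<in> MC" "g \<in> MC" "src g = tgt f" shows "(\<ominus> g) \<cdot> f = \<ominus> (g \<cdot> f)"
proof -
  have "g \<cdot> f \<oplus> (\<ominus> g) \<cdot> f = (g \<oplus> \<ominus> g) \<cdot> f" using assms by (simp del: madd_mneg)
  then show ?thesis using assms mneg_unique[of "g \<cdot> f" "(\<ominus> g) \<cdot> f"] by simp
qed

lemma mneg_madd [simp]:
  assumes "f \<in> MC" "g \<in> MC" "src g = src f" "tgt g = tgt f"
  shows "\<ominus> (f \<oplus> g) = \<ominus> f \<oplus> \<ominus> g"
proof -
  have "(f \<oplus> g) \<oplus> (\<ominus> f \<oplus> \<ominus> g) = f \<oplus> \<ominus> f \<oplus> g \<oplus> \<ominus> g"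
    using assms madd_left_commute[of g "\<ominus> f" "\<ominus> g"] by (simp del: madd_mneg)
  also have "\<dots> = zero (src f) (tgt f)" using assms by simp
  finally show ?thesis using assms mneg_unique[of "f \<oplus> g" "\<ominus> f \<oplus> \<ominus> g"] by simp
qed

section \<open>Zero object, biproducts and block matrices\<close>

lemma zob_Ob [simp]: "zo \<in> OC"
  using additive by (auto simp: additive_cat_def)

lemma zob_mor:
  assumes "f \<in> MC" shows "src f = zo \<Longrightarrow> f = zero zo (tgt f)" "tgt f = zo \<Longrightarrow> f = zero (src f) zo"
proof -
  have *: "\<forall>A \<in> Ob C. hom C (zob C) A = {zer C (zob C) A} \<and> hom C A (zob C) = {zer C A (zob C)}"
    using additive unfolding additive_cat_def by (elim conjE) assumption
  have f: "f \<in> hom C (src f) (tgt f)" using assms by (auto simp: in_hom)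
  show "src f = zo \<Longrightarrow> f = zero zo (tgt f)" "tgt f = zo \<Longrightarrow> f = zero (src f) zo"
    using * f src_tgt_Ob[OF assms] by auto
qed

lemma one_zob [simp]: "one zo = zero zo zo"
  using zob_mor(1)[of "one zo"] by simp

lemma biprod_ax:
  "\<forall>A \<in> Ob C. \<forall>B \<in> Ob C.
        dsum C A B \<in> Ob C \<and>
        in1 C A B \<in> hom C A (dsum C A B) \<and> in2 C A B \<in> hom C B (dsum C A B) \<and>
        pj1 C A B \<in> hom C (dsum C A B) A \<and> pj2 C A B \<in> hom C (dsum C A B) B \<and>
        cmp C (pj1 C A B) (in1 C A B) = idm C A \<and>
        cmp C (pj2 C A B) (in2 C A B) = idm C B \<and>
        cmp C (pj1 C A B) (in2 C A B) = zer C B A \<and>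
        cmp C (pj2 C A B) (in1 C A B) = zer C A B \<and>
        madd C (cmp C (in1 C A B) (pj1 C A B)) (cmp C (in2 C A B) (pj2 C A B))
          = idm C (dsum C A B)"
  using additive unfolding additive_cat_def by (elim conjE) assumption

lemma dsum_Ob [simp]: "A \<in> OC \<Longrightarrow> B \<in> OC \<Longrightarrow> ds A B \<in> OC"
  using biprod_ax by blast

lemma biprod_type:
  assumes "A \<in> OC" "B \<in> OC"
  shows "in1 C A B \<in> MC" "src (in1 C A B) = A" "tgt (in1 C A B) = ds A B"
    "in2 C A B \<in> MC" "src (in2 C A B) = B" "tgt (in2 C A B) = ds A B"
    "pj1 C A B \<in> MC" "src (pj1 C A B) = ds A B" "tgt (pj1 C A B) = A"
    "pj2 C A B \<in> MC" "src (pj2 C A B) = ds A B" "tgt (pj2 C A B) = B"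
  using biprod_ax assms by (auto simp: in_hom)

lemma biprod_eq:
  assumes "A \<in> OC" "B \<in> OC"
  shows "pj1 C A B \<cdot> in1 C A B = one A" "pj2 C A B \<cdot> in2 C A B = one B"
    "pj1 C A B \<cdot> in2 C A B = zero B A" "pj2 C A B \<cdot> in1 C A B = zero A B"
    "in1 C A B \<cdot> pj1 C A B \<oplus> in2 C A B \<cdot> pj2 C A B = one (ds A B)"
  using biprod_ax assms by (auto simp: in_hom)

text \<open>\<open>pair\<close> and \<open>copair\<close> read their summands off the source and target of the components, so that every
  composite of matrices simplifies to nested pairs of copairs and equations are checked entrywise.\<close>

definition pair where
  "pair f g = in1 C (tgt f) (tgt g) \<cdot> f \<oplus> in2 C (tgt f) (tgt g) \<cdot> g"

definition copair where
  "copair f g = f \<cdot> pj1 C (src f) (src g) \<oplus> g \<cdot> pj2 C (src f) (src g)"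

lemma pair_type [simp]:
  assumes "f \<in> MC" "g \<in> MC" "src g = src f"
  shows "pair f g \<in> MC" "src (pair f g) = src f" "tgt (pair f g) = ds (tgt f) (tgt g)"
  using assms by (auto simp: pair_def biprod_type)

lemma copair_type [simp]:
  assumes "f \<in> MC" "g \<in> MC" "tgt g = tgt f"
  shows "copair f g \<in> MC" "src (copair f g) = ds (src f) (src g)" "tgt (copair f g) = tgt f"
  using assms by (auto simp: copair_def biprod_type)

lemma cmp_copair [simp]:
  "f \<in> MC \<Longrightarrow> g \<in> MC \<Longrightarrow> h \<in> MC \<Longrightarrow> tgt g = tgt f \<Longrightarrow> src h = tgt f
    \<Longrightarrow> h \<cdot> copair f g = copair (h \<cdot> f) (h \<cdot> g)"
  by (simp add: copair_def biprod_type)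

lemma pair_cmp [simp]:
  "f \<in> MC \<Longrightarrow> g \<in> MC \<Longrightarrow> h \<in> MC \<Longrightarrow> src g = src f \<Longrightarrow> tgt h = src f
    \<Longrightarrow> pair f g \<cdot> h = pair (f \<cdot> h) (g \<cdot> h)"
  by (simp add: pair_def biprod_type)

lemma pj_pair:
  assumes "f \<in> MC" "g \<in> MC" "src g = src f"
  shows "tgt f = A \<Longrightarrow> tgt g = B \<Longrightarrow> pj1 C A B \<cdot> pair f g = f"
    "tgt f = A \<Longrightarrow> tgt g = B \<Longrightarrow> pj2 C A B \<cdot> pair f g = g"
  using assms by (auto simp: pair_def biprod_type biprod_eq simp flip: cmp_assoc)

lemma copair_pair [simp]:
  assumes "f \<in> MC" "g \<in> MC" "h \<in> MC" "k \<in> MC" "tgt g = tgt f" "src h = src k" "src f = tgt h" "src g = tgt k"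
  shows "copair f g \<cdot> pair h k = f \<cdot> h \<oplus> g \<cdot> k"
  using assms pj_pair[of h k] by (simp add: copair_def biprod_type)

lemma in_eq_pair:
  assumes "A \<in> OC" "B \<in> OC"
  shows "in1 C A B = pair (one A) (zero A B)" "in2 C A B = pair (zero B A) (one B)"
  using assms by (simp_all add: pair_def biprod_type)

lemma pj_eq_copair:
  assumes "A \<in> OC" "B \<in> OC"
  shows "pj1 C A B = copair (one A) (zero B A)" "pj2 C A B = copair (zero A B) (one B)"
  using assms by (simp_all add: copair_def biprod_type)

lemma one_dsum:
  assumes "A \<in> OC" "B \<in> OC"
  shows "one (ds A B) = pair (copair (one A) (zero B A)) (copair (zero A B) (one B))"
  using biprod_eq(5)[OF assms] assms unfolding pj_eq_copair[OF assms, symmetric] pair_def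
  by (simp add: biprod_type)

lemma pair_zer [simp]:
  "A \<in> OC \<Longrightarrow> B \<in> OC \<Longrightarrow> D \<in> OC \<Longrightarrow> pair (zero A B) (zero A D) = zero A (ds B D)"
  by (simp add: pair_def biprod_type)

lemma copair_zer [simp]:
  "A \<in> OC \<Longrightarrow> B \<in> OC \<Longrightarrow> D \<in> OC \<Longrightarrow> copair (zero A D) (zero B D) = zero (ds A B) D"
  by (simp add: copair_def biprod_type)

lemma mneg_pair [simp]:
  "f \<in> MC \<Longrightarrow> g \<in> MC \<Longrightarrow> src g = src f \<Longrightarrow> \<ominus> (pair f g) = pair (\<ominus> f) (\<ominus> g)"
  by (simp add: pair_def biprod_type)

lemma mneg_copair [simp]:
  "f \<in> MC \<Longrightarrow> g \<in> MC \<Longrightarrow> tgt g = tgt f \<Longrightarrow> \<ominus> (copair f g) = copair (\<ominus> f) (\<ominus> g)"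
  by (simp add: copair_def biprod_type)

lemma madd_pair [simp]:
  assumes "f \<in> MC" "g \<in> MC" "f' \<in> MC" "g' \<in> MC" "src g = src f" "src f' = src f" "src g' = src f"
    "tgt f' = tgt f" "tgt g' = tgt g"
  shows "pair f g \<oplus> pair f' g' = pair (f \<oplus> f') (g \<oplus> g')"
  using assms madd_left_commute[of "in2 C (tgt f) (tgt g) \<cdot> g" "in1 C (tgt f) (tgt g) \<cdot> f'"]
  by (simp add: pair_def biprod_type)

lemma madd_copair [simp]:
  assumes "f \<in> MC" "g \<in> MC" "f' \<in> MC" "g' \<in> MC" "tgt g = tgt f" "tgt f' = tgt f" "tgt g' = tgt f"
    "src f' = src f" "src g' = src g"
  shows "copair f g \<oplus> copair f' g' = copair (f \<oplus> f') (g \<oplus> g')"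
  using assms madd_left_commute[of "g \<cdot> pj2 C (src f) (src g)" "f' \<cdot> pj1 C (src f) (src g)"]
  by (simp add: copair_def biprod_type)

text \<open>The rewrite direction fixes the normal form: a matrix is a \<open>pair\<close> of its
  rows, and each row is a \<open>copair\<close>.\<close>

lemma copair_of_pairs [simp]:
  assumes "a \<in> MC" "b \<in> MC" "c \<in> MC" "d \<in> MC"
    "src c = src a" "src d = src b" "tgt b = tgt a" "tgt d = tgt c"
  shows "copair (pair a c) (pair b d) = pair (copair a b) (copair c d)"
  using assms madd_left_commute[of "in2 C (tgt a) (tgt c) \<cdot> c \<cdot> pj1 C (src a) (src b)"
        "in1 C (tgt a) (tgt c) \<cdot> b \<cdot> pj2 C (src a) (src b)"
        "in2 C (tgt a) (tgt c) \<cdot> d \<cdot> pj2 C (src a) (src b)"]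
  by (simp add: pair_def copair_def biprod_type)

text \<open>\<open>pair_zer\<close> collapses a zero block to a single zero morphism, which hides it
  from \<open>copair_of_pairs\<close>; these rules restore its rows.\<close>

lemma copair_pair_zer [simp]:
  assumes "a \<in> MC" "c \<in> MC" "src c = src a" "X \<in> OC" "tgt a = Y" "tgt c = Z"
  shows "copair (pair a c) (zero X (ds Y Z)) = pair (copair a (zero X Y)) (copair c (zero X Z))"
    "copair (zero X (ds Y Z)) (pair a c) = pair (copair (zero X Y) a) (copair (zero X Z) c)"
proof -
  have [simp]: "Y \<in> OC" "Z \<in> OC" using assms by auto
  have *: "zero X (ds Y Z) = pair (zero X Y) (zero X Z)" using assms by simp
  show "copair (pair a c) (zero X (ds Y Z)) = pair (copair a (zero X Y)) (copair c (zero X Z))"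
    "copair (zero X (ds Y Z)) (pair a c) = pair (copair (zero X Y) a) (copair (zero X Z) c)"
    unfolding * using assms by (simp_all del: pair_zer)
qed

lemma mat2_eq:
  assumes "a \<in> hom C X1 Y1" "b \<in> hom C X2 Y1" "c \<in> hom C X1 Y2" "d \<in> hom C X2 Y2"
  shows "mat2 C X1 X2 Y1 Y2 a b c d = pair (copair a b) (copair c d)"
proof -
  have [simp]: "X1 \<in> OC" "X2 \<in> OC" "Y1 \<in> OC" "Y2 \<in> OC" using assms by (auto simp: in_hom)
  show ?thesis using assms
    by (simp add: mat2_def msum_def in_hom in_eq_pair pj_eq_copair)
qed

lemma mat3_eq:
  assumes "m 1 1 \<in> hom C X1 Y1" "m 1 2 \<in> hom C X2 Y1" "m 1 3 \<in> hom C X3 Y1"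
   "m 2 1 \<in> hom C X1 Y2" "m 2 2 \<in> hom C X2 Y2" "m 2 3 \<in> hom C X3 Y2"
   "m 3 1 \<in> hom C X1 Y3" "m 3 2 \<in> hom C X2 Y3" "m 3 3 \<in> hom C X3 Y3"
  shows "mat3 C X1 X2 X3 Y1 Y2 Y3 m = pair (copair (m 1 1) (copair (m 1 2) (m 1 3)))
     (pair (copair (m 2 1) (copair (m 2 2) (m 2 3))) (copair (m 3 1) (copair (m 3 2) (m 3 3))))"
proof -
  have [simp]: "X1 \<in> OC" "X2 \<in> OC" "Y1 \<in> OC" "Y2 \<in> OC" "X3 \<in> OC" "Y3 \<in> OC"
    using assms by (auto simp: in_hom)
  show ?thesis using assms
    by (simp add: mat3_def msum_def tri_def tin_def tpj_def in_hom in_eq_pair pj_eq_copair)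
qed

end

section \<open>Automorphisms are additive\<close>

locale additive_auto = additive C for C :: "('o, 'm) addcat" +
  fixes SO :: "'o \<Rightarrow> 'o" and SM :: "'m \<Rightarrow> 'm"
  assumes auto: "cat_automorphism C SO SM"
begin

lemma SO_bij: "bij_betw SO OC OC"
  using auto unfolding cat_automorphism_def by (elim conjE) assumption

lemma SM_bij: "bij_betw SM MC MC"
  using auto unfolding cat_automorphism_def by (elim conjE) assumption

lemma SO_Ob [simp]: "A \<in> OC \<Longrightarrow> SO A \<in> OC"
  using SO_bij by (rule bij_betw_apply)

lemma SM_type [simp]:
  assumes "f \<in> MC"
  shows "SM f \<in> MC" "src (SM f) = SO (src f)" "tgt (SM f) = SO (tgt f)"
proof -
  have "\<forall>A \<in> Ob C. \<forall>B \<in> Ob C. \<forall>f \<in> hom C A B. SM f \<in> hom C (SO A) (SO B)"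
    using auto unfolding cat_automorphism_def by (elim conjE) assumption
  from this[rule_format, of "src f" "tgt f" f]
  show "SM f \<in> MC" "src (SM f) = SO (src f)" "tgt (SM f) = SO (tgt f)"
    using assms by (auto simp: in_hom)
qed

lemma SM_one [simp]: "A \<in> OC \<Longrightarrow> SM (one A) = one (SO A)"
proof -
  have "\<forall>A \<in> OC. SM (one A) = one (SO A)"
    using auto unfolding cat_automorphism_def by (elim conjE) assumption
  then show "A \<in> OC \<Longrightarrow> SM (one A) = one (SO A)" ..
qed

lemma SM_cmp [simp]:
  assumes "f \<in> MC" "g \<in> MC" "src g = tgt f" shows "SM (g \<cdot> f) = SM g \<cdot> SM f"
proof -
  have "\<forall>A \<in> Ob C. \<forall>B \<in> Ob C. \<forall>D \<in> Ob C. \<forall>f \<in> hom C A B. \<forall>g \<in> hom C B D.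
        SM (cmp C g f) = cmp C (SM g) (SM f)"
    using auto unfolding cat_automorphism_def by (elim conjE) assumption
  from this[rule_format, of "src f" "tgt f" "tgt g" f g]
  show ?thesis using assms by (auto simp: in_hom)
qed

text \<open>A preimage exists because \<open>SM\<close> is onto the morphisms; injectivity of
  \<open>SO\<close> on objects forces its source and target.\<close>

lemma SM_full:
  assumes "g \<in> MC" "src g = SO A" "tgt g = SO B" "A \<in> OC" "B \<in> OC"
  obtains f where "f \<in> MC" "src f = A" "tgt f = B" "SM f = g"
proof -
  obtain f where f: "f \<in> MC" "SM f = g" 
    using assms(1) bij_betw_imp_surj_on[OF SM_bij] by (metis imageE)
  then have eq: "SO (src f) = SO A" "SO (tgt f) = SO B" using SM_type(2,3)[OF f(1)] assms(2,3) by (simp_all only:)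
  have "src f = A" "tgt f = B"
    using inj_onD[OF bij_betw_imp_inj_on[OF SO_bij] eq(1)]
      inj_onD[OF bij_betw_imp_inj_on[OF SO_bij] eq(2)] f(1) assms(4,5) by auto
  then show thesis using that f by blast
qed

lemma SM_faithful: "f \<in> MC \<Longrightarrow> g \<in> MC \<Longrightarrow> SM f = SM g \<Longrightarrow> f = g"
  by (rule inj_onD[OF bij_betw_imp_inj_on[OF SM_bij]])

text \<open>Fullness pulls a morphism into \<Sigma>0 back to one into the zero object, of which
  there is only one. So \<Sigma>0 acts as a zero object although it need not equal
  \<open>zo\<close>.\<close>

lemma SO_zob_mor:
  assumes "f \<in> MC" "A \<in> OC" shows "src f = SO A \<Longrightarrow> tgt f = SO zo \<Longrightarrow> f = zero (SO A) (SO zo)"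
proof -
  assume f: "src f = SO A" "tgt f = SO zo"
  obtain f' where f': "f' \<in> MC" "src f' = A" "tgt f' = zo" "SM f' = f"
    using SM_full[OF assms(1) f assms(2) zob_Ob] .
  obtain z where z: "z \<in> MC" "src z = A" "tgt z = zo" "SM z = zero (SO A) (SO zo)"
    by (rule SM_full[of "zero (SO A) (SO zo)" A zo]) (use assms in simp_all)
  have "f' = z" using f' z zob_mor(2)[of f'] zob_mor(2)[of z] by metis
  then show ?thesis using f' z by simp
qed

text \<open>A zero morphism factors through the zero object, and \<Sigma> carries this to a
  factorization through \<Sigma>0.\<close>

lemma SM_zer [simp]:
  assumes "A \<in> OC" "B \<in> OC" shows "SM (zero A B) = zero (SO A) (SO B)"
proof -
  have "zero A B = zero zo B \<cdot> zero A zo" using assms by simp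
  then have "SM (zero A B) = SM (zero zo B \<cdot> zero A zo)" by (rule arg_cong)
  also have "\<dots> = SM (zero zo B) \<cdot> SM (zero A zo)" using assms by (simp del: cmp_zer zer_cmp)
  also have "SM (zero A zo) = zero (SO A) (SO zo)"
    using SO_zob_mor[of "SM (zero A zo)" A] assms by simp
  also have "SM (zero zo B) \<cdot> \<dots> = zero (SO A) (SO B)" using assms by simp
  finally show ?thesis .
qed

lemma one_SO_zob [simp]: "one (SO zo) = zero (SO zo) (SO zo)"
  using SM_one[of zo] by simp

text \<open>Additivity of \<Sigma> is not yet available, so the left side is written as \<Sigma>h.
  Faithfulness shows that h fixes both inclusions, hence h is the identity.\<close>

lemma SM_biprod:
  assumes "A \<in> OC" "B \<in> OC"
  shows "SM (in1 C A B) \<cdot> SM (pj1 C A B) \<oplus> SM (in2 C A B) \<cdot> SM (pj2 C A B) = one (SO (ds A B))"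
    (is "?h = _")
proof -
  note [simp] = assms biprod_type biprod_eq
  have type: "?h \<in> MC" "src ?h = SO (ds A B)" "tgt ?h = SO (ds A B)" by simp_all
  then obtain h where h: "h \<in> MC" "src h = ds A B" "tgt h = ds A B" "SM h = ?h"
    by (rule SM_full[of ?h "ds A B" "ds A B"]) (use assms in simp_all)
  have c: "SM (pj1 C A B) \<cdot> SM (in1 C A B) = one (SO A)" "SM (pj2 C A B) \<cdot> SM (in1 C A B) = zero (SO A) (SO B)"
     "SM (pj1 C A B) \<cdot> SM (in2 C A B) = zero (SO B) (SO A)" "SM (pj2 C A B) \<cdot> SM (in2 C A B) = one (SO B)"
    by (simp_all flip: SM_cmp)
  have "SM (h \<cdot> in1 C A B) = ?h \<cdot> SM (in1 C A B)" "SM (h \<cdot> in2 C A B) = ?h \<cdot> SM (in2 C A B)"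
    using h by simp_all
  then have "SM (h \<cdot> in1 C A B) = SM (in1 C A B)" "SM (h \<cdot> in2 C A B) = SM (in2 C A B)"
    using c by simp_all
  then have i: "h \<cdot> in1 C A B = in1 C A B" "h \<cdot> in2 C A B = in2 C A B"
    using h SM_faithful[of "h \<cdot> in1 C A B" "in1 C A B"] SM_faithful[of "h \<cdot> in2 C A B" "in2 C A B"]
    by simp_all
  have "h = h \<cdot> (in1 C A B \<cdot> pj1 C A B \<oplus> in2 C A B \<cdot> pj2 C A B)" using h by simp
  also have "\<dots> = (h \<cdot> in1 C A B) \<cdot> pj1 C A B \<oplus> (h \<cdot> in2 C A B) \<cdot> pj2 C A B"
    using h by (simp del: biprod_eq)
  also have "\<dots> = one (ds A B)" unfolding i by simp
  finally have "h = one (ds A B)" .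
  then show ?thesis using h(4) by simp
qed

text \<open>The sum factors through the biproduct of the source with itself, as the diagonal
  \<open>v\<close> followed by the row \<open>u\<close>; \<Sigma> preserves composition and this
  biproduct.\<close>

lemma SM_madd [simp]:
  assumes "f \<in> MC" "g \<in> MC" "src g = src f" "tgt g = tgt f"
  shows "SM (f \<oplus> g) = SM f \<oplus> SM g"
proof -
  define A where "A = src f"
  define i1 i2 p1 p2 where "i1 = in1 C A A" "i2 = in2 C A A" "p1 = pj1 C A A" "p2 = pj2 C A A"
  note d = this
  have [simp]: "A \<in> OC" "src f = A" "src g = A" using assms by (auto simp: A_def)
  have t [simp]: "i1 \<in> MC" "src i1 = A" "tgt i1 = ds A A" "i2 \<in> MC" "src i2 = A" "tgt i2 = ds A A"
    "p1 \<in> MC" "src p1 = ds A A" "tgt p1 = A" "p2 \<in> MC" "src p2 = ds A A" "tgt p2 = A"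
    by (auto simp: d biprod_type)
  have b: "p1 \<cdot> i1 = one A" "p2 \<cdot> i2 = one A" "p1 \<cdot> i2 = zero A A" "p2 \<cdot> i1 = zero A A"
    by (auto simp: d biprod_eq)
  define u v where "u = f \<cdot> p1 \<oplus> g \<cdot> p2" "v = i1 \<oplus> i2"
  note uv = this
  have [simp]: "u \<in> MC" "src u = ds A A" "tgt u = tgt f" "v \<in> MC" "src v = A" "tgt v = ds A A"
    using assms by (auto simp: uv)
  have pv: "p1 \<cdot> v = one A" "p2 \<cdot> v = one A" by (auto simp: uv b)
  have ui: "u \<cdot> i1 = f" "u \<cdot> i2 = g" using assms by (auto simp: uv b)
  have "u \<cdot> v = f \<oplus> g" using assms by (simp add: uv(1) pv)
  then have "SM (f \<oplus> g) = SM u \<cdot> SM v" by (metis SM_cmp \<open>u \<in> MC\<close> \<open>v \<in> MC\<close> \<open>src u = ds A A\<close> \<open>tgt v = ds A A\<close>)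
  also have "\<dots> = SM u \<cdot> (SM i1 \<cdot> SM p1 \<oplus> SM i2 \<cdot> SM p2) \<cdot> SM v"
    using SM_biprod[of A A] by (simp flip: d)
  also have "\<dots> = SM (u \<cdot> i1) \<cdot> SM (p1 \<cdot> v) \<oplus> SM (u \<cdot> i2) \<cdot> SM (p2 \<cdot> v)"
    by simp
  also have "\<dots> = SM f \<oplus> SM g" using assms by (simp only: pv ui) simp
  finally show ?thesis .
qed

lemma SM_mneg [simp]: "f \<in> MC \<Longrightarrow> SM (\<ominus> f) = \<ominus> (SM f)"
  by (rule mneg_unique) (simp_all flip: SM_madd)

section \<open>The canonical morphism from \<Sigma>A \<oplus> \<Sigma>B to \<Sigma>(A \<oplus>
  B)\<close>

lemma canon_type [simp]:
  assumes "A \<in> OC" "B \<in> OC"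
  shows "canon C SO SM A B \<in> MC" "src (canon C SO SM A B) = ds (SO A) (SO B)"
    "tgt (canon C SO SM A B) = SO (ds A B)"
  using assms by (auto simp: canon_def biprod_type)

lemma SM_pair [simp]:
  assumes "f \<in> MC" "g \<in> MC" "src g = src f"
  shows "SM (pair f g) = canon C SO SM (tgt f) (tgt g) \<cdot> pair (SM f) (SM g)"
  using assms by (simp add: canon_def pj_pair biprod_type) (simp add: pair_def biprod_type)

lemma SM_copair_canon [simp]:
  assumes "f \<in> MC" "g \<in> MC" "tgt g = tgt f" "src f = A" "src g = B"
  shows "SM (copair f g) \<cdot> canon C SO SM A B = copair (SM f) (SM g)"
proof -
  have [simp]: "A \<in> OC" "B \<in> OC" using assms by auto
  have "copair f g \<cdot> in1 C A B = f" "copair f g \<cdot> in2 C A B = g"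
    using assms by (auto simp: in_eq_pair)
  then have "SM (copair f g) \<cdot> SM (in1 C A B) = SM f" "SM (copair f g) \<cdot> SM (in2 C A B) = SM g"
    using assms by (auto simp: biprod_type simp flip: SM_cmp)
  then have "(SM (copair f g) \<cdot> SM (in1 C A B)) \<cdot> pj1 C (SO A) (SO B) \<oplus>
     (SM (copair f g) \<cdot> SM (in2 C A B)) \<cdot> pj2 C (SO A) (SO B) = copair (SM f) (SM g)"
    using assms by (simp add: copair_def del: cmp_assoc)
  then show ?thesis using assms by (simp add: canon_def biprod_type)
qed

text \<open>Composites are normalized by nesting to the right, so the cancellation of
  \<open>canon\<close> is needed also in front of a further factor.\<close>

lemma SM_copair_canon_cmp [simp]:
  assumes "f \<in> MC" "g \<in> MC" "tgt g = tgt f" "src f = A" "src g = B" "h \<in> MC" "tgt h = ds (SO A) (SO B)"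
  shows "SM (copair f g) \<cdot> canon C SO SM A B \<cdot> h = copair (SM f) (SM g) \<cdot> h"
proof -
  have [simp]: "A \<in> OC" "B \<in> OC" using assms by auto
  have "SM (copair f g) \<cdot> canon C SO SM A B \<cdot> h = (SM (copair f g) \<cdot> canon C SO SM A B) \<cdot> h"
    using assms by (simp del: SM_copair_canon cmp_copair)
  then show ?thesis using assms by simp
qed

lemma canon_pair:
  assumes "f \<in> MC" "g \<in> MC" "src g = src f" "tgt f = SO A" "tgt g = SO B" "A \<in> OC" "B \<in> OC"
  shows "canon C SO SM A B \<cdot> pair f g = SM (in1 C A B) \<cdot> f \<oplus> SM (in2 C A B) \<cdot> g"
  using assms by (simp add: canon_def pj_pair biprod_type)

lemma mneg_canon_pair [simp]:
  assumes "f \<in> MC" "g \<in> MC" "src g = src f" "tgt f = SO A" "tgt g = SO B" "A \<in> OC" "B \<in> OC"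
  shows "\<ominus> (canon C SO SM A B \<cdot> pair f g) = canon C SO SM A B \<cdot> pair (\<ominus> f) (\<ominus> g)"
  using assms by (simp flip: cmp_mneg)

end

section \<open>Sequences and mapping cones\<close>

text \<open>The filler \<open>Z\<close> stands for what follows position n: \<Sigma>A_1 in mapping
  cones, a zero object in the reduced sequences and in the sequence of
  \<open>N4star\<close>.\<close>

definition padob :: "nat \<Rightarrow> 'o \<Rightarrow> ('o, 'm) nseq \<Rightarrow> nat \<Rightarrow> 'o" where
  "padob n Z S i = (if 1 \<le> i \<and> i \<le> n then ob S i else Z)"

lemma ob_mkseq [simp]: "1 \<le> i \<Longrightarrow> i \<le> n \<Longrightarrow> ob (mkseq n f g) i = f i"
  and mo_mkseq [simp]: "1 \<le> i \<Longrightarrow> i \<le> n \<Longrightarrow> mo (mkseq n f g) i = g i"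
  by (simp_all add: ob_def mo_def mkseq_def del: upt_Suc)

lemma Suc_Suc_0 [simp]: "Suc (Suc 0) = 2" by simp

locale nseqs = additive_auto C SO SM
  for C :: "('o, 'm) addcat" and SO :: "'o \<Rightarrow> 'o" and SM :: "'m \<Rightarrow> 'm" +
  fixes n :: nat
  assumes n3: "3 \<le> n"
begin

lemma n_simps [simp]:
  "1 \<le> n" "Suc 0 \<le> n" "2 \<le> n" "3 \<le> n" "Suc 0 < n" "2 < n" "n \<noteq> 2" "n \<noteq> Suc 0" "0 < n"
  "2 \<noteq> n" "Suc 0 \<noteq> n" "\<not> n \<le> 2" "\<not> n \<le> Suc 0"
  using n3 by auto

lemma is_nseq_mkseq:
  assumes "\<And>i. 1 \<le> i \<Longrightarrow> i \<le> n \<Longrightarrow> f i \<in> OC"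
    and "\<And>i. 1 \<le> i \<Longrightarrow> i < n \<Longrightarrow> g i \<in> MC \<and> src (g i) = f i \<and> tgt (g i) = f (Suc i)"
    and "g n \<in> MC" "src (g n) = f n" "tgt (g n) = SO (f 1)"
  shows "is_nseq C SO n (mkseq n f g)"
  unfolding is_nseq_def
proof (intro conjI allI impI ballI)
  show "length (fst (mkseq n f g)) = n" "length (snd (mkseq n f g)) = n"
    by (simp_all add: mkseq_def)
  show "ob (mkseq n f g) i \<in> OC" if "i \<in> {1..n}" for i
    using assms(1)[of i] that by simp
  show "mo (mkseq n f g) i \<in> hom C (ob (mkseq n f g) i) (ob (mkseq n f g) (i + 1))"
    if "1 \<le> i \<and> i < n" for i using assms(2)[of i] that by (simp add: in_hom)
  show "mo (mkseq n f g) n \<in> hom C (ob (mkseq n f g) n) (SO (ob (mkseq n f g) 1))"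
    using assms(3-5) by (simp add: in_hom)
qed

lemma nseq_ob [simp]: "is_nseq C SO n S \<Longrightarrow> 1 \<le> i \<Longrightarrow> i \<le> n \<Longrightarrow> ob S i \<in> OC"
  unfolding is_nseq_def by simp

lemma nseq_mo [simp]:
  assumes "is_nseq C SO n S" "1 \<le> i" "i \<le> n"
  shows "mo S i \<in> MC" "src (mo S i) = ob S i"
proof -
  consider "i < n" | "i = n" using assms by linarith
  then show "mo S i \<in> MC" "src (mo S i) = ob S i"
    using assms unfolding is_nseq_def in_hom by (cases; simp)+
qed

lemma nseq_tgt [simp]:
  "is_nseq C SO n S \<Longrightarrow> 1 \<le> i \<Longrightarrow> i < n \<Longrightarrow> tgt (mo S i) = ob S (Suc i)"
  "is_nseq C SO n S \<Longrightarrow> tgt (mo S n) = SO (ob S 1)"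
  unfolding is_nseq_def in_hom by simp_all

definition padmo where
  "padmo Z S i = (if 1 \<le> i \<and> i < n then mo S i else zero (padob n Z S i) (padob n Z S (i + 1)))"

lemma padob_Ob [simp]: "is_nseq C SO n S \<Longrightarrow> Z \<in> OC \<Longrightarrow> padob n Z S i \<in> OC"
  by (simp add: padob_def)

lemma padmo_type [simp]:
  assumes "is_nseq C SO n S" "Z \<in> OC"
  shows "padmo Z S i \<in> MC" "src (padmo Z S i) = padob n Z S i" "tgt (padmo Z S i) = padob n Z S (Suc i)"
  using assms by (auto simp: padmo_def) (auto simp: padob_def)

lemma seqmor_type:
  assumes "seqmor C SM n A B \<phi>" "1 \<le> i" "i \<le> n"
  shows "\<phi> i \<in> MC" "src (\<phi> i) = ob A i" "tgt (\<phi> i) = ob B i"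
  using assms by (auto simp: seqmor_def in_hom)

lemma seqmor_commute:
  assumes "seqmor C SM n A B \<phi>" "1 \<le> i" "i < n"
  shows "\<phi> (Suc i) \<cdot> mo A i = mo B i \<cdot> \<phi> i"
  using assms by (auto simp: seqmor_def)

lemma seqmor_commute_last:
  assumes "seqmor C SM n A B \<phi>"
  shows "SM (\<phi> 1) \<cdot> mo A n = mo B n \<cdot> \<phi> n"
  using assms by (auto simp: seqmor_def)

lemma seqmorI:
  assumes "\<And>i::nat. 1 \<le> i \<Longrightarrow> i \<le> n \<Longrightarrow> \<phi> i \<in> MC \<and> src (\<phi> i) = ob A i \<and> tgt (\<phi> i) = ob B i"
    and "\<And>i. 1 \<le> i \<Longrightarrow> i < n \<Longrightarrow> \<phi> (Suc i) \<cdot> mo A i = mo B i \<cdot> \<phi> i"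
    and "SM (\<phi> 1) \<cdot> mo A n = mo B n \<cdot> \<phi> n"
  shows "seqmor C SM n A B \<phi>"
  using assms by (auto simp: seqmor_def in_hom)

lemma seqmor_comp:
  assumes "seqmor C SM n A B \<phi>" "seqmor C SM n B D \<psi>"
    and A: "is_nseq C SO n A" and B: "is_nseq C SO n B" and D: "is_nseq C SO n D"
  shows "seqmor C SM n A D (\<lambda>i. \<psi> i \<cdot> \<phi> i)"
proof (rule seqmorI)
  note [simp] = seqmor_type[OF assms(1)] seqmor_type[OF assms(2)] A B D
  show "\<psi> i \<cdot> \<phi> i \<in> MC \<and> src (\<psi> i \<cdot> \<phi> i) = ob A i \<and> tgt (\<psi> i \<cdot> \<phi> i) = ob D i"
    if "1 \<le> i" "i \<le> n" for i using that by simp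
  fix i :: nat assume "1 \<le> i" and i: "i < n"
  then have [simp]: "Suc 0 \<le> i" "i < n" "i \<le> n" "Suc i \<le> n" by simp_all
  have "(\<psi> (Suc i) \<cdot> \<phi> (Suc i)) \<cdot> mo A i = \<psi> (Suc i) \<cdot> mo B i \<cdot> \<phi> i"
    using seqmor_commute[OF assms(1), of i] by simp
  also have "\<dots> = (\<psi> (Suc i) \<cdot> mo B i) \<cdot> \<phi> i" by simp
  also have "\<dots> = mo D i \<cdot> \<psi> i \<cdot> \<phi> i"
    using seqmor_commute[OF assms(2), of i] by simp
  finally show "(\<psi> (Suc i) \<cdot> \<phi> (Suc i)) \<cdot> mo A i = mo D i \<cdot> \<psi> i \<cdot> \<phi> i" .
next
  note [simp] = seqmor_type[OF assms(1)] seqmor_type[OF assms(2)] A B D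
  have "SM (\<psi> 1 \<cdot> \<phi> 1) \<cdot> mo A n = SM (\<psi> 1) \<cdot> mo B n \<cdot> \<phi> n"
    using seqmor_commute_last[OF assms(1)] by simp
  also have "\<dots> = (SM (\<psi> 1) \<cdot> mo B n) \<cdot> \<phi> n" by simp
  also have "\<dots> = mo D n \<cdot> \<psi> n \<cdot> \<phi> n"
    using seqmor_commute_last[OF assms(2)] by simp
  finally show "SM (\<psi> 1 \<cdot> \<phi> 1) \<cdot> mo A n = mo D n \<cdot> \<psi> n \<cdot> \<phi> n" .
qed

section \<open>Objects and matrix entries of mapping cones\<close>

lemma cone_ob [simp]:
  "1 \<le> i \<Longrightarrow> i \<le> n \<Longrightarrow> ob (cone C SO SM n A B \<phi>) i = ds (padob n (SO (ob A 1)) A (Suc i)) (ob B i)"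
  by (auto simp: cone_def Let_def padob_def)

lemma cone_mo:
  assumes [simp]: "is_nseq C SO n A" "is_nseq C SO n B" and "seqmor C SM n A B \<phi>" "1 \<le> i" "i < n"
  shows "mo (cone C SO SM n A B \<phi>) i = pair (copair (\<ominus> (mo A (Suc i)))
     (zero (ob B i) (padob n (SO (ob A 1)) A (Suc (Suc i))))) (copair (\<phi> (Suc i)) (mo B i))"
proof -
  note [simp] = assms(1-3) seqmor_type[OF assms(3)]
  have "(mat2 C (ob A (Suc i)) (ob B i) (if Suc i < n then ob A (Suc (Suc i)) else SO (ob A 1)) (ob B (Suc i))
               (mneg C (mo A (Suc i))) (zer C (ob B i) (if Suc i < n then ob A (Suc (Suc i)) else SO (ob A 1)))
               (\<phi> (Suc i)) (mo B i)) = pair (copair (\<ominus> (mo A (Suc i)))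
     (zero (ob B i) (padob n (SO (ob A 1)) A (Suc (Suc i))))) (copair (\<phi> (Suc i)) (mo B i))"
  proof (cases "Suc i < n")
    case True then show ?thesis using assms(4,5) by (subst mat2_eq) (auto simp: in_hom padob_def)
  next
    case False then have "Suc i = n" using assms(5) by simp
    then show ?thesis using assms(4,5) nseq_tgt(2)[of A] by (subst mat2_eq) (auto simp: in_hom padob_def simp del: nseq_tgt(2))
  qed
  then show ?thesis using assms(4,5) by (cases "Suc i < n") (simp_all add: cone_def Let_def)
qed

lemma cone_mo_last:
  assumes [simp]: "is_nseq C SO n A" "is_nseq C SO n B" and "seqmor C SM n A B \<phi>"
  shows "mo (cone C SO SM n A B \<phi>) n = canon C SO SM (ob A 2) (ob B 1) \<cdot>
     pair (copair (\<ominus> (SM (mo A 1))) (zero (ob B n) (SO (ob A 2)))) (copair (SM (\<phi> 1)) (mo B n))"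
proof -
  note [simp] = assms(1-3) seqmor_type[OF assms(3)]
  show ?thesis by (simp add: cone_def Let_def in_hom mat2_eq)
qed

lemma is_nseq_cone:
  assumes [simp]: "is_nseq C SO n A" "is_nseq C SO n B" and "seqmor C SM n A B \<phi>"
  shows "is_nseq C SO n (cone C SO SM n A B \<phi>)"
proof -
  note [simp] = assms(1-3) seqmor_type[OF assms(3)]
  have "length (fst (cone C SO SM n A B \<phi>)) = n" "length (snd (cone C SO SM n A B \<phi>)) = n"
    by (simp_all add: cone_def Let_def mkseq_def)
  moreover have "mo (cone C SO SM n A B \<phi>) i \<in> hom C (ob (cone C SO SM n A B \<phi>) i) (ob (cone C SO SM n A B \<phi>) (i+1))"
    if "1 \<le> i" "i < n" for i
  proof (cases "Suc i < n")
    case True then show ?thesis using that by (auto simp: cone_mo in_hom padob_def)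
  next
    case False then have "Suc i = n" using that by simp
    then show ?thesis using that nseq_tgt(2)[of A] by (auto simp: cone_mo in_hom padob_def simp del: nseq_tgt(2))
  qed
  moreover have "mo (cone C SO SM n A B \<phi>) n \<in> hom C (ob (cone C SO SM n A B \<phi>) n) (SO (ob (cone C SO SM n A B \<phi>) 1))"
    by (auto simp: cone_mo_last in_hom padob_def)
  ultimately show ?thesis unfolding is_nseq_def by simp
qed

end

section \<open>Working forms of the axioms and vanishing of consecutive composites\<close>

locale pre_nangulated = nseqs C SO SM n
  for C :: "('o, 'm) addcat" and SO :: "'o \<Rightarrow> 'o" and SM :: "'m \<Rightarrow> 'm" and n :: nat +
  fixes N :: "('o, 'm) nseq set"
  assumes nseq_N [simp]: "S \<in> N \<Longrightarrow> is_nseq C SO n S"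
    and N1: "N1 C SO SM n N" and N2: "N2 C SO SM n N" and N3: "N3 C SO SM n N"
begin

lemma N_summand:
  assumes "B \<in> N" "is_nseq C SO n A" "seqmor C SM n A B s" "seqmor C SM n B A r"
    "\<And>i. 1 \<le> i \<Longrightarrow> i \<le> n \<Longrightarrow> r i \<cdot> s i = one (ob A i)"
  shows "A \<in> N"
proof -
  have *: "\<forall>B \<in> N. \<forall>A. is_nseq C SO n A \<and> is_summand_seq C SM n A B \<longrightarrow> A \<in> N"
    using N1 unfolding N1_def by (elim conjE) assumption
  have "is_summand_seq C SM n A B" unfolding is_summand_seq_def using assms(3-5)
    by (intro exI[of _ s] exI[of _ r]) simp
  then show ?thesis using *[rule_format, OF assms(1)] assms(2) by simp
qed

lemma N_iso:
  assumes "A \<in> N" "is_nseq C SO n B" "seqmor C SM n A B g"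
    "\<And>i. 1 \<le> i \<Longrightarrow> i \<le> n \<Longrightarrow> h i \<in> MC \<and> src (h i) = ob B i \<and> tgt (h i) = ob A i \<and>
       h i \<cdot> g i = one (ob A i) \<and> g i \<cdot> h i = one (ob B i)"
  shows "B \<in> N"
proof -
  have *: "\<forall>A \<in> N. \<forall>B \<phi>. is_nseq C SO n B \<and> seqiso C SM n A B \<phi> \<longrightarrow> B \<in> N"
    using N1 unfolding N1_def by (elim conjE) assumption
  have "\<exists>h\<in>hom C (ob B i) (ob A i). h \<cdot> g i = one (ob A i) \<and> g i \<cdot> h = one (ob B i)"
    if "i \<in> {1..n}" for i using assms(4)[of i] that by (intro bexI[of _ "h i"]) (simp_all add: in_hom)
  then have "seqiso C SM n A B g" unfolding seqiso_def using assms(3) by blast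
  then show ?thesis using *[rule_format, OF assms(1)] assms(2) by simp
qed

definition triv where
  "triv A = mkseq n (\<lambda>i. if i \<le> 2 then A else zob C)
        (\<lambda>i. if i = 1 then idm C A
             else if i = 2 then zer C A (zob C)
             else if i < n then zer C (zob C) (zob C)
             else zer C (zob C) (SO A))"

lemma triv_N [simp]: "A \<in> OC \<Longrightarrow> triv A \<in> N"
proof -
  have "\<forall>A \<in> Ob C. triv A \<in> N"
    using N1 unfolding N1_def triv_def by (elim conjE) assumption
  then show "A \<in> OC \<Longrightarrow> triv A \<in> N" ..
qed

lemma rot_N: "S \<in> N \<Longrightarrow> rot C SO SM n S \<in> N"
  using N2 nseq_N[of S] unfolding N2_def by blast

lemma rot_ND: "is_nseq C SO n S \<Longrightarrow> rot C SO SM n S \<in> N \<Longrightarrow> S \<in> N"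
  using N2 unfolding N2_def by blast

lemma rot_ob [simp]: "1 \<le> i \<Longrightarrow> i \<le> n \<Longrightarrow> ob (rot C SO SM n S) i = (if i < n then ob S (Suc i) else SO (ob S 1))"
  and rot_mo [simp]: "1 \<le> i \<Longrightarrow> i \<le> n \<Longrightarrow> mo (rot C SO SM n S) i = (if i < n then mo S (Suc i) else sgnm C n (SM (mo S 1)))"
  by (simp_all add: rot_def)

lemma is_nseq_rot:
  assumes [simp]: "is_nseq C SO n S" shows "is_nseq C SO n (rot C SO SM n S)"
  unfolding rot_def
proof (rule is_nseq_mkseq, goal_cases)
  case (2 i)
  show ?case
  proof (cases "Suc i < n")
    case True then show ?thesis using 2 by simp
  next
    case False
    then have "Suc i = n" using 2 by simp
    then show ?thesis using 2 nseq_tgt(2)[of S] by (simp del: nseq_tgt(2))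
  qed
qed (auto simp: sgnm_def)

text \<open>N3 extends the identity and \<open>mo S 1\<close> to a morphism from the trivial n-angle
  to \<open>S\<close>. Its third component starts at the zero object, so the square at position 2
  gives the claim.\<close>

lemma first_composite_zero:
  assumes S [simp]: "S \<in> N" shows "mo S 2 \<cdot> mo S 1 = zero (ob S 1) (ob S 3)"
proof -
  have [simp]: "ob (triv A) (Suc 0) = A" "ob (triv A) 2 = A" "mo (triv A) (Suc 0) = one A" "mo (triv A) 2 = zero A zo"
    "ob (triv A) 3 = zo" for A by (simp_all add: triv_def)
  have t: "triv (ob S 1) \<in> N" by simp
  have "one (ob S 1) \<in> hom C (ob (triv (ob S 1)) 1) (ob S 1) \<and> mo S 1 \<in> hom C (ob (triv (ob S 1)) 2) (ob S 2) \<and>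
       cmp C (mo S 1) (mo (triv (ob S 1)) 1) = cmp C (mo S 1) (one (ob S 1))"
    by (simp add: in_hom)
  then obtain \<phi> where \<phi>: "\<phi> 1 = one (ob S 1)" "\<phi> 2 = mo S 1" "seqmor C SM n (triv (ob S 1)) S \<phi>"
    using N3[unfolded N3_def, rule_format, OF t S] by auto
  note [simp] = seqmor_type[OF \<phi>(3)]
  have "mo S 2 \<cdot> mo S 1 = \<phi> 3 \<cdot> zero (ob S 1) zo"
    using seqmor_commute[OF \<phi>(3), of 2] \<phi>(2) by simp
  also have "\<dots> = zero (ob S 1) (ob S 3)" by simp
  finally show ?thesis .
qed

text \<open>Induction over rotations: the composite at position i + 1 of \<open>S\<close> is the one
  at position i of its left rotation.\<close>

lemma composite_zero:
  assumes "S \<in> N" "1 \<le> i" "i < n"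
  shows "mo S (Suc i) \<cdot> mo S i = zero (ob S i) (padob n (SO (ob S 1)) S (Suc (Suc i)))"
  using assms(2,3,1)
proof (induction i arbitrary: S rule: dec_induct)
  case base
  then show ?case using first_composite_zero[of S] by (simp add: padob_def)
next
  case (step i)
  then show ?case using step.IH[OF _ rot_N[of S]]
    by (auto simp: padob_def)
qed

text \<open>Up to the sign (-1)^n, this composite occurs at position n - 1 of the left
  rotation.\<close>

lemma last_composite_zero:
  assumes [simp]: "S \<in> N" shows "SM (mo S 1) \<cdot> mo S n = zero (ob S n) (SO (ob S 2))"
proof -
  define m where "m = n - 1"
  have m [simp]: "Suc m = n" "m < n" "Suc 0 \<le> m" "m \<le> n"
    using n3 unfolding m_def by linarith+
  have "mo (rot C SO SM n S) n \<cdot> mo (rot C SO SM n S) m = zero (ob S n) (SO (ob S 2))"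
    using composite_zero[of "rot C SO SM n S" m] rot_N[of S] by (simp add: padob_def)
  moreover have "mo (rot C SO SM n S) n = sgnm C n (SM (mo S 1))" "mo (rot C SO SM n S) m = mo S n"
    by simp_all
  ultimately have "\<ominus> (SM (mo S 1) \<cdot> mo S n) = zero (ob S n) (SO (ob S 2)) \<or> ?thesis"
    by (auto simp: sgnm_def split: if_splits)
  then show ?thesis
    using mneg_mneg[of "SM (mo S (Suc 0)) \<cdot> mo S n"] by fastforce
qed

end

section \<open>From (N4) to (N4*)\<close>

context pre_nangulated
begin

text \<open>A mapping cone of a morphism with \<open>\<chi>\<^sub>1 = 1\<close> contains the contractible summand \<open>E\<^sub>1 = E\<^sub>1\<close>;
  this is what remains after splitting it off. The zero object \<open>Z\<close> stands for \<open>E\<^sub>n\<^sub>+\<^sub>1\<close>.\<close>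

definition red where
  "red Z E D \<chi> = mkseq n (\<lambda>k. if k = 1 then ob E 2 else ds (padob n Z E (k + 1)) (ob D k))
     (\<lambda>k. if k = 1 then pair (\<ominus> (mo E 2)) (\<chi> 2)
          else if k < n then pair (copair (\<ominus> (padmo Z E (k + 1))) (zero (ob D k) (padob n Z E (k + 2))))
             (copair (\<chi> (k + 1)) (mo D k))
          else copair (zero Z (SO (ob E 2))) (SM (mo E 1) \<cdot> mo D n))"

lemma red_ob:
  "ob (red Z E D \<chi>) (Suc 0) = ob E 2"
  "2 \<le> k \<Longrightarrow> k \<le> n \<Longrightarrow> ob (red Z E D \<chi>) k = ds (padob n Z E (Suc k)) (ob D k)"
  by (simp_all add: red_def)

lemma red_mo:
  "mo (red Z E D \<chi>) (Suc 0) = pair (\<ominus> (mo E 2)) (\<chi> 2)"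
  "2 \<le> k \<Longrightarrow> k < n \<Longrightarrow> mo (red Z E D \<chi>) k = pair (copair (\<ominus> (padmo Z E (Suc k)))
     (zero (ob D k) (padob n Z E (Suc (Suc k))))) (copair (\<chi> (Suc k)) (mo D k))"
  "mo (red Z E D \<chi>) n = copair (zero Z (SO (ob E 2))) (SM (mo E 1) \<cdot> mo D n)"
  by (simp_all add: red_def)

context
  fixes Z E D \<chi>
  assumes Z [simp]: "Z \<in> OC" and Z0: "one Z = zero Z Z"
    and E [simp]: "E \<in> N" and D [simp]: "D \<in> N" and ED [simp]: "ob D (Suc 0) = ob E (Suc 0)"
    and chi: "seqmor C SM n E D \<chi>" and chi1 [simp]: "\<chi> (Suc 0) = one (ob E (Suc 0))"
begin

lemma is_nseq_red: "is_nseq C SO n (red Z E D \<chi>)"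
  unfolding red_def
proof (rule is_nseq_mkseq, goal_cases)
  note [simp] = seqmor_type[OF chi]
  case (1 i)
  then show ?case by auto
next
  note [simp] = seqmor_type[OF chi]
  case (2 i)
  consider "i = 1" | "2 \<le> i" using 2 by linarith
  then show ?case
  proof cases
    case 1 then show ?thesis by (simp add: padob_def)
  next
    case i: 2
    then show ?thesis using 2 by (simp add: padob_def)
  qed
qed (simp_all add: padob_def)

text \<open>The reduction is a retract of the cone. The maps \<open>s\<close> and \<open>r\<close>
  are identities except at the two ends, where E_1 and \<Sigma>E_1 occur; closure under direct
  summands does the rest.\<close>

lemma red_N:
  assumes cone: "cone C SO SM n E D \<chi> \<in> N"
  shows "red Z E D \<chi> \<in> N"
proof -
  note [simp] = seqmor_type[OF chi]
  note comm = seqmor_commute[OF chi] and lastc = seqmor_commute_last[OF chi]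
  define m where "m = n - 1"
  have m [simp]: "Suc m = n" "m < n" "2 \<le> m" "Suc 0 \<le> m" "m \<le> n" "m \<noteq> Suc 0" using n3 unfolding m_def by linarith+
  have pos: "k = 1 \<or> 2 \<le> k \<and> k < m \<or> k = m \<or> k = n" if "1 \<le> k" "k \<le> n" for k
    using that m(1) by linarith
  \<comment> \<open>The entry \<open>\<ominus> (mo D n)\<close> at position n makes the
    \<Sigma>D_1-component of the last cone map vanish after \<open>s\<close>, because \<chi>_1 is
    the identity.\<close>
  define s where "s k = (if k = 1 then pair (one (ob E 2)) (zero (ob E 2) (ob D 1))
     else if k < n then one (ds (ob E (k+1)) (ob D k))
     else pair (copair (zero Z (SO (ob E 1))) (\<ominus> (mo D n))) (copair (zero Z (ob D n)) (one (ob D n))))" for k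
  \<comment> \<open>The entry \<open>mo E 1\<close> at position 1, after applying \<Sigma>, cancels
    the entry \<open>\<ominus> (SM (mo E 1))\<close> of the last cone map.\<close>
  define r where "r k = (if k = 1 then copair (one (ob E 2)) (mo E 1)
     else if k < n then one (ds (ob E (k+1)) (ob D k))
     else pair (zero (ds (SO (ob E 1)) (ob D n)) Z) (copair (zero (SO (ob E 1)) (ob D n)) (one (ob D n))))" for k
  have sr: "s (Suc 0) = pair (one (ob E 2)) (zero (ob E 2) (ob D 1))" "r (Suc 0) = copair (one (ob E 2)) (mo E 1)"
    "2 \<le> k \<Longrightarrow> k < n \<Longrightarrow> s k = one (ds (ob E (Suc k)) (ob D k))" 
    "2 \<le> k \<Longrightarrow> k < n \<Longrightarrow> r k = one (ds (ob E (Suc k)) (ob D k))"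
    "s n = pair (copair (zero Z (SO (ob E 1))) (\<ominus> (mo D n))) (copair (zero Z (ob D n)) (one (ob D n)))"
    "r n = pair (zero (ds (SO (ob E 1)) (ob D n)) Z) (copair (zero (SO (ob E 1)) (ob D n)) (one (ob D n)))" for k
    by (simp_all add: s_def r_def)
  have s_type: "s k \<in> MC \<and> src (s k) = ob (red Z E D \<chi>) k \<and> tgt (s k) = ob (cone C SO SM n E D \<chi>) k"
   and r_type: "r k \<in> MC \<and> tgt (r k) = ob (red Z E D \<chi>) k \<and> src (r k) = ob (cone C SO SM n E D \<chi>) k"
    if k: "1 \<le> k" "k \<le> n" for k
  proof -
    consider "k = 1" | "2 \<le> k" "k < n" | "k = n" using k by linarith
    note cases = this
    show "s k \<in> MC \<and> src (s k) = ob (red Z E D \<chi>) k \<and> tgt (s k) = ob (cone C SO SM n E D \<chi>) k"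
      using cases by cases (simp_all add: sr red_ob padob_def)
    show "r k \<in> MC \<and> tgt (r k) = ob (red Z E D \<chi>) k \<and> src (r k) = ob (cone C SO SM n E D \<chi>) k"
      using cases by cases (simp_all add: sr red_ob padob_def)
  qed
  have "seqmor C SM n (red Z E D \<chi>) (cone C SO SM n E D \<chi>) s"
  proof (rule seqmorI, goal_cases)
    case (1 k) then show ?case by (rule s_type)
  next
    case (2 k)
    consider "k = 1" | "2 \<le> k" "k < m" | "k = m" using pos[of k] 2 by linarith
    then show ?case
    proof cases
      case 1
      then show ?thesis
        by (simp add: red_mo cone_mo chi sr(1,3) red_ob padob_def)
    next
      case k: 2
      then have "Suc k < n" "Suc (Suc k) \<le> n" using m(1) by linarith+
      then show ?thesis using k(1)
        by (simp add: red_mo cone_mo chi sr(1,3) padmo_def padob_def)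
    next
      case 3
      \<comment> \<open>The new entry of \<open>s n\<close> brings in \<open>mo D n\<close> after
        \<open>\<chi> n\<close> and after \<open>mo D m\<close>: the first equals
        \<open>mo E n\<close> by the last square, the second vanishes.\<close>
      then show ?thesis using lastc composite_zero[of D m]
        by (simp add: red_mo cone_mo chi sr padmo_def padob_def)
    qed
  next
    case 3
    then show ?case by (simp add: red_mo cone_mo_last chi sr canon_pair biprod_type)
  qed
  moreover have "seqmor C SM n (cone C SO SM n E D \<chi>) (red Z E D \<chi>) r"
  proof (rule seqmorI, goal_cases)
    case (1 k) then show ?case using r_type by blast
  next
    case (2 k)
    consider "k = 1" | "2 \<le> k" "k < m" | "k = m" using pos[of k] 2 by linarith
    then show ?case
    proof cases
      case 1
      then show ?thesis using comm[of 1] composite_zero[of E 1]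
        by (simp add: red_mo cone_mo chi sr red_ob padob_def)
    next
      case k: 2
      then have "Suc k < n" "Suc (Suc k) \<le> n" using m(1) by linarith+
      then show ?thesis using k(1)
        by (simp add: red_mo cone_mo chi sr padmo_def padob_def)
    next
      case 3
      then show ?thesis
        by (simp add: red_mo cone_mo chi sr padmo_def padob_def)
    qed
  next
    case 3
    then show ?case by (simp add: red_mo cone_mo_last chi sr)
  qed
  moreover have "r k \<cdot> s k = one (ob (red Z E D \<chi>) k)" if k: "1 \<le> k" "k \<le> n" for k
  proof -
    consider "k = 1" | "2 \<le> k" "k < n" | "k = n" using k by linarith
    then show ?thesis
      by cases (simp_all add: red_ob sr Z0 padob_def one_dsum)
  qed
  ultimately show ?thesis using N_summand[OF cone is_nseq_red] by blast
qed

end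

end

section \<open>Comparing and recovering the entries of a row\<close>

context additive
begin

lemma copair_inject:
  assumes "copair f g = copair f' g'" "f \<in> MC" "g \<in> MC" "f' \<in> MC" "g' \<in> MC" "tgt g = tgt f" "tgt g' = tgt f'"
    "src f' = src f" "src g' = src g"
  shows "f = f'" "g = g'"
proof -
  let ?i = "pair (one (src f)) (zero (src f) (src g))" and ?j = "pair (zero (src g) (src f)) (one (src g))"
  have "copair f g \<cdot> ?i = f" "copair f' g' \<cdot> ?i = f'" "copair f g \<cdot> ?j = g" "copair f' g' \<cdot> ?j = g'"
    using assms(2-) by simp_all
  then show "f = f'" "g = g'" unfolding assms(1) by metis+
qed

lemma copair_eta:
  assumes "h \<in> MC" "src h = ds A B" "A \<in> OC" "B \<in> OC"
  shows "h = copair (h \<cdot> in1 C A B) (h \<cdot> in2 C A B)"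
proof -
  have "h = h \<cdot> (in1 C A B \<cdot> pj1 C A B \<oplus> in2 C A B \<cdot> pj2 C A B)"
    using assms by (simp add: biprod_eq)
  also have "\<dots> = copair (h \<cdot> in1 C A B) (h \<cdot> in2 C A B)"
    using assms by (simp add: copair_def biprod_type)
  finally show ?thesis .
qed

end

section \<open>Objects and matrix entries of the sequence in \<open>N4star\<close>\<close>

context nseqs
begin

lemma padob_eq [simp]: "1 \<le> i \<Longrightarrow> i \<le> n \<Longrightarrow> padob n Z S i = ob S i"
  and padob_out [simp]: "n < i \<Longrightarrow> padob n Z S i = Z"
  by (simp_all add: padob_def)

lemma padmo_eq [simp]: "1 \<le> i \<Longrightarrow> i < n \<Longrightarrow> padmo Z S i = mo S i"
  and padmo_out [simp]: "n \<le> i \<Longrightarrow> padmo Z S i = zero (padob n Z S i) Z"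
  by (simp_all add: padmo_def)

definition padmor where
  "padmor A B \<phi> i = (if 1 \<le> i \<and> i \<le> n then \<phi> i else zero (padob n zo A i) (padob n zo B i))"

lemma padmor_eq [simp]: "1 \<le> i \<Longrightarrow> i \<le> n \<Longrightarrow> padmor A B \<phi> i = \<phi> i"
  and padmor_out [simp]: "n < i \<Longrightarrow> padmor A B \<phi> i = zero zo zo"
  by (simp_all add: padmor_def)

text \<open>The third n-angle begins with A_2 and B_2, which must not contribute as C_1 and C_2;
  hence the start at 3.\<close>

definition cob where "cob S i = (if 3 \<le> i \<and> i \<le> n then ob S i else zo)"
definition cmo where "cmo S i = (if 3 \<le> i \<and> i < n then mo S i else zero (cob S i) (cob S (i + 1)))"

lemma cob_eq [simp]: "3 \<le> i \<Longrightarrow> i \<le> n \<Longrightarrow> cob S i = ob S i" and cob_2 [simp]: "cob S 2 = zo"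
  by (simp_all add: cob_def)

lemma cmo_eq [simp]: "3 \<le> i \<Longrightarrow> i < n \<Longrightarrow> cmo S i = mo S i" and cmo_2 [simp]: "cmo S 2 = zero zo (cob S 3)"
  by (simp_all add: cmo_def)

lemma cob_Ob [simp]: "is_nseq C SO n S \<Longrightarrow> cob S i \<in> OC"
  by (auto simp: cob_def)

lemma cmo_type [simp]:
  assumes "is_nseq C SO n S"
  shows "cmo S i \<in> MC" "src (cmo S i) = cob S i" "tgt (cmo S i) = cob S (Suc i)"
  using assms by (auto simp: cmo_def)

lemma padmor_type:
  assumes "is_nseq C SO n A" "is_nseq C SO n B" "seqmor C SM n A B \<phi>"
  shows "padmor A B \<phi> i \<in> MC" "src (padmor A B \<phi> i) = padob n zo A i" "tgt (padmor A B \<phi> i) = padob n zo B i"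
  using assms seqmor_type[OF assms(3)] by (auto simp: padmor_def)

lemma Dseq_ob:
  "ob (Dseq C SO SM n A B Cs \<phi> \<psi>) (Suc 0) = ob A 3"
  "2 \<le> i \<Longrightarrow> i \<le> n \<Longrightarrow> ob (Dseq C SO SM n A B Cs \<phi> \<psi>) i = ds (padob n zo A (Suc (Suc i))) (ds (padob n zo B (Suc i)) (cob Cs i))"
  by (simp_all add: Dseq_def Let_def tri_def padob_def cob_def)

context
  fixes A B Cs \<phi> \<psi>
  assumes A [simp]: "is_nseq C SO n A" and B [simp]: "is_nseq C SO n B" and Cs [simp]: "is_nseq C SO n Cs"
    and C1 [simp]: "ob Cs (Suc 0) = ob A 2"
    and phi: "seqmor C SM n A B \<phi>"
    and psi_odd: "\<forall>k. 1 \<le> k \<and> k \<le> n - 2 \<longrightarrow> \<psi> (2*k-1) \<in> hom C (ob B (k+2)) (ob Cs (k+2))"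
    and psi_even: "\<forall>k. 1 \<le> k \<and> k \<le> n - 3 \<longrightarrow> \<psi> (2*k) \<in> hom C (ob A (k+3)) (ob Cs (k+2))"
begin

lemmas [simp] = padmor_type[OF A B phi]

text \<open>For i = k + 1 these are the entries \<open>\<psi> (2*k)\<close> and
  \<open>\<psi> (2*k-1)\<close> of d_(k+1). At i = n - 1 the column of A_(n+1) = 0 carries a zero
  morphism instead.\<close>

definition psA where "psA i = (if Suc i < n then \<psi> (2*i-2) else zero zo (ob Cs n))"
definition psB where "psB i = \<psi> (2*i-3)"

lemma psA_type [simp]:
  assumes "2 \<le> i" "i < n"
  shows "psA i \<in> MC" "src (psA i) = padob n zo A (Suc (Suc i))" "tgt (psA i) = cob Cs (Suc i)"
proof -
  obtain k where k: "i = Suc k" "1 \<le> k" using assms by (cases i) auto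
  have k3: "k + 3 = Suc (Suc i)" and i2: "2 * i - 2 = 2 * k" using k by simp_all
  have "Suc i < n \<or> Suc i = n" using assms by linarith
  then have "psA i \<in> MC \<and> src (psA i) = padob n zo A (Suc (Suc i)) \<and> tgt (psA i) = cob Cs (Suc i)"
    using psi_even[rule_format, of k] k k3 i2 by (auto simp: psA_def in_hom cob_def padob_def)
  then show "psA i \<in> MC" "src (psA i) = padob n zo A (Suc (Suc i))" "tgt (psA i) = cob Cs (Suc i)" by simp_all
qed

lemma psB_type [simp]:
  assumes "2 \<le> i" "i < n"
  shows "psB i \<in> MC" "src (psB i) = ob B (Suc i)" "tgt (psB i) = cob Cs (Suc i)"
proof -
  obtain k where k: "i = Suc k" "1 \<le> k" using assms by (cases i) auto
  have [simp]: "2 * Suc k - 3 = 2 * k - Suc 0" by simp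
  have "psB i \<in> MC \<and> src (psB i) = ob B (Suc i) \<and> tgt (psB i) = cob Cs (Suc i)"
    using psi_odd[rule_format, of k] k assms by (auto simp: psB_def in_hom cob_def)
  then show "psB i \<in> MC" "src (psB i) = ob B (Suc i)" "tgt (psB i) = cob Cs (Suc i)" by simp_all
qed

lemma Dseq_mo1:
  "mo (Dseq C SO SM n A B Cs \<phi> \<psi>) (Suc 0) = pair (padmo zo A 3) (pair (\<phi> 3) (zero (ob A 3) zo))"
proof -
  note [simp] = seqmor_type[OF phi]
  show ?thesis
    by (cases "4 \<le> n") (simp_all add: Dseq_def Let_def tri_def msum_def tin_def in_eq_pair)
qed

lemma Dseq_mo:
  assumes "2 \<le> i" "i < n"
  shows "mo (Dseq C SO SM n A B Cs \<phi> \<psi>) i =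
    pair (copair (\<ominus> (padmo zo A (Suc (Suc i)))) (copair (zero (ob B (Suc i)) (padob n zo A (Suc (Suc (Suc i))))) (zero (cob Cs i) (padob n zo A (Suc (Suc (Suc i)))))))
   (pair (copair (sgnm C i (padmor A B \<phi> (Suc (Suc i)))) (copair (\<ominus> (padmo zo B (Suc i))) (zero (cob Cs i) (padob n zo B (Suc (Suc i))))))
         (copair (psA i) (copair (psB i) (cmo Cs i))))"
proof -
  note [simp] = seqmor_type[OF phi]
  obtain k where k: "i = Suc k" "1 \<le> k" using assms by (cases i) auto
  have i2: "2 * i - 2 = 2 * k" "2 * i - 3 = 2 * k - 1" using k by simp_all
  define ps where "ps j = (if 1 \<le> j \<and> j \<le> 2*n-5 then \<psi> j
                   else if even j then zer C (padob n zo A (j div 2 + 3)) (cob Cs (j div 2 + 2))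
                   else zer C (padob n zo B ((j+1) div 2 + 2)) (cob Cs ((j+1) div 2 + 2)))" for j
  have psA: "ps (2 * k) = psA i"
  proof (cases "Suc i < n")
    case True
    then have "1 \<le> 2 * k \<and> 2 * k \<le> 2 * n - 5" using k by linarith
    then show ?thesis using True by (simp add: ps_def psA_def i2)
  next
    case False
    then have "Suc i = n" using assms by simp
    \<comment> \<open>Here 2k = 2n - 4 lies just beyond the last \<psi>, so the default zero
      applies.\<close>
    then have "\<not> 2 * k \<le> 2 * n - 5" "Suc (Suc k) = n" using k by linarith+
    then show ?thesis using False by (simp add: ps_def psA_def)
  qed
  have "1 \<le> 2 * k - 1 \<and> 2 * k - 1 \<le> 2 * n - 5" using k assms by linarith
  then have psB: "ps (2 * k - 1) = psB i" by (simp add: ps_def psB_def i2)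
  have ik: "i - 1 = k" using k by simp
  have e: "k + 3 = Suc (Suc i)" "k + 2 = Suc i" "k + 1 = i" "k + 4 = Suc (Suc (Suc i))"
    "padob n zo B (Suc i) = ob B (Suc i)" using k(1) assms(2) by simp_all
  have "mo (Dseq C SO SM n A B Cs \<phi> \<psi>) i = mat3 C (padob n zo A (k+3)) (padob n zo B (k+2)) (cob Cs (k+1))
      (padob n zo A (k+4)) (padob n zo B (k+3)) (cob Cs (k+2))
      (\<lambda>r c. if r = 1 then (if c = 1 then mneg C (padmo zo A (k+3))
                                       else if c = 2 then zer C (padob n zo B (k+2)) (padob n zo A (k+4))
                                       else zer C (cob Cs (k+1)) (padob n zo A (k+4)))
                       else if r = 2 then (if c = 1 then sgnm C (k+1) (padmor A B \<phi> (k+3))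
                                       else if c = 2 then mneg C (padmo zo B (k+2))
                                       else zer C (cob Cs (k+1)) (padob n zo B (k+3)))
                       else (if c = 1 then ps (2*k)
                             else if c = 2 then ps (2*k-1)
                             else cmo Cs (k+1)))"
    unfolding Dseq_def Let_def
    apply (subst mo_mkseq)
    subgoal using assms by simp
    subgoal using assms by simp
    apply (subst if_not_P[of "i = 1"])
    subgoal using assms by simp
    apply (subst if_P[of "i < n"])
    subgoal using assms by simp
    unfolding ik ps_def padob_def padmo_def cob_def cmo_def padmor_def
    by (rule refl)
  also have "\<dots> = mat3 C (padob n zo A (Suc (Suc i))) (ob B (Suc i)) (cob Cs i)
      (padob n zo A (Suc (Suc (Suc i)))) (padob n zo B (Suc (Suc i))) (cob Cs (Suc i))
      (\<lambda>r c. if r = 1 then (if c = 1 then mneg C (padmo zo A (Suc (Suc i)))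
                                       else if c = 2 then zer C (ob B (Suc i)) (padob n zo A (Suc (Suc (Suc i))))
                                       else zer C (cob Cs i) (padob n zo A (Suc (Suc (Suc i)))))
                       else if r = 2 then (if c = 1 then sgnm C i (padmor A B \<phi> (Suc (Suc i)))
                                       else if c = 2 then mneg C (padmo zo B (Suc i))
                                       else zer C (cob Cs i) (padob n zo B (Suc (Suc i))))
                       else (if c = 1 then psA i
                             else if c = 2 then psB i
                             else cmo Cs i))"
    unfolding psA psB e by (rule refl)
  also have "\<dots> = 
    pair (copair (\<ominus> (padmo zo A (Suc (Suc i)))) (copair (zero (ob B (Suc i)) (padob n zo A (Suc (Suc (Suc i))))) (zero (cob Cs i) (padob n zo A (Suc (Suc (Suc i)))))))
   (pair (copair (sgnm C i (padmor A B \<phi> (Suc (Suc i)))) (copair (\<ominus> (padmo zo B (Suc i))) (zero (cob Cs i) (padob n zo B (Suc (Suc i))))))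
         (copair (psA i) (copair (psB i) (cmo Cs i))))"
    using assms by (subst mat3_eq) (simp_all add: in_hom sgnm_def)
  finally show ?thesis .
qed

lemma Dseq_mo_last:
  "mo (Dseq C SO SM n A B Cs \<phi> \<psi>) n = copair (zero zo (SO (ob A 3))) (copair (zero zo (SO (ob A 3))) (SM (mo A 2) \<cdot> mo Cs n))"
  apply (simp add: Dseq_def Let_def)
  apply (simp add: tpj_def pj_eq_copair)
  done

lemma is_nseq_Dseq: "is_nseq C SO n (Dseq C SO SM n A B Cs \<phi> \<psi>)"
proof -
  note [simp] = seqmor_type[OF phi]
  let ?D = "Dseq C SO SM n A B Cs \<phi> \<psi>"
  show ?thesis unfolding is_nseq_def
  proof (intro conjI allI impI ballI)
    show "length (fst ?D) = n" "length (snd ?D) = n"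
      by (simp_all add: Dseq_def Let_def mkseq_def)
    show "ob ?D i \<in> OC" if i: "i \<in> {1..n}" for i
    proof -
      consider "i = 1" | "2 \<le> i" "i \<le> n" using i by fastforce
      then show ?thesis by cases (simp_all add: Dseq_ob)
    qed
    show "mo ?D i \<in> hom C (ob ?D i) (ob ?D (i + 1))" if i: "1 \<le> i \<and> i < n" for i
    proof -
      consider "i = 1" | "2 \<le> i" "i < n" using i by fastforce
      then show ?thesis
      proof cases
        case 1
        then show ?thesis by (simp add: Dseq_ob Dseq_mo1 in_hom)
      next
        case 2
        then show ?thesis by (simp add: Dseq_ob Dseq_mo in_hom sgnm_def)
      qed
    qed
    show "mo ?D n \<in> hom C (ob ?D n) (SO (ob ?D 1))"
      by (simp add: Dseq_ob Dseq_mo_last in_hom)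
  qed
qed

end

end

section \<open>Block identities comparing a twofold reduction with the sequence in
  \<open>N4star\<close>\<close>

context additive
begin

text \<open>\<open>i\<close> and \<open>j\<close> relate C_k to the k-th object of the third
  n-angle. In the application they are identities unless k = 2, where C_2 = 0 replaces B_2 and
  \<open>c\<close> is \<beta>_2. The sign on \<open>A1\<close> squares to the identity.\<close>

lemma block_split:
  assumes [simp]: "A1 \<in> OC" "B1 \<in> OC" "C1 \<in> OC" "K1 \<in> OC"
    "i \<in> MC" "src i = C1" "tgt i = K1" "j \<in> MC" "src j = K1" "tgt j = C1"
    "c \<in> MC" "src c = K1" "tgt c = B1" "c \<cdot> i = zero C1 B1" "j \<cdot> i = one C1"
  shows "pair (copair (copair (sgnm C (Suc k) (one A1)) (zero B1 A1)) (zero K1 A1))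
         (pair (copair (copair (zero A1 B1) (one B1)) c) (copair (zero (ds A1 B1) C1) j)) \<cdot>
      pair (pair (copair (sgnm C (Suc k) (one A1)) (zero (ds B1 C1) A1))
              (copair (zero A1 B1) (copair (one B1) (zero C1 B1))))
           (copair (zero A1 K1) (copair (zero B1 K1) i)) = one (ds A1 (ds B1 C1))"
  by (simp add: sgnm_def one_dsum)

context
  fixes A1 B1 C1 K1 A2 B2 K2 a p b x y g g'
  assumes ob [simp]: "A1 \<in> OC" "B1 \<in> OC" "C1 \<in> OC" "K1 \<in> OC" "A2 \<in> OC" "B2 \<in> OC" "K2 \<in> OC"
    and type [simp]: "a \<in> MC" "src a = A1" "tgt a = A2" "p \<in> MC" "src p = A1" "tgt p = B2"
    "b \<in> MC" "src b = B1" "tgt b = B2" "x \<in> MC" "src x = A1" "tgt x = K2" "y \<in> MC" "src y = B1" "tgt y = K2"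
    "g \<in> MC" "src g = K1" "tgt g = K2" "g' \<in> MC" "src g' = C1" "tgt g' = K2"
begin

text \<open>Rescaling the A-summand in position k by (-1)^(k+1) turns the constant signs of the
  reduction into the alternating ones of \<open>N4star\<close>.\<close>

lemma block_inclusion:
  assumes [simp]: "i \<in> MC" "src i = C1" "tgt i = K1" "g \<cdot> i = g'"
  shows "pair (pair (copair (sgnm C (Suc (Suc k)) (one A2)) (zero (ds B2 K2) A2))
                 (copair (zero A2 B2) (copair (one B2) (zero K2 B2))))
              (copair (zero A2 K2) (copair (zero B2 K2) (one K2))) \<cdot>
      pair (copair (\<ominus> a) (copair (zero B1 A2) (zero C1 A2)))
        (pair (copair (sgnm C k p) (copair (\<ominus> b) (zero C1 B2))) (copair (sgnm C (Suc k) x) (copair y g'))) =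
    pair (copair (\<ominus> (pair (copair (\<ominus> a) (zero B1 A2)) (copair p b))) (zero K1 (ds A2 B2)))
         (copair (copair x y) g) \<cdot>
      pair (pair (copair (sgnm C (Suc k) (one A1)) (zero (ds B1 C1) A1))
              (copair (zero A1 B1) (copair (one B1) (zero C1 B1))))
           (copair (zero A1 K1) (copair (zero B1 K1) i))"
  by (cases "even k") (simp_all add: sgnm_def)

text \<open>The two conditions on \<open>c\<close> have content only at k = 2, where they read
  \<beta>_3 \<beta>_2 = 0 and \<psi>_1 \<beta>_2 = \<gamma>_2.\<close>

lemma block_projection:
  assumes [simp]: "j \<in> MC" "src j = K1" "tgt j = C1" "c \<in> MC" "src c = K1" "tgt c = B1"
    "b \<cdot> c = zero K1 B2" "y \<cdot> c \<oplus> g' \<cdot> j = g"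
  shows "pair (copair (copair (sgnm C (Suc (Suc k)) (one A2)) (zero B2 A2)) (zero K2 A2))
         (pair (copair (copair (zero A2 B2) (one B2)) (zero K2 B2))
               (copair (zero (ds A2 B2) K2) (one K2))) \<cdot>
       pair (copair (\<ominus> (pair (copair (\<ominus> a) (zero B1 A2)) (copair p b))) (zero K1 (ds A2 B2)))
         (copair (copair x y) g) =
     pair (copair (\<ominus> a) (copair (zero B1 A2) (zero C1 A2)))
        (pair (copair (sgnm C k p) (copair (\<ominus> b) (zero C1 B2))) (copair (sgnm C (Suc k) x) (copair y g'))) \<cdot>
       pair (copair (copair (sgnm C (Suc k) (one A1)) (zero B1 A1)) (zero K1 A1))
         (pair (copair (copair (zero A1 B1) (one B1)) c) (copair (zero (ds A1 B1) C1) j))"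
  by (cases "even k") (simp_all add: sgnm_def)

end

end

section \<open>The implication from \<open>N4\<close> to \<open>N4star\<close>\<close>

context pre_nangulated
begin

text \<open>The padded sequence stops at position n instead of continuing to \<Sigma>S_1, so the
  last case is a composite with a zero morphism.\<close>

lemma pad_composite:
  assumes [simp]: "S \<in> N" and i: "1 \<le> i" "i < n"
  shows "padmo zo S (Suc i) \<cdot> mo S i = zero (ob S i) (padob n zo S (Suc (Suc i)))"
proof (cases "Suc i < n")
  case True
  then show ?thesis using composite_zero[of S i] i by simp
next
  case False
  then have "Suc i = n" using i by simp
  then show ?thesis using i by (simp add: padob_def)
qed

lemma N4_imp_N4star:
  assumes N4: "N4 C SO SM n N" shows "N4star C SO SM n N"
  unfolding N4star_def
proof (intro ballI allI impI, elim conjE)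
  fix A B Cs \<phi>2
  assume A [simp]: "A \<in> N" and B [simp]: "B \<in> N" and Cs [simp]: "Cs \<in> N"
    and "ob B 1 = ob A 1" "ob Cs 1 = ob A 2" and C2 [simp]: "ob Cs 2 = ob B 2"
    and phi2: "mo Cs 1 = \<phi>2" and "cmp C \<phi>2 (mo A 1) = mo B 1"
  then have B1 [simp]: "ob B (Suc 0) = ob A (Suc 0)" and C1 [simp]: "ob Cs (Suc 0) = ob A 2"
    and mC1: "mo Cs (Suc 0) = \<phi>2" and sq: "\<phi>2 \<cdot> mo A (Suc 0) = mo B (Suc 0)" by simp_all
  have phi2_type [simp]: "\<phi>2 \<in> MC" "src \<phi>2 = ob A 2" "tgt \<phi>2 = ob B 2"
    using nseq_mo[of Cs "Suc 0"] nseq_tgt(1)[of Cs "Suc 0"] by (simp_all add: mC1)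
  obtain \<phi> where phi1: "\<phi> 1 = one (ob A 1)" and phi_2: "\<phi> 2 = \<phi>2" and phi: "seqmor C SM n A B \<phi>"
    and cone1: "cone C SO SM n A B \<phi> \<in> N"
    using N4[unfolded N4_def, rule_format, OF A B, of "one (ob A 1)" \<phi>2] sq by (auto simp: in_hom)
  have phi1' [simp]: "\<phi> (Suc 0) = one (ob A (Suc 0))" using phi1 by simp
  note [simp] = seqmor_type[OF phi] padmor_type[OF nseq_N[OF A] nseq_N[OF B] phi]
  define E where "E = red zo A B \<phi>"
  have E [simp]: "E \<in> N"
    unfolding E_def by (rule red_N[OF _ _ A B _ phi _ cone1]) simp_all
  have Eob [simp]: "ob E (Suc 0) = ob A 2" "\<And>k. 2 \<le> k \<Longrightarrow> k \<le> n \<Longrightarrow> ob E k = ds (padob n zo A (Suc k)) (ob B k)"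
    unfolding E_def by (simp_all add: red_ob phi)
  have Emo1: "mo E (Suc 0) = pair (\<ominus> (mo A 2)) \<phi>2"
    unfolding E_def by (simp add: red_mo phi phi_2)
  have Emo: "mo E k = pair (copair (\<ominus> (padmo zo A (Suc k))) (zero (ob B k) (padob n zo A (Suc (Suc k)))))
      (copair (\<phi> (Suc k)) (mo B k))" if "2 \<le> k" "k < n" for k
    using that unfolding E_def by (simp add: red_mo phi)
  \<comment> \<open>With the filler 0 \<oplus> 0 the objects of \<open>E\<close> beyond position n
    keep the form A_(k+1) \<oplus> B_k, so the second reduction has uniform matrices up to its
    end.\<close>
  let ?Z = "ds zo zo"
  have padE: "padob n ?Z E k = ds (padob n zo A (Suc k)) (padob n zo B k)" if "2 \<le> k" for k
    using that by (cases "k \<le> n") simp_all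
  have padEmo: "padmo ?Z E k = pair (copair (\<ominus> (padmo zo A (Suc k))) (zero (padob n zo B k) (padob n zo A (Suc (Suc k)))))
      (copair (padmor A B \<phi> (Suc k)) (padmo zo B k))" if k: "2 \<le> k" for k
  proof (cases "k < n")
    case True
    then show ?thesis using k by (simp add: Emo)
  next
    case False
    then show ?thesis using k by (simp add: padE)
  qed
  \<comment> \<open>The projection to B_2 after the first map (-\<alpha>_2, \<phi>_2) of
    \<open>E\<close> is \<phi>_2 = \<gamma>_1, so the square commutes.\<close>
  obtain \<chi> where chi1: "\<chi> 1 = one (ob A 2)" and chi2: "\<chi> 2 = copair (zero (ob A 3) (ob B 2)) (one (ob B 2))"
    and chi: "seqmor C SM n E Cs \<chi>" and cone2: "cone C SO SM n E Cs \<chi> \<in> N"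
    using N4[unfolded N4_def, rule_format, OF E Cs, of "one (ob A 2)" "copair (zero (ob A 3) (ob B 2)) (one (ob B 2))"]
    by (auto simp: in_hom Emo1 mC1)
  have chi1' [simp]: "\<chi> (Suc 0) = one (ob A 2)" using chi1 by simp
  \<comment> \<open>This is A_3 \<oplus> B_2 \<rightarrow> (A_4 \<oplus> B_3) \<oplus> B_2
    \<rightarrow> (A_5 \<oplus> B_4) \<oplus> C_3 \<rightarrow> ..., with B_2 in positions 1 and 2
    still to be split off.\<close>
  define G where "G = red ?Z E Cs \<chi>"
  have G: "G \<in> N"
    unfolding G_def by (rule red_N[OF _ _ E Cs _ chi _ cone2]) (simp_all add: one_dsum)
  define xA where "xA k = \<chi> k \<cdot> in1 C (padob n zo A (Suc k)) (ob B k)" for k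
  define xB where "xB k = \<chi> k \<cdot> in2 C (padob n zo A (Suc k)) (ob B k)" for k
  have x_type [simp]: "xA k \<in> MC" "src (xA k) = padob n zo A (Suc k)" "tgt (xA k) = ob Cs k"
    "xB k \<in> MC" "src (xB k) = ob B k" "tgt (xB k) = ob Cs k" if "2 \<le> k" "k \<le> n" for k
    using that seqmor_type[OF chi, of k] by (simp_all add: xA_def xB_def biprod_type)
  have chi_eq: "\<chi> k = copair (xA k) (xB k)" if "2 \<le> k" "k \<le> n" for k
    unfolding xA_def xB_def using that seqmor_type[OF chi, of k] by (intro copair_eta) simp_all
  \<comment> \<open>The \<psi> are the components of \<chi>; the signs on the A-components
    compensate the rescaling of the A-summands by \<open>s\<close> and \<open>r\<close>
    below.\<close>
  define \<psi> where "\<psi> j = (if even j then sgnm C (j div 2) (xA (j div 2 + 2)) else xB ((j + 1) div 2 + 2))" for j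
  have psi_odd: "\<psi> (2*k-1) \<in> hom C (ob B (k+2)) (ob Cs (k+2))" if "1 \<le> k" "k \<le> n - 2" for k
    using that n3 by (auto simp: \<psi>_def in_hom)
  have psi_even: "\<psi> (2*k) \<in> hom C (ob A (k+3)) (ob Cs (k+2))" if "1 \<le> k" "k \<le> n - 3" for k
  proof -
    have e: "k + 3 = Suc (k + 2)" and "Suc (k + 2) \<le> n" using that n3 by linarith+
    then show ?thesis unfolding e by (auto simp: \<psi>_def in_hom sgnm_def)
  qed
  have psi: "\<forall>k. 1 \<le> k \<and> k \<le> n - 2 \<longrightarrow> \<psi> (2*k-1) \<in> hom C (ob B (k+2)) (ob Cs (k+2))"
    "\<forall>k. 1 \<le> k \<and> k \<le> n - 3 \<longrightarrow> \<psi> (2*k) \<in> hom C (ob A (k+3)) (ob Cs (k+2))"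
    using psi_odd psi_even by blast+
  note D = nseq_N[OF A] nseq_N[OF B] nseq_N[OF Cs] C1 phi psi
  have psA: "psA Cs \<psi> k = sgnm C (Suc k) (xA (Suc k))" if k: "2 \<le> k" "k < n" for k
  proof (cases "Suc k < n")
    case True
    obtain j where "k = Suc j" using k by (cases k) auto
    then show ?thesis using True by (simp add: psA_def[OF D] \<psi>_def sgnm_def)
  next
    case False
    then have "Suc k = n" using k by simp
    then show ?thesis using zob_mor(1)[of "xA n"] by (simp add: psA_def[OF D] sgnm_def)
  qed
  have psB: "psB \<psi> k = xB (Suc k)" if k: "2 \<le> k" "k < n" for k
  proof -
    obtain j where j: "k = Suc j" "1 \<le> j" using k by (cases k) auto
    have "2 * k - 3 = 2 * j - 1" "odd (2 * j - 1)" "(2 * j - 1 + 1) div 2 + 2 = Suc k" using j by auto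
    then show ?thesis by (simp add: psB_def[OF D] \<psi>_def del: One_nat_def)
  qed
  have psi_last: "\<psi> (2*n-5) = xB n"
  proof -
    have "2 * (n - 1) - 3 = 2 * n - 5" "2 \<le> n - 1" using n3 by linarith+
    then show ?thesis using psB[of "n - 1"] n3 by (simp add: psB_def[OF D])
  qed
  \<comment> \<open>The B_n-entries of the last square of \<chi>, whose first component is 1, give
    the relation for the last \<psi>.\<close>
  have "copair (zero zo (SO (ob A 2))) (SM (mo A (Suc 0)) \<cdot> mo B n) = copair (mo Cs n \<cdot> xA n) (mo Cs n \<cdot> xB n)"
    using seqmor_commute_last[OF chi] unfolding E_def by (simp add: red_mo phi chi_eq)
  from copair_inject(2)[OF this]
  have rel: "mo Cs n \<cdot> xB n = SM (mo A (Suc 0)) \<cdot> mo B n" by simp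
  \<comment> \<open>This is the B_2-column of the square of \<chi> at position 2; \<chi>_2 is the
    identity on B_2.\<close>
  have x3: "xB 3 \<cdot> mo B 2 = mo Cs 2"
  proof -
    have "copair (\<ominus> (xA 3 \<cdot> padmo zo A 3) \<oplus> xB 3 \<cdot> \<phi> 3) (xB 3 \<cdot> mo B 2) = copair (zero (ob A 3) (ob Cs 3)) (mo Cs 2)"
      using seqmor_commute[OF chi, of 2] by (simp add: Emo chi_eq[of 3] chi2)
    from copair_inject(2)[OF this] show ?thesis by simp
  qed
  let ?D = "Dseq C SO SM n A B Cs \<phi> \<psi>"
  note Dob = Dseq_ob and Dmo1 = Dseq_mo1[OF D] and Dmo = Dseq_mo[OF D] and Dmon = Dseq_mo_last[OF D]
  have Gob1: "ob G (Suc 0) = ds (ob A 3) (ob B 2)"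
    and Gob: "\<And>k. 2 \<le> k \<Longrightarrow> k \<le> n \<Longrightarrow> ob G k = ds (ds (padob n zo A (Suc (Suc k))) (padob n zo B (Suc k))) (ob Cs k)"
    unfolding G_def by (simp_all add: red_ob chi padE)
  have Gmo1: "mo G (Suc 0) = pair (pair (copair (padmo zo A 3) (zero (ob B 2) (padob n zo A 4)))
      (copair (\<ominus> (\<phi> 3)) (\<ominus> (mo B 2)))) (copair (zero (ob A 3) (ob B 2)) (one (ob B 2)))"
    unfolding G_def by (simp add: red_mo chi Emo chi2)
  have Gmo: "mo G k = pair (copair (\<ominus> (padmo ?Z E (Suc k))) (zero (ob Cs k) (padob n ?Z E (Suc (Suc k)))))
      (copair (copair (xA (Suc k)) (xB (Suc k))) (mo Cs k))" if "2 \<le> k" "k < n" for k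
    using that unfolding G_def by (simp add: red_mo chi chi_eq)
  have Gnf: "mo G k = pair (copair (\<ominus> (pair (copair (\<ominus> (padmo zo A (Suc (Suc k)))) (zero (padob n zo B (Suc k)) (padob n zo A (Suc (Suc (Suc k))))))
        (copair (padmor A B \<phi> (Suc (Suc k))) (padmo zo B (Suc k)))))
        (zero (ob Cs k) (ds (padob n zo A (Suc (Suc (Suc k)))) (padob n zo B (Suc (Suc k))))))
      (copair (copair (xA (Suc k)) (xB (Suc k))) (mo Cs k))" if "2 \<le> k" "k < n" for k
    unfolding Gmo[OF that] padE[OF le_SucI[OF le_SucI[OF that(1)]]] padEmo[OF le_SucI[OF that(1)]] by (rule refl)
  have Gmon: "mo G n = copair (zero ?Z (SO (ds (ob A 3) (ob B 2)))) (SM (pair (\<ominus> (mo A 2)) \<phi>2) \<cdot> mo Cs n)"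
    unfolding G_def by (simp add: red_mo chi Emo1)
  \<comment> \<open>These compare the objects of the third n-angle with the C_k and are special only
    at k = 2. There \<open>cB\<close> is \<beta>_2: the copy of B_2 in position 1 of
    \<open>G\<close> maps by (-\<beta>_2, 1) into B_3 \<oplus> B_2, and the projection
    \<open>r\<close> has to kill it.\<close>
  define cin where "cin k = (if k = 2 then zero zo (ob B 2) else one (ob Cs k))" for k
  define cout where "cout k = (if k = 2 then zero (ob B 2) zo else one (ob Cs k))" for k
  define cB where "cB k = (if k = 2 then mo B 2 else zero (ob Cs k) (padob n zo B (Suc k)))" for k
  have c_type [simp]: "cin k \<in> MC" "src (cin k) = cob Cs k" "tgt (cin k) = ob Cs k"
    "cout k \<in> MC" "src (cout k) = ob Cs k" "tgt (cout k) = cob Cs k"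
    "cB k \<in> MC" "src (cB k) = ob Cs k" "tgt (cB k) = padob n zo B (Suc k)" if "2 \<le> k" "k \<le> n" for k
    using that by (auto simp: cin_def cout_def cB_def cob_def)
  have up: "cob Cs (Suc k) = ob Cs (Suc k)" "cin (Suc k) = one (ob Cs (Suc k))" "cout (Suc k) = one (ob Cs (Suc k))"
    "cB (Suc k) = zero (ob Cs (Suc k)) (padob n zo B (Suc (Suc k)))" "ob B (Suc k) = padob n zo B (Suc k)"
    if "2 \<le> k" "k < n" for k
    using that by (simp_all add: cin_def cout_def cB_def)
  \<comment> \<open>The scalar on the A-summand is (-1)^(k+1) for k \<ge> 2 but -1 at k = 1, because
    both entries of d_1 have sign +.\<close>
  define s where "s k = (if k = 1 then \<ominus> (in1 C (ob A 3) (ob B 2)) else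
     pair (pair (copair (sgnm C (Suc k) (one (padob n zo A (Suc (Suc k)))))
                        (zero (ds (padob n zo B (Suc k)) (cob Cs k)) (padob n zo A (Suc (Suc k)))))
                (copair (zero (padob n zo A (Suc (Suc k))) (padob n zo B (Suc k)))
                        (copair (one (padob n zo B (Suc k))) (zero (cob Cs k) (padob n zo B (Suc k))))))
          (copair (zero (padob n zo A (Suc (Suc k))) (ob Cs k)) (copair (zero (padob n zo B (Suc k)) (ob Cs k)) (cin k))))" for k
  define r where "r k = (if k = 1 then \<ominus> (pj1 C (ob A 3) (ob B 2)) else
     pair (copair (copair (sgnm C (Suc k) (one (padob n zo A (Suc (Suc k))))) (zero (padob n zo B (Suc k)) (padob n zo A (Suc (Suc k)))))
                  (zero (ob Cs k) (padob n zo A (Suc (Suc k)))))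
       (pair (copair (copair (zero (padob n zo A (Suc (Suc k))) (padob n zo B (Suc k))) (one (padob n zo B (Suc k)))) (cB k))
             (copair (zero (ds (padob n zo A (Suc (Suc k))) (padob n zo B (Suc k))) (cob Cs k)) (cout k))))" for k
  have s_eq: "s k = pair (pair (copair (sgnm C (Suc k) (one (padob n zo A (Suc (Suc k)))))
                        (zero (ds (padob n zo B (Suc k)) (cob Cs k)) (padob n zo A (Suc (Suc k)))))
                (copair (zero (padob n zo A (Suc (Suc k))) (padob n zo B (Suc k)))
                        (copair (one (padob n zo B (Suc k))) (zero (cob Cs k) (padob n zo B (Suc k))))))
          (copair (zero (padob n zo A (Suc (Suc k))) (ob Cs k)) (copair (zero (padob n zo B (Suc k)) (ob Cs k)) (cin k)))"
    and r_eq: "r k = pair (copair (copair (sgnm C (Suc k) (one (padob n zo A (Suc (Suc k))))) (zero (padob n zo B (Suc k)) (padob n zo A (Suc (Suc k)))))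
                  (zero (ob Cs k) (padob n zo A (Suc (Suc k)))))
       (pair (copair (copair (zero (padob n zo A (Suc (Suc k))) (padob n zo B (Suc k))) (one (padob n zo B (Suc k)))) (cB k))
             (copair (zero (ds (padob n zo A (Suc (Suc k))) (padob n zo B (Suc k))) (cob Cs k)) (cout k)))"
    if "2 \<le> k" for k
    using that unfolding s_def r_def by (simp_all only: if_False split: if_split) simp_all
  have sr1: "s (Suc 0) = pair (\<ominus> (one (ob A 3))) (zero (ob A 3) (ob B 2))" "r (Suc 0) = copair (\<ominus> (one (ob A 3))) (zero (ob B 2) (ob A 3))"
    by (simp_all add: s_def r_def in_eq_pair pj_eq_copair)
  have s: "seqmor C SM n ?D G s"
  proof (rule seqmorI, goal_cases)
    case (1 k)
    consider "k = 1" | "2 \<le> k" using 1 by linarith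
    then show ?case
      by cases (use 1 in \<open>simp_all add: Dob Gob1 Gob sr1, simp_all add: s_def sgnm_def\<close>)
  next
    case (2 k)
    consider "k = 1" | "2 \<le> k" using 2 by linarith
    then show ?case
    proof cases
      case 1
      then show ?thesis by (simp add: Dmo1 Gmo1 sr1) (simp add: s_def sgnm_def)
    next
      case k: 2
      have "mo Cs k \<cdot> cin k = cmo Cs k"
        using k 2 by (cases "k = 2") (simp_all add: cin_def)
      then show ?thesis
        unfolding s_eq[OF k] s_eq[OF le_SucI[OF k]] Dmo[OF k 2(2)] Gnf[OF k 2(2)] psA[OF k 2(2)] psB[OF k 2(2)] up[OF k 2(2)]
        using k 2 by (intro block_inclusion) simp_all
    qed
  next
    case 3
    \<comment> \<open>This is the \<Sigma>B_2-component of the last map of \<open>G\<close>; it must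
      vanish since \<open>s\<close> reaches only \<Sigma>A_3.\<close>
    have "SM \<phi>2 \<cdot> mo Cs n = zero (ob Cs n) (SO (ob B 2))"
      using last_composite_zero[of Cs] by (simp add: mC1)
    then show ?case
      by (simp add: Dmon Gmon sr1 canon_pair biprod_type) (simp add: s_def cin_def sgnm_def canon_pair biprod_type)
  qed
  have "seqmor C SM n G ?D r"
  proof (rule seqmorI, goal_cases)
    case (1 k)
    consider "k = 1" | "2 \<le> k" using 1 by linarith
    then show ?case
      by cases (use 1 in \<open>simp_all add: Dob Gob1 Gob sr1, simp_all add: r_def sgnm_def\<close>)
  next
    case (2 k)
    consider "k = 1" | "2 \<le> k" using 2 by linarith
    then show ?case
    proof cases
      case 1
      then show ?thesis by (simp add: Dmo1 Gmo1 sr1) (simp add: r_def sgnm_def cB_def cout_def)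
    next
      case k: 2
      have "padmo zo B (Suc k) \<cdot> cB k = zero (ob Cs k) (padob n zo B (Suc (Suc k)))"
        using k 2 pad_composite[of B 2] by (cases "k = 2") (simp_all add: cB_def)
      moreover have "xB (Suc k) \<cdot> cB k \<oplus> cmo Cs k \<cdot> cout k = mo Cs k"
        using k 2 x3 by (cases "k = 2") (simp_all add: cB_def cout_def)
      ultimately show ?thesis
        unfolding r_eq[OF k] r_eq[OF le_SucI[OF k]] Dmo[OF k 2(2)] Gnf[OF k 2(2)] psA[OF k 2(2)] psB[OF k 2(2)] up[OF k 2(2)]
        using k 2 by (intro block_projection) simp_all
    qed
  next
    case 3
    show ?case
      by (simp add: Dmon Gmon sr1) (simp add: r_def cB_def cout_def sgnm_def)
  qed
  moreover have "r k \<cdot> s k = one (ob ?D k)" if k: "1 \<le> k" "k \<le> n" for k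
  proof -
    consider "k = 1" | "2 \<le> k" using k by linarith
    then show ?thesis
    proof cases
      case 1
      then show ?thesis by (simp add: Dob sr1)
    next
      case k2: 2
      have "cB k \<cdot> cin k = zero (cob Cs k) (padob n zo B (Suc k))" "cout k \<cdot> cin k = one (cob Cs k)"
        using k k2 by (cases "k = 2"; simp add: cB_def cout_def cin_def)+
      then show ?thesis
        unfolding r_eq[OF k2] s_eq[OF k2] Dob(2)[OF k2 k(2)] using k k2 by (intro block_split) simp_all
    qed
  qed
  ultimately have "?D \<in> N"
    using N_summand[OF G is_nseq_Dseq[OF D] s] by blast
  show "\<exists>\<phi> \<psi>. \<phi> 1 = idm C (ob A 1) \<and> \<phi> 2 = \<phi>2 \<and> seqmor C SM n A B \<phi> \<and>
          (\<forall>k. 1 \<le> k \<and> k \<le> n - 2 \<longrightarrow>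
               \<psi> (2*k-1) \<in> hom C (ob B (k+2)) (ob Cs (k+2))) \<and>
          (\<forall>k. 1 \<le> k \<and> k \<le> n - 3 \<longrightarrow>
               \<psi> (2*k) \<in> hom C (ob A (k+3)) (ob Cs (k+2))) \<and>
          cmp C (mo Cs n) (\<psi> (2*n-5)) = cmp C (SM (mo A 1)) (mo B n) \<and>
          Dseq C SO SM n A B Cs \<phi> \<psi> \<in> N"
    using phi1 phi_2 phi psi rel psi_last \<open>?D \<in> N\<close>
    by (intro exI[of _ \<phi>] exI[of _ \<psi>]) simp
qed

end

section \<open>From (N4*) to (N4)\<close>

context additive
begin

text \<open>The object and the structure maps are free, so that A \<oplus> 0 can be A itself and the
  basis of a sum can be changed.\<close>

definition biprod where
  "biprod A B X i1 i2 p1 p2 \<longleftrightarrow> A \<in> OC \<and> B \<in> OC \<and> X \<in> OC \<and>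
     i1 \<in> MC \<and> src i1 = A \<and> tgt i1 = X \<and> i2 \<in> MC \<and> src i2 = B \<and> tgt i2 = X \<and>
     p1 \<in> MC \<and> src p1 = X \<and> tgt p1 = A \<and> p2 \<in> MC \<and> src p2 = X \<and> tgt p2 = B \<and>
     p1 \<cdot> i1 = one A \<and> p2 \<cdot> i2 = one B \<and> p1 \<cdot> i2 = zero B A \<and> p2 \<cdot> i1 = zero A B \<and>
     i1 \<cdot> p1 \<oplus> i2 \<cdot> p2 = one X"

text \<open>The first summand is embedded as the graph of \<open>f\<close>, and the second
  projection is the one that kills this graph.\<close>

lemma biprod_twist:
  "A \<in> OC \<Longrightarrow> B \<in> OC \<Longrightarrow> f \<in> MC \<Longrightarrow> src f = A \<Longrightarrow> tgt f = B \<Longrightarrow>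
    biprod A B (ds A B) (pair (one A) f) (pair (zero B A) (one B)) (copair (one A) (zero B A)) (copair (\<ominus> f) (one B))"
  by (simp add: biprod_def one_dsum)

lemma biprod_dsum:
  "A \<in> OC \<Longrightarrow> B \<in> OC \<Longrightarrow>
    biprod A B (ds A B) (pair (one A) (zero A B)) (pair (zero B A) (one B)) (copair (one A) (zero B A)) (copair (zero A B) (one B))"
  using biprod_twist[of A B "zero A B"] by simp

lemma biprod_zero_right: "A \<in> OC \<Longrightarrow> biprod A zo A (one A) (zero zo A) (one A) (zero A zo)"
  and biprod_zero_left: "A \<in> OC \<Longrightarrow> biprod zo A A (zero zo A) (one A) (zero A zo) (one A)"
  by (simp_all add: biprod_def)

end

section \<open>Direct sums of n-angles and rotations of trivial n-angles\<close>

context pre_nangulated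
begin

text \<open>The direct sum carried by a chosen biproduct in each position. Twisting the biproduct in
  one position alters only the maps adjacent to it.\<close>

definition sumseq where
  "sumseq A B X I1 I2 P1 P2 = mkseq n X (\<lambda>i. if i < n then I1 (i+1) \<cdot> mo A i \<cdot> P1 i \<oplus> I2 (i+1) \<cdot> mo B i \<cdot> P2 i
     else SM (I1 1) \<cdot> mo A n \<cdot> P1 n \<oplus> SM (I2 1) \<cdot> mo B n \<cdot> P2 n)"

lemma sumseq_ob [simp]: "1 \<le> i \<Longrightarrow> i \<le> n \<Longrightarrow> ob (sumseq A B X I1 I2 P1 P2) i = X i"
  and sumseq_mo: "1 \<le> i \<Longrightarrow> i < n \<Longrightarrow> mo (sumseq A B X I1 I2 P1 P2) i =
      I1 (Suc i) \<cdot> mo A i \<cdot> P1 i \<oplus> I2 (Suc i) \<cdot> mo B i \<cdot> P2 i"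
  and sumseq_mo_last: "mo (sumseq A B X I1 I2 P1 P2) n =
      SM (I1 (Suc 0)) \<cdot> mo A n \<cdot> P1 n \<oplus> SM (I2 (Suc 0)) \<cdot> mo B n \<cdot> P2 n"
  by (simp_all add: sumseq_def)

context
  fixes A B X I1 I2 P1 P2
  assumes A [simp]: "A \<in> N" and B [simp]: "B \<in> N"
    and b: "\<And>i. 1 \<le> i \<Longrightarrow> i \<le> n \<Longrightarrow> biprod (ob A i) (ob B i) (X i) (I1 i) (I2 i) (P1 i) (P2 i)"
begin

lemma sumseq_biprod_type [simp]:
  assumes "1 \<le> i" "i \<le> n"
  shows "X i \<in> OC" "I1 i \<in> MC" "src (I1 i) = ob A i" "tgt (I1 i) = X i" "I2 i \<in> MC" "src (I2 i) = ob B i" "tgt (I2 i) = X i"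
   "P1 i \<in> MC" "src (P1 i) = X i" "tgt (P1 i) = ob A i" "P2 i \<in> MC" "src (P2 i) = X i" "tgt (P2 i) = ob B i"
  using b[OF assms] unfolding biprod_def by simp_all

lemma sumseq_biprod_eq [simp]:
  assumes "1 \<le> i" "i \<le> n"
  shows "P1 i \<cdot> I1 i = one (ob A i)" "P2 i \<cdot> I2 i = one (ob B i)" "P1 i \<cdot> I2 i = zero (ob B i) (ob A i)"
    "P2 i \<cdot> I1 i = zero (ob A i) (ob B i)" "I1 i \<cdot> P1 i \<oplus> I2 i \<cdot> P2 i = one (X i)"
  using b[OF assms] unfolding biprod_def by simp_all

lemma sumseq_biprod_cmp [simp]:
  assumes [simp]: "h \<in> MC" and i: "1 \<le> i" "i \<le> n"
  shows "tgt h = ob A i \<Longrightarrow> P1 i \<cdot> I1 i \<cdot> h = h" "tgt h = ob B i \<Longrightarrow> P2 i \<cdot> I2 i \<cdot> h = h"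
   "tgt h = ob B i \<Longrightarrow> P1 i \<cdot> I2 i \<cdot> h = zero (src h) (ob A i)"
   "tgt h = ob A i \<Longrightarrow> P2 i \<cdot> I1 i \<cdot> h = zero (src h) (ob B i)"
  using sumseq_biprod_eq[OF i] cmp_assoc[of h "I1 i" "P1 i"] cmp_assoc[of h "I2 i" "P2 i"] cmp_assoc[of h "I2 i" "P1 i"] cmp_assoc[of h "I1 i" "P2 i"] i
  by (simp_all del: cmp_assoc sumseq_biprod_eq)

lemma sumseq_SM_biprod_cmp:
  assumes [simp]: "h \<in> MC"
  shows "tgt h = SO (ob A (Suc 0)) \<Longrightarrow> SM (P1 (Suc 0)) \<cdot> SM (I1 (Suc 0)) \<cdot> h = h"
   "tgt h = SO (ob B (Suc 0)) \<Longrightarrow> SM (P2 (Suc 0)) \<cdot> SM (I2 (Suc 0)) \<cdot> h = h"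
   "tgt h = SO (ob B (Suc 0)) \<Longrightarrow> SM (P1 (Suc 0)) \<cdot> SM (I2 (Suc 0)) \<cdot> h = zero (src h) (SO (ob A (Suc 0)))"
   "tgt h = SO (ob A (Suc 0)) \<Longrightarrow> SM (P2 (Suc 0)) \<cdot> SM (I1 (Suc 0)) \<cdot> h = zero (src h) (SO (ob B (Suc 0)))"
  by (simp_all flip: cmp_assoc SM_cmp)

lemma sumseq_N: "sumseq A B X I1 I2 P1 P2 \<in> N" (is "?S \<in> N")
  and sumseq_I1: "seqmor C SM n A (sumseq A B X I1 I2 P1 P2) I1"
  and sumseq_I2: "seqmor C SM n B (sumseq A B X I1 I2 P1 P2) I2"
  and sumseq_P1: "seqmor C SM n (sumseq A B X I1 I2 P1 P2) A P1"
  and sumseq_P2: "seqmor C SM n (sumseq A B X I1 I2 P1 P2) B P2"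
proof -
  show m: "seqmor C SM n A ?S I1" "seqmor C SM n B ?S I2" "seqmor C SM n ?S A P1" "seqmor C SM n ?S B P2"
    by (rule seqmorI; simp add: sumseq_mo sumseq_mo_last sumseq_SM_biprod_cmp)+
  have "is_nseq C SO n ?S"
    unfolding sumseq_def by (rule is_nseq_mkseq) simp_all
  moreover have "is_dsum_seq C SM n A B ?S"
    unfolding is_dsum_seq_def using m
    by (intro exI[of _ I1] exI[of _ I2] exI[of _ P1] exI[of _ P2]) simp
  moreover have "\<forall>A \<in> N. \<forall>B \<in> N. \<forall>S. is_nseq C SO n S \<and> is_dsum_seq C SM n A B S \<longrightarrow> S \<in> N"
    using N1 unfolding N1_def by (elim conjE) assumption
  ultimately show "?S \<in> N" using A B by blast
qed

end

text \<open>The n-angle X \<rightarrow> 0 \<rightarrow> ... \<rightarrow> 0 \<rightarrow> \<Sigma>X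
  \<rightarrow> \<Sigma>X with last map (-1)^n.\<close>

definition shifted where "shifted X = rot C SO SM n (triv X)"

lemma shifted_N [simp]: "X \<in> OC \<Longrightarrow> shifted X \<in> N"
  unfolding shifted_def by (intro rot_N triv_N)

lemma triv_ob [simp]:
  "ob (triv X) (Suc 0) = X" "ob (triv X) 2 = X" "3 \<le> k \<Longrightarrow> k \<le> n \<Longrightarrow> ob (triv X) k = zo"
  and triv_mo [simp]: "mo (triv X) (Suc 0) = one X" "mo (triv X) 2 = zero X zo"
  by (simp_all add: triv_def)

lemma shifted_ob [simp]:
  "ob (shifted X) (Suc 0) = X" "2 \<le> k \<Longrightarrow> k < n \<Longrightarrow> ob (shifted X) k = zo" "ob (shifted X) n = SO X"
  and shifted_mo [simp]: "mo (shifted X) (Suc 0) = zero X zo"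
    "X \<in> OC \<Longrightarrow> mo (shifted X) n = sgnm C n (one (SO X))"
  by (simp_all add: shifted_def)

text \<open>The right rotation of \<open>triv X\<close>, up to the isomorphism \<open>\<Sigma>0 = 0\<close>.\<close>

definition unshifted where
  "unshifted X = mkseq n (\<lambda>i. if i = 2 \<or> i = 3 then X else zo)
     (\<lambda>i. if i = 2 then one X else zero (if i = 3 then X else zo) (if i = n then SO zo else if i = 1 then X else zo))"

lemma unshifted_ob [simp]:
  "ob (unshifted X) (Suc 0) = zo" "ob (unshifted X) 2 = X" "ob (unshifted X) 3 = X"
  "4 \<le> k \<Longrightarrow> k \<le> n \<Longrightarrow> ob (unshifted X) k = zo"
  and unshifted_mo [simp]: "mo (unshifted X) (Suc 0) = zero zo X" "mo (unshifted X) 2 = one X"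
  by (simp_all add: unshifted_def)

text \<open>Its left rotation differs from \<open>triv X\<close> only by \<Sigma>0 in place of 0 in
  the last position, so N2 applies backwards.\<close>

lemma unshifted_N [simp]:
  assumes [simp]: "X \<in> OC" shows "unshifted X \<in> N"
proof -
  have u: "is_nseq C SO n (unshifted X)"
    unfolding unshifted_def by (rule is_nseq_mkseq) auto
  define g where "g i = (if i \<le> 2 then one X else zero zo (if i = n then SO zo else zo))" for i
  define h where "h i = (if i \<le> 2 then one X else zero (if i = n then SO zo else zo) zo)" for i
  have "rot C SO SM n (unshifted X) \<in> N"
  proof (rule N_iso[OF triv_N[OF assms] is_nseq_rot[OF u], of g h])
    show "seqmor C SM n (triv X) (rot C SO SM n (unshifted X)) g"
    proof (rule seqmorI, goal_cases)
      case (1 i)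
      consider "i = 1" | "i = 2" | "3 \<le> i" "i < n" | "i = n" using 1 by linarith
      then show ?case by cases (simp_all add: g_def)
    next
      case (2 i)
      consider "i = 1" | "i = 2" | "3 \<le> i" "i < n" using 2 by linarith
      then show ?case
        by cases (simp_all add: g_def unshifted_def triv_def)
    next
      case 3
      show ?case by (simp add: g_def sgnm_def triv_def)
    qed
    fix i assume i: "1 \<le> i" "i \<le> n"
    consider "i = 1" | "i = 2" | "3 \<le> i" "i < n" | "i = n" using i by linarith
    then show "h i \<in> MC \<and> src (h i) = ob (rot C SO SM n (unshifted X)) i \<and> tgt (h i) = ob (triv X) i \<and>
       h i \<cdot> g i = one (ob (triv X) i) \<and> g i \<cdot> h i = one (ob (rot C SO SM n (unshifted X)) i)"
      by cases (simp_all add: g_def h_def)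
  qed
  then show ?thesis using rot_ND[OF u] by blast
qed

end

section \<open>The implication from \<open>N4star\<close> to \<open>N4\<close>\<close>

context pre_nangulated
begin

lemma N4star_imp_N4:
  assumes N4star: "N4star C SO SM n N" shows "N4 C SO SM n N"
  unfolding N4_def
proof (intro ballI allI impI, elim conjE)
  fix A B \<phi>1 \<phi>2
  assume A [simp]: "A \<in> N" and B [simp]: "B \<in> N"
    and "\<phi>1 \<in> hom C (ob A 1) (ob B 1)" "\<phi>2 \<in> hom C (ob A 2) (ob B 2)"
    and "cmp C \<phi>2 (mo A 1) = cmp C (mo B 1) \<phi>1"
  then have type [simp]: "\<phi>1 \<in> MC" "src \<phi>1 = ob A (Suc 0)" "tgt \<phi>1 = ob B (Suc 0)"
      "\<phi>2 \<in> MC" "src \<phi>2 = ob A 2" "tgt \<phi>2 = ob B 2"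
    and sq: "\<phi>2 \<cdot> mo A (Suc 0) = mo B (Suc 0) \<cdot> \<phi>1" by (simp_all add: in_hom)
  define A1 A2 A3 B1 B2 Bn where "A1 = ob A 1" "A2 = ob A 2" "A3 = ob A 3" "B1 = ob B 1" "B2 = ob B 2" "Bn = ob B n"
  note ob_defs = this
  have [simp]: "A1 \<in> OC" "A2 \<in> OC" "A3 \<in> OC" "B1 \<in> OC" "B2 \<in> OC" "Bn \<in> OC"
    unfolding ob_defs by simp_all
  have [simp]: "ob A (Suc 0) = A1" "ob A 2 = A2" "ob A 3 = A3" "ob B (Suc 0) = B1" "ob B 2 = B2" "ob B n = Bn"
    by (simp_all add: ob_defs)
  define Y where "Y = ds A2 B1"
  have Y [simp]: "Y \<in> OC" by (simp add: Y_def)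
  define f where "f = copair \<phi>2 (mo B (Suc 0))"
  have f [simp]: "f \<in> MC" "src f = Y" "tgt f = B2" by (simp_all add: f_def Y_def)

  \<comment> \<open>A trivial n-angle on B_1 is added to A, with A_1 embedded in A_1 \<oplus> B_1 as
    the graph of \<phi>_1. This produces the entry -\<phi>_1 in the first map, and \<open>f\<close>
    after that map becomes [0 \<beta>_1].\<close>
  define XA where "XA k = (if k = 1 then ds A1 B1 else if k = 2 then Y else ob A k)" for k
  define IA1 where "IA1 k = (if k = 1 then pair (one A1) \<phi>1 else if k = 2 then pair (one A2) (zero A2 B1) else one (ob A k))" for k
  define IA2 where "IA2 k = (if k = 1 then pair (zero B1 A1) (one B1) else if k = 2 then pair (zero B1 A2) (one B1) else zero zo (ob A k))" for k
  define PA1 where "PA1 k = (if k = 1 then copair (one A1) (zero B1 A1) else if k = 2 then copair (one A2) (zero B1 A2) else one (ob A k))" for k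
  define PA2 where "PA2 k = (if k = 1 then copair (\<ominus> \<phi>1) (one B1) else if k = 2 then copair (zero A2 B1) (one B1) else zero (ob A k) zo)" for k
  note A_defs = XA_def IA1_def IA2_def PA1_def PA2_def
  have bA: "biprod (ob A k) (ob (triv B1) k) (XA k) (IA1 k) (IA2 k) (PA1 k) (PA2 k)" if k: "1 \<le> k" "k \<le> n" for k
  proof -
    consider "k = 1" | "k = 2" | "3 \<le> k" using k by linarith
    then show ?thesis using k
      by cases (simp_all add: A_defs Y_def biprod_twist biprod_dsum biprod_zero_right)
  qed
  define A' where "A' = sumseq A (triv B1) XA IA1 IA2 PA1 PA2"
  have A' [simp]: "A' \<in> N" and IA1: "seqmor C SM n A A' IA1"
    unfolding A'_def using sumseq_N[OF A triv_N bA] sumseq_I1[OF A triv_N bA] by simp_all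
  have A'ob [simp]: "ob A' (Suc 0) = ds A1 B1" "ob A' 2 = Y" "3 \<le> k \<Longrightarrow> k \<le> n \<Longrightarrow> ob A' k = ob A k" for k
    unfolding A'_def by (simp_all add: XA_def)
  have A'mo1: "mo A' (Suc 0) = pair (copair (mo A (Suc 0)) (zero B1 A2)) (copair (\<ominus> \<phi>1) (one B1))"
    unfolding A'_def by (simp add: sumseq_mo A_defs)
  have A'mo2: "mo A' 2 = copair (mo A 2) (zero B1 A3)"
    unfolding A'_def by (simp add: sumseq_mo A_defs)
  have A'mo: "mo A' k = mo A k" if "3 \<le> k" "k < n" for k
    using that nseq_tgt(1)[of "triv B1" k] unfolding A'_def by (simp add: sumseq_mo A_defs)

  \<comment> \<open>B_2 is added in positions 2 and 3. This allows \<open>f\<close> to be replaced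
    by the split epimorphism [f 1], whose n-angle can be written down.\<close>
  define XE where "XE k = (if k = 1 then ds A1 B1 else if k = 2 then ds Y B2 else if k = 3 then ds A3 B2 else ob A k)" for k
  define IE1 where "IE1 k = (if k = 1 then one (ds A1 B1) else if k = 2 then pair (one Y) (zero Y B2)
     else if k = 3 then pair (one A3) (zero A3 B2) else one (ob A k))" for k
  define IE2 where "IE2 k = (if k = 1 then zero zo (ds A1 B1) else if k = 2 then pair (zero B2 Y) (one B2)
     else if k = 3 then pair (zero B2 A3) (one B2) else zero zo (ob A k))" for k
  define PE1 where "PE1 k = (if k = 1 then one (ds A1 B1) else if k = 2 then copair (one Y) (zero B2 Y)
     else if k = 3 then copair (one A3) (zero B2 A3) else one (ob A k))" for k
  define PE2 where "PE2 k = (if k = 1 then zero (ds A1 B1) zo else if k = 2 then copair (zero Y B2) (one B2)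
     else if k = 3 then copair (zero A3 B2) (one B2) else zero (ob A k) zo)" for k
  note E_defs = XE_def IE1_def IE2_def PE1_def PE2_def
  have bE: "biprod (ob A' k) (ob (unshifted B2) k) (XE k) (IE1 k) (IE2 k) (PE1 k) (PE2 k)" if k: "1 \<le> k" "k \<le> n" for k
  proof -
    consider "k = 1" | "k = 2" | "k = 3" | "4 \<le> k" using k by linarith
    then show ?thesis using k
      by cases (simp_all add: E_defs biprod_dsum biprod_zero_right)
  qed
  define E where "E = sumseq A' (unshifted B2) XE IE1 IE2 PE1 PE2"
  have E [simp]: "E \<in> N" and IE1: "seqmor C SM n A' E IE1" and IE2: "seqmor C SM n (unshifted B2) E IE2"
    unfolding E_def using sumseq_N[OF A' unshifted_N bE] sumseq_I1[OF A' unshifted_N bE] sumseq_I2[OF A' unshifted_N bE] by simp_all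
  have Eob [simp]: "ob E (Suc 0) = ds A1 B1" "ob E 2 = ds Y B2" "ob E 3 = ds A3 B2" "4 \<le> k \<Longrightarrow> k \<le> n \<Longrightarrow> ob E k = ob A k" for k
    unfolding E_def by (simp_all add: XE_def)
  have A'1_type [simp]: "mo A' (Suc 0) \<in> MC" "src (mo A' (Suc 0)) = ds A1 B1" "tgt (mo A' (Suc 0)) = Y"
    using nseq_tgt(1)[of A' "Suc 0"] by simp_all
  have Emo1: "mo E (Suc 0) = pair (mo A' (Suc 0)) (zero (ds A1 B1) B2)"
    unfolding E_def by (simp add: sumseq_mo E_defs)
  have Emo2: "mo E 2 = pair (copair (mo A' 2) (zero B2 A3)) (copair (zero Y B2) (one B2))"
    unfolding E_def using nseq_tgt(1)[of A' 2] by (simp add: sumseq_mo E_defs)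
  have Emo3: "mo E 3 = copair (mo A 3) (zero B2 (ob A 4))" if "3 < n"
    using that nseq_tgt(1)[of "unshifted B2" 3] unfolding E_def by (simp add: sumseq_mo E_defs A'mo)
  have Emo: "mo E k = mo A k" if "4 \<le> k" "k < n" for k
    using that nseq_tgt(1)[of "unshifted B2" k] unfolding E_def by (simp add: sumseq_mo E_defs A'mo)

  \<comment> \<open>The added summand on A_1 places \<Sigma>A_1 beside B_n, as position n of the
    mapping cone requires.\<close>
  define XB where "XB k = (if k = 1 then ds A1 B1 else if k = n then ds (SO A1) Bn else ob B k)" for k
  define IB1 where "IB1 k = (if k = 1 then pair (one A1) (zero A1 B1) else if k = n then pair (one (SO A1)) (zero (SO A1) Bn) else zero zo (ob B k))" for k
  define IB2 where "IB2 k = (if k = 1 then pair (zero B1 A1) (one B1) else if k = n then pair (zero Bn (SO A1)) (one Bn) else one (ob B k))" for k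
  define PB1 where "PB1 k = (if k = 1 then copair (one A1) (zero B1 A1) else if k = n then copair (one (SO A1)) (zero Bn (SO A1)) else zero (ob B k) zo)" for k
  define PB2 where "PB2 k = (if k = 1 then copair (zero A1 B1) (one B1) else if k = n then copair (zero (SO A1) Bn) (one Bn) else one (ob B k))" for k
  note B_defs = XB_def IB1_def IB2_def PB1_def PB2_def
  have bB: "biprod (ob (shifted A1) k) (ob B k) (XB k) (IB1 k) (IB2 k) (PB1 k) (PB2 k)" if k: "1 \<le> k" "k \<le> n" for k
  proof -
    consider "k = 1" | "2 \<le> k" "k < n" | "k = n" using k by linarith
    then show ?thesis
      by cases (simp_all add: B_defs biprod_dsum biprod_zero_left)
  qed
  define F where "F = sumseq (shifted A1) B XB IB1 IB2 PB1 PB2"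
  have F [simp]: "F \<in> N" and PB1: "seqmor C SM n F (shifted A1) PB1" and PB2: "seqmor C SM n F B PB2"
    unfolding F_def using sumseq_N[OF shifted_N B bB] sumseq_P1[OF shifted_N B bB] sumseq_P2[OF shifted_N B bB] by simp_all
  have Fob [simp]: "ob F (Suc 0) = ds A1 B1" "2 \<le> k \<Longrightarrow> k < n \<Longrightarrow> ob F k = ob B k" "ob F n = ds (SO A1) Bn" for k
    unfolding F_def by (simp_all add: XB_def)
  have Fmo1: "mo F (Suc 0) = copair (zero A1 B2) (mo B (Suc 0))"
    unfolding F_def by (simp add: sumseq_mo B_defs)
  have Fmo: "mo F k = mo B k" if "2 \<le> k" "Suc k < n" for k
    using that nseq_tgt(1)[of "shifted A1" k] unfolding F_def by (simp add: sumseq_mo B_defs)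
  have Fmo': "mo F k = pair (zero (ob B k) (SO A1)) (mo B k)" if "2 \<le> k" "Suc k = n" for k
    using that nseq_tgt(1)[of "shifted A1" k] nseq_tgt(1)[of B k] unfolding F_def by (simp add: sumseq_mo B_defs)
  have Fmon: "mo F n = canon C SO SM A1 B1 \<cdot> pair (copair (sgnm C n (one (SO A1))) (zero Bn (SO A1))) (copair (zero (SO A1) (SO B1)) (mo B n))"
    unfolding F_def by (simp add: sumseq_mo_last B_defs sgnm_def canon_pair biprod_type)

  \<comment> \<open>Embedding Y as the graph of -f turns the first map into [f 1] and the last into
    (-1)^n \<Sigma>(1, -f). Strictly between positions 2 and n the objects are zero, which will
    force most \<psi> to vanish.\<close>
  define XC where "XC k = (if k = 1 then ds Y B2 else if k = 2 then B2 else if k = n then SO Y else zo)" for k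
  define IC1 where "IC1 k = (if k = 1 then pair (one Y) (\<ominus> f) else if k = n then one (SO Y) else zero zo (XC k))" for k
  define IC2 where "IC2 k = (if k = 1 then pair (zero B2 Y) (one B2) else if k = 2 then one B2 else zero zo (XC k))" for k
  define PC1 where "PC1 k = (if k = 1 then copair (one Y) (zero B2 Y) else if k = n then one (SO Y) else zero (XC k) zo)" for k
  define PC2 where "PC2 k = (if k = 1 then copair f (one B2) else if k = 2 then one B2 else zero (XC k) zo)" for k
  note C_defs = XC_def IC1_def IC2_def PC1_def PC2_def
  have bC: "biprod (ob (shifted Y) k) (ob (triv B2) k) (XC k) (IC1 k) (IC2 k) (PC1 k) (PC2 k)" if k: "1 \<le> k" "k \<le> n" for k
  proof -
    consider "k = 1" | "k = 2" | "3 \<le> k" "k < n" | "k = n" using k by linarith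
    then show ?thesis
    proof cases
      case 1
      then show ?thesis using biprod_twist[of Y B2 "\<ominus> f"] by (simp add: C_defs)
    next
      case 3
      then show ?thesis using biprod_zero_left[of zo] by (simp add: C_defs)
    qed (simp_all add: C_defs biprod_zero_left biprod_zero_right)
  qed
  define G where "G = sumseq (shifted Y) (triv B2) XC IC1 IC2 PC1 PC2"
  have G [simp]: "G \<in> N" 
    unfolding G_def using sumseq_N[OF shifted_N triv_N bC] by simp
  have Gob [simp]: "ob G (Suc 0) = ds Y B2" "ob G 2 = B2" "3 \<le> k \<Longrightarrow> k < n \<Longrightarrow> ob G k = zo" "ob G n = SO Y" for k
    unfolding G_def by (simp_all add: XC_def)
  have Gmo1: "mo G (Suc 0) = copair f (one B2)"
    unfolding G_def by (simp add: sumseq_mo C_defs)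
  have Gmon: "mo G n = sgnm C n (SM (pair (one Y) (\<ominus> f)))"
    unfolding G_def by (simp add: sumseq_mo_last C_defs sgnm_def del: SM_pair)

  \<comment> \<open>The A_1-entry of the composite is \<phi>_2 \<alpha>_1 - \<beta>_1 \<phi>_1 =
    0.\<close>
  have "copair f (one B2) \<cdot> mo E (Suc 0) = mo F (Suc 0)"
    by (simp add: Emo1 A'mo1 Fmo1 f_def sq)
  then have "\<exists>\<phi> \<psi>. \<phi> 1 = one (ds A1 B1) \<and> \<phi> 2 = copair f (one B2) \<and> seqmor C SM n E F \<phi> \<and>
          (\<forall>k. 1 \<le> k \<and> k \<le> n - 2 \<longrightarrow>
               \<psi> (2*k-1) \<in> hom C (ob F (k+2)) (ob G (k+2))) \<and>
          (\<forall>k. 1 \<le> k \<and> k \<le> n - 3 \<longrightarrow>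
               \<psi> (2*k) \<in> hom C (ob E (k+3)) (ob G (k+2))) \<and>
          cmp C (mo G n) (\<psi> (2*n-5)) = cmp C (SM (mo E 1)) (mo F n) \<and>
          Dseq C SO SM n E F G \<phi> \<psi> \<in> N"
    using N4star[unfolded N4star_def, rule_format, OF E F G, of "copair f (one B2)"] by (simp add: Gmo1)
  then obtain \<phi>' \<psi> where phi'1: "\<phi>' (Suc 0) = one (ds A1 B1)" and phi'2: "\<phi>' 2 = copair f (one B2)"
    and phi': "seqmor C SM n E F \<phi>'"
    and psi: "\<forall>k. 1 \<le> k \<and> k \<le> n - 2 \<longrightarrow> \<psi> (2*k-1) \<in> hom C (ob F (k+2)) (ob G (k+2))"
          "\<forall>k. 1 \<le> k \<and> k \<le> n - 3 \<longrightarrow> \<psi> (2*k) \<in> hom C (ob E (k+3)) (ob G (k+2))"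
    and rel: "mo G n \<cdot> \<psi> (2*n-5) = SM (mo E (Suc 0)) \<cdot> mo F n"
    and DN: "Dseq C SO SM n E F G \<phi>' \<psi> \<in> N" by auto
  note phi'_type [simp] = seqmor_type[OF phi']
  \<comment> \<open>Restriction of \<phi>' to the summand A. As \<phi>'_1 is the identity and A_1 is
    embedded as the graph of \<phi>_1, the component of \<zeta> in B begins with \<phi>_1 and
    \<phi>_2; it is the morphism sought.\<close>
  define \<zeta> where "\<zeta> k = \<phi>' k \<cdot> IE1 k \<cdot> IA1 k" for k
  have zeta: "seqmor C SM n A F \<zeta>"
    unfolding \<zeta>_def by (intro seqmor_comp[OF seqmor_comp[OF IA1 IE1] phi']) simp_all
  note zeta_type [simp] = seqmor_type[OF zeta]
  define \<phi> where "\<phi> k = PB2 k \<cdot> \<zeta> k" for k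
  have phi: "seqmor C SM n A B \<phi>"
    unfolding \<phi>_def by (intro seqmor_comp[OF zeta PB2]) simp_all
  note phi_type [simp] = seqmor_type[OF phi]
  define \<theta> where "\<theta> k = PB1 k \<cdot> \<zeta> k" for k
  have theta: "seqmor C SM n A (shifted A1) \<theta>"
    unfolding \<theta>_def by (intro seqmor_comp[OF zeta PB1]) simp_all
  have zeta1: "\<zeta> (Suc 0) = pair (one A1) \<phi>1" by (simp add: \<zeta>_def phi'1 IE1_def IA1_def)
  have zeta2: "\<zeta> 2 = \<phi>2" by (simp add: \<zeta>_def phi'2 IE1_def IA1_def f_def Y_def)
  have phi1: "\<phi> (Suc 0) = \<phi>1" by (simp add: \<phi>_def zeta1 PB2_def)
  have phi2: "\<phi> 2 = \<phi>2" by (simp add: \<phi>_def zeta2 PB2_def)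
  \<comment> \<open>\<theta> has first component 1 and the last map of its target is (-1)^n, so the
    last square determines \<theta>_n.\<close>
  have theta_n: "\<theta> n = sgnm C n (mo A n)"
  proof -
    have [simp]: "\<theta> (Suc 0) = one A1" by (simp add: \<theta>_def zeta1 PB1_def)
    have "mo A n = sgnm C n (one (SO A1)) \<cdot> \<theta> n"
      using seqmor_commute_last[OF theta] by simp
    then show ?thesis using seqmor_type[OF theta, of n] by (cases "even n") (simp_all add: sgnm_def)
  qed
  have zeta_n: "\<zeta> n = pair (sgnm C n (mo A n)) (\<phi> n)"
  proof -
    have "\<zeta> n = one (ds (SO A1) Bn) \<cdot> \<zeta> n" by simp
    also have "\<dots> = pair (\<theta> n) (\<phi> n)" unfolding one_dsum[OF SO_Ob[OF \<open>A1 \<in> OC\<close>] \<open>Bn \<in> OC\<close>]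
      by (simp add: \<theta>_def \<phi>_def PB1_def PB2_def)
    finally show ?thesis by (simp add: theta_n)
  qed
  have zeta_k: "\<zeta> k = \<phi> k" if "3 \<le> k" "k < n" for k
    using that by (simp add: \<phi>_def PB2_def)
  have phi'_k: "\<phi>' k = \<zeta> k" if "4 \<le> k" "k \<le> n" for k
    using that by (simp add: \<zeta>_def IE1_def IA1_def)
  \<comment> \<open>On the added summand B_2, \<phi>'_2 is the identity, so the square at position 2
    determines the second column.\<close>
  have phi'_3: "\<phi>' 3 = copair (\<zeta> 3) (mo F 2)"
  proof -
    have "seqmor C SM n (unshifted B2) F (\<lambda>i. \<phi>' i \<cdot> IE2 i)"
      by (intro seqmor_comp[OF IE2 phi']) simp_all
    from seqmor_commute[OF this, of 2] have "\<phi>' 3 \<cdot> IE2 3 = mo F 2"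
      using seqmor_type[OF IE2, of 3] by (simp add: phi'2) (simp add: IE2_def)
    moreover have "\<zeta> 3 = \<phi>' 3 \<cdot> IE1 3" using seqmor_type[OF IE1, of 3] by (simp add: \<zeta>_def IA1_def)
    moreover have "IE1 3 = in1 C A3 B2" "IE2 3 = in2 C A3 B2" by (simp_all add: IE1_def IE2_def in_eq_pair)
    ultimately show ?thesis using copair_eta[of "\<phi>' 3" A3 B2] by simp
  qed
  have GE: "ob G (Suc 0) = ob E 2" by simp
  note psA_type = psA_type[OF nseq_N[OF E] nseq_N[OF F] nseq_N[OF G] GE phi' psi]
    and psB_type = psB_type[OF nseq_N[OF E] nseq_N[OF F] nseq_N[OF G] GE phi' psi]
    and psB_def = psB_def[OF nseq_N[OF E] nseq_N[OF F] nseq_N[OF G] GE phi' psi]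
    and psA_def = psA_def[OF nseq_N[OF E] nseq_N[OF F] nseq_N[OF G] GE phi' psi]
    and Dmo1 = Dseq_mo1[OF nseq_N[OF E] nseq_N[OF F] nseq_N[OF G] GE phi' psi]
    and Dmo = Dseq_mo[OF nseq_N[OF E] nseq_N[OF F] nseq_N[OF G] GE phi' psi]
    and Dmon = Dseq_mo_last[OF nseq_N[OF E] nseq_N[OF F] nseq_N[OF G] GE phi' psi]
  define w where "w = \<psi> (2*n-5)"
  have psB_w: "psB \<psi> k = w" if "Suc k = n" for k
    using that by (auto simp: psB_def w_def)
  have w_type [simp]: "w \<in> MC" "src w = ds (SO A1) Bn" "tgt w = SO Y"
  proof -
    have "2 \<le> n - 1" "n - 1 < n" "Suc (n - 1) = n" using n3 by linarith+
    then show "w \<in> MC" "src w = ds (SO A1) Bn" "tgt w = SO Y"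
      using psB_type[of "n - 1"] psB_w[of "n - 1"] by simp_all
  qed
  \<comment> \<open>The projection Y \<oplus> B_2 \<rightarrow> Y, under \<Sigma>, turns the last
    map of \<open>G\<close> into (-1)^n. Applied to the relation for the last \<psi>, it therefore
    determines \<open>w\<close>.\<close>
  have w: "w = canon C SO SM A2 B1 \<cdot> pair (copair (SM (mo A (Suc 0))) (zero Bn (SO A2)))
      (copair (\<ominus> (SM \<phi>1)) (sgnm C n (mo B n)))"
  proof -
    let ?p = "copair (one Y) (zero B2 Y)"
    have "SM ?p \<cdot> mo G n \<cdot> w = (SM ?p \<cdot> SM (mo E (Suc 0))) \<cdot> mo F n"
      unfolding w_def rel using nseq_tgt(1)[of E "Suc 0"] by simp
    also have "SM ?p \<cdot> SM (mo E (Suc 0)) = SM (mo A' (Suc 0))"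
      unfolding Emo1 by (simp flip: SM_cmp)
    also have "SM ?p \<cdot> mo G n \<cdot> w = sgnm C n w"
      unfolding Gmon by (simp add: sgnm_def)
    finally have eq: "sgnm C n w = SM (mo A' (Suc 0)) \<cdot> mo F n" .
    have "w = sgnm C n (sgnm C n w)" by (simp add: sgnm_def)
    then show ?thesis unfolding eq by (cases "even n") (simp_all add: A'mo1 Fmon sgnm_def)
  qed
  let ?D = "Dseq C SO SM n E F G \<phi>' \<psi>"
  let ?R = "rot C SO SM n (cone C SO SM n A B \<phi>)"
  have coneseq: "is_nseq C SO n (cone C SO SM n A B \<phi>)"
    by (rule is_nseq_cone[OF _ _ phi]) simp_all
  have cobG [simp]: "cob G k = zo" if "2 \<le> k" "k < n" for k
    using that by (cases "k = 2") simp_all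
  have cobGn [simp]: "cob G n = SO Y" by simp
  have cmoG: "cmo G k = zero zo (cob G (Suc k))" if "2 \<le> k" "k < n" for k
    using that zob_mor(1)[of "cmo G k"] by simp
  \<comment> \<open>Entries into C_(k+1) = 0 vanish, so \<open>w\<close> is the only \<psi> that
    survives.\<close>
  have psA0: "psA G \<psi> k = zero (ob A (Suc (Suc k))) zo" if "2 \<le> k" "Suc (Suc k) \<le> n" for k
    using that psA_type[of k] zob_mor(2)[of "psA G \<psi> k"] by simp
  have psB0: "psB \<psi> k = zero (ob B (Suc k)) zo" if "2 \<le> k" "Suc (Suc k) \<le> n" for k
    using that psB_type[of k] zob_mor(2)[of "psB \<psi> k"] by simp
  have psA_last: "psA G \<psi> k = zero zo (SO Y)" if "Suc k = n" for k
    using that by (simp add: psA_def)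

  have Dob1: "ob ?D (Suc 0) = ds A3 B2" by (simp add: Dseq_ob)
  have Dob: "ob ?D k = ds (ob A (Suc (Suc k))) (ds (ob B (Suc k)) zo)" if "2 \<le> k" "Suc (Suc k) \<le> n" for k
    using that by (simp add: Dseq_ob)
  have Dob_pen: "ob ?D k = ds zo (ds (ds (SO A1) Bn) zo)" if "Suc k = n" "2 \<le> k" for k
    using that by (simp add: Dseq_ob)
  have Dobn: "ob ?D n = ds zo (ds zo (SO Y))" by (simp add: Dseq_ob)
  have Rob: "ob ?R k = ds (ob A (Suc (Suc k))) (ob B (Suc k))" if "1 \<le> k" "Suc (Suc k) \<le> n" for k
    using that by simp
  have Rob_pen: "ob ?R k = ds (SO A1) Bn" if "Suc k = n" "1 \<le> k" for k
    using that by simp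
  have Robn: "ob ?R n = SO Y" by (simp add: Y_def)

  have D1: "mo ?D (Suc 0) = pair (copair (mo A 3) (zero B2 (ob A 4))) (pair (copair (\<phi> 3) (mo B 2)) (zero (ds A3 B2) zo))"
    if "3 < n" using that by (simp add: Dmo1 Emo3 phi'_3 zeta_k Fmo)
  \<comment> \<open>For n = 3 position 2 is already the last but one, so the first map lands in
    \<Sigma>A_1 \<oplus> B_3.\<close>
  have D1': "mo ?D (Suc 0) = pair (zero (ds A3 B2) zo) (pair (pair (copair (sgnm C n (mo A n)) (zero B2 (SO A1)))
      (copair (\<phi> n) (mo B 2))) (zero (ds A3 B2) zo))" if "3 = n"
  proof -
    have le: "n \<le> 3" "n < 4" using that by linarith+
    have [simp]: "ob A n = A3" "ob B 3 = Bn" unfolding ob_defs \<open>3 = n\<close> by (rule refl)+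
    have z: "\<zeta> 3 = pair (sgnm C n (mo A n)) (\<phi> n)" unfolding \<open>3 = n\<close> by (rule zeta_n)
    have m: "mo F 2 = pair (zero B2 (SO A1)) (mo B 2)" using Fmo'[of 2] \<open>3 = n\<close> by simp
    have B: "tgt (mo B 2) = Bn" "padob n zo E 4 = zo" "padmo zo E 3 = zero (ds A3 B2) zo"
      using le nseq_tgt(1)[of B 2] by simp_all
    show ?thesis by (simp add: Dmo1 phi'_3 z m B sgnm_def)
  qed
  have Dk: "mo ?D k = pair (copair (\<ominus> (mo A (Suc (Suc k)))) (zero (ds (ob B (Suc k)) zo) (ob A (Suc (Suc (Suc k))))))
     (pair (copair (sgnm C k (\<phi> (Suc (Suc k)))) (copair (\<ominus> (mo B (Suc k))) (zero zo (ob B (Suc (Suc k))))))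
       (zero (ds (ob A (Suc (Suc k))) (ds (ob B (Suc k)) zo)) zo))" if "2 \<le> k" "Suc (Suc k) < n" for k
    using that by (simp add: Dmo cmoG psA0 psB0 Emo Fmo phi'_k zeta_k)
  \<comment> \<open>In the \<Sigma>A_1-row the sign (-1)^k of the matrix entry and the sign (-1)^n
    in \<zeta>_n cancel, as n = k + 2.\<close>
  have Dk_pre: "mo ?D k = pair (zero (ds (ob A n) (ds (ob B (Suc k)) zo)) zo)
     (pair (pair (copair (mo A n) (zero (ds (ob B (Suc k)) zo) (SO A1)))
        (copair (sgnm C n (\<phi> n)) (copair (\<ominus> (mo B (Suc k))) (zero zo Bn))))
       (zero (ds (ob A n) (ds (ob B (Suc k)) zo)) zo))" if "2 \<le> k" "Suc (Suc k) = n" for k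
  proof -
    have n4: "4 \<le> n" and parity: "even k \<longleftrightarrow> even n" using that by auto
    show ?thesis using that phi'_k[OF n4] zeta_n nseq_tgt(1)[of B "Suc k"] parity
      by (cases "even n") (simp_all add: Dmo cmoG psA0 psB0 Fmo' sgnm_def)
  qed
  have Dk_pen: "mo ?D k = pair (zero (ds zo (ds (ds (SO A1) Bn) zo)) zo) (pair (zero (ds zo (ds (ds (SO A1) Bn) zo)) zo)
      (copair (zero zo (SO Y)) (copair w (zero zo (SO Y)))))" if "2 \<le> k" "Suc k = n" for k
    using that by (simp add: Dmo cmoG psA_last psB_w sgnm_def)
  \<comment> \<open>The signs are -1 in position 1, then 1 on A_(k+2) and (-1)^(k+1) on B_(k+1),
    ending with (-1)^n on B_n, and 1 on \<Sigma>Y. On \<Sigma>A_1 the sign is -1: for n > 3,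
    \<alpha>_n enters the sequence of \<open>N4star\<close> with sign + but the cone with sign
    -.\<close>
  define g where "g k = (if k = 1 then pair (copair (\<ominus> (one A3)) (zero B2 A3)) (copair (zero A3 B2) (\<ominus> (one B2)))
      else if k = n then copair (zero zo (SO Y)) (copair (zero zo (SO Y)) (one (SO Y)))
      else if Suc k = n then pair (copair (zero zo (SO A1)) (copair (copair (\<ominus> (one (SO A1))) (zero Bn (SO A1))) (zero zo (SO A1))))
         (copair (zero zo Bn) (copair (copair (zero (SO A1) Bn) (sgnm C n (one Bn))) (zero zo Bn)))
      else pair (copair (one (ob A (k+2))) (zero (ds (ob B (k+1)) zo) (ob A (k+2))))
         (copair (zero (ob A (k+2)) (ob B (k+1))) (copair (sgnm C (k+1) (one (ob B (k+1)))) (zero zo (ob B (k+1))))))" for k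
  \<comment> \<open>The inverse of \<open>g\<close>: the same signs, with the zero summands put
    back.\<close>
  define h where "h k = (if k = 1 then pair (copair (\<ominus> (one A3)) (zero B2 A3)) (copair (zero A3 B2) (\<ominus> (one B2)))
      else if k = n then pair (zero (SO Y) zo) (pair (zero (SO Y) zo) (one (SO Y)))
      else if Suc k = n then pair (zero (ds (SO A1) Bn) zo) (pair (pair (copair (\<ominus> (one (SO A1))) (zero Bn (SO A1)))
         (copair (zero (SO A1) Bn) (sgnm C n (one Bn)))) (zero (ds (SO A1) Bn) zo))
      else pair (copair (one (ob A (k+2))) (zero (ob B (k+1)) (ob A (k+2))))
         (pair (copair (zero (ob A (k+2)) (ob B (k+1))) (sgnm C (k+1) (one (ob B (k+1))))) (zero (ds (ob A (k+2)) (ob B (k+1))) zo)))" for k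
  have g1: "g (Suc 0) = pair (copair (\<ominus> (one A3)) (zero B2 A3)) (copair (zero A3 B2) (\<ominus> (one B2)))"
    and gn: "g n = copair (zero zo (SO Y)) (copair (zero zo (SO Y)) (one (SO Y)))"
    and g_pen: "\<And>k. Suc k = n \<Longrightarrow> g k = pair (copair (zero zo (SO A1)) (copair (copair (\<ominus> (one (SO A1))) (zero Bn (SO A1))) (zero zo (SO A1))))
         (copair (zero zo Bn) (copair (copair (zero (SO A1) Bn) (sgnm C n (one Bn))) (zero zo Bn)))"
    and gk: "\<And>k. 2 \<le> k \<Longrightarrow> Suc (Suc k) \<le> n \<Longrightarrow> g k = pair (copair (one (ob A (Suc (Suc k)))) (zero (ds (ob B (Suc k)) zo) (ob A (Suc (Suc k)))))
         (copair (zero (ob A (Suc (Suc k))) (ob B (Suc k))) (copair (sgnm C (Suc k) (one (ob B (Suc k)))) (zero zo (ob B (Suc k)))))"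
    by (auto simp: g_def)
  have h1: "h (Suc 0) = pair (copair (\<ominus> (one A3)) (zero B2 A3)) (copair (zero A3 B2) (\<ominus> (one B2)))"
    and hn: "h n = pair (zero (SO Y) zo) (pair (zero (SO Y) zo) (one (SO Y)))"
    and h_pen: "\<And>k. Suc k = n \<Longrightarrow> h k = pair (zero (ds (SO A1) Bn) zo) (pair (pair (copair (\<ominus> (one (SO A1))) (zero Bn (SO A1)))
         (copair (zero (SO A1) Bn) (sgnm C n (one Bn)))) (zero (ds (SO A1) Bn) zo))"
    and hk: "\<And>k. 2 \<le> k \<Longrightarrow> Suc (Suc k) \<le> n \<Longrightarrow> h k = pair (copair (one (ob A (Suc (Suc k)))) (zero (ob B (Suc k)) (ob A (Suc (Suc k)))))
         (pair (copair (zero (ob A (Suc (Suc k))) (ob B (Suc k))) (sgnm C (Suc k) (one (ob B (Suc k))))) (zero (ds (ob A (Suc (Suc k))) (ob B (Suc k))) zo))"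
    by (auto simp: h_def)
  have position: "k = 1 \<or> 2 \<le> k \<and> Suc (Suc k) \<le> n \<or> 2 \<le> k \<and> Suc k = n \<or> k = n" if "1 \<le> k" "k \<le> n" for k
    using that by linarith
  have Rk: "mo ?R k = pair (copair (\<ominus> (mo A (Suc (Suc k)))) (zero (ob B (Suc k)) (padob n (SO A1) A (Suc (Suc (Suc k))))))
      (copair (\<phi> (Suc (Suc k))) (mo B (Suc k)))" if "1 \<le> k" "Suc (Suc k) \<le> n" for k
    using that cone_mo[OF _ _ phi, of "Suc k"] by simp
  have Rk_pen: "mo ?R k = canon C SO SM A2 B1 \<cdot> pair (copair (\<ominus> (SM (mo A (Suc 0)))) (zero Bn (SO A2))) (copair (SM \<phi>1) (mo B n))"
    if "Suc k = n" "1 \<le> k" for k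
    using that cone_mo_last[OF _ _ phi] by (simp add: phi1)
  have Rn: "mo ?R n = sgnm C n (SM (pair (copair (\<ominus> (mo A 2)) (zero B1 A3)) (copair \<phi>2 (mo B (Suc 0)))))"
    using cone_mo[OF _ _ phi, of 1] by (simp add: phi2)
  have "?R \<in> N"
  proof (rule N_iso[OF DN is_nseq_rot[OF coneseq], of g h])
    show "seqmor C SM n ?D ?R g"
    proof (rule seqmorI, goal_cases)
      case (1 k)
      consider "k = 1" | "2 \<le> k" "Suc (Suc k) \<le> n" | "2 \<le> k" "Suc k = n" | "k = n" using position[OF 1] by blast
      then show ?case
      proof cases
        case 1
        then show ?thesis by (simp add: Dob1 g1)
      next
        case 2
        then show ?thesis unfolding Dob[OF 2] gk[OF 2] by (simp add: sgnm_def)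
      next
        case 3
        then show ?thesis unfolding Dob_pen[OF 3(2,1)] g_pen[OF 3(2)] by (simp add: sgnm_def)
      next
        case 4
        then show ?thesis by (simp only: Dobn gn Robn) simp
      qed
    next
      case (2 k)
      consider "k = 1" "3 < n" | "k = 1" "3 = n" | "2 \<le> k" "Suc (Suc k) < n" | "2 \<le> k" "Suc (Suc k) = n" | "2 \<le> k" "Suc k = n"
        using 2 n3 by linarith
      then show ?case
      proof cases
        case 1
        then have g2: "g (Suc 1) = pair (copair (one (ob A 4)) (zero (ds (ob B 3) zo) (ob A 4)))
         (copair (zero (ob A 4) (ob B 3)) (copair (\<ominus> (one (ob B 3))) (zero zo (ob B 3))))"
          using gk[of 2] by (simp add: sgnm_def)
        have R1: "mo ?R 1 = pair (copair (\<ominus> (mo A 3)) (zero B2 (ob A 4))) (copair (\<phi> 3) (mo B 2))"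
          using Rk[of 1] 1 by simp
        show ?thesis unfolding \<open>k = 1\<close> g2 R1 using 1 by (simp add: D1 g1)
      next
        case 2
        then have odd: "odd n" and e: "Suc (Suc 1) = n" "Suc 1 = 2" "Suc 2 = n" by auto
        have [simp]: "ob A n = A3" "ob B 3 = Bn" unfolding ob_defs \<open>3 = n\<close> by (rule refl)+
        have [simp]: "tgt (mo B 2) = Bn" using nseq_tgt(1)[of B 2] by simp
        have R1: "mo ?R 1 = pair (copair (\<ominus> (mo A n)) (zero B2 (SO A1))) (copair (\<phi> n) (mo B 2))"
          using Rk[of 1, unfolded e] by simp
        show ?thesis unfolding \<open>k = 1\<close> R1 unfolding e unfolding g_pen[OF e(3)] One_nat_def D1'[OF \<open>3 = n\<close>] g1
          using odd by (simp add: sgnm_def)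
      next
        case 3
        then have k: "1 \<le> k" "Suc (Suc k) \<le> n" "2 \<le> Suc k" "Suc (Suc (Suc k)) \<le> n" by linarith+
        show ?thesis unfolding Dk[OF 3] gk[OF 3(1) k(2)] gk[OF k(3,4)] Rk[OF k(1,2)]
          using k by (cases "even k") (simp_all add: sgnm_def)
      next
        case 4
        then have k: "1 \<le> k" "Suc (Suc k) \<le> n" and parity: "even k \<longleftrightarrow> even n" by auto
        show ?thesis unfolding Dk_pre[OF 4] gk[OF 4(1) k(2)] g_pen[OF 4(2)] Rk[OF k] 4(2)
          using k 4 nseq_tgt(1)[of B "Suc k"] parity by (cases "even n") (simp_all add: sgnm_def)
      next
        case 5
        then have k: "1 \<le> k" by simp
        show ?thesis unfolding Dk_pen[OF 5] g_pen[OF 5(2)] Rk_pen[OF 5(2) k] 5(2) gn w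
          by (cases "even n") (simp_all add: sgnm_def Y_def canon_pair biprod_type)
      qed
    next
      case 3
      \<comment> \<open>The last map of the sequence of \<open>N4star\<close> is (-1)^n \<Sigma>p on
        the summand \<Sigma>Y, while that of the rotated cone is (-1)^n \<Sigma>(-p). The sign -1 of
        \<open>g\<close> in position 1 accounts for the difference.\<close>
      define a where "a = copair (mo A 2) (zero B1 A3)"
      have [simp]: "a \<in> MC" "src a = Y" "tgt a = A3" by (simp_all add: a_def Y_def)
      define p where "p = pair a (\<ominus> f)"
      have p [simp]: "p \<in> MC" "src p = Y" "tgt p = ds A3 B2" by (simp_all add: p_def)
      have np: "pair (copair (\<ominus> (mo A 2)) (zero B1 A3)) (copair \<phi>2 (mo B (Suc 0))) = \<ominus> p"
        by (simp add: p_def a_def f_def)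
      have Ep: "mo E 2 \<cdot> pair (one Y) (\<ominus> f) = p"
        by (simp add: Emo2 A'mo2 p_def flip: a_def)
      have "SM (mo E 2) \<cdot> SM (pair (one Y) (\<ominus> f)) = SM p"
        unfolding Ep[symmetric] by (rule SM_cmp[symmetric]) (simp_all add: Emo2 A'mo2 flip: a_def)
      then have Gp: "SM (mo E 2) \<cdot> mo G n = sgnm C n (SM p)"
        unfolding Gmon sgnm_def
        using nseq_tgt(1)[of E 2] by (simp del: SM_pair)
      have g1': "g (Suc 0) = \<ominus> (one (ds A3 B2))" by (simp add: g1 one_dsum)
      show ?case unfolding One_nat_def g1' gn Rn Dmon np Gp
        by (cases "even n") (simp_all add: sgnm_def)
    qed
    fix k assume k: "1 \<le> k" "k \<le> n"
    consider "k = 1" | "2 \<le> k" "Suc (Suc k) \<le> n" | "2 \<le> k" "Suc k = n" | "k = n" using position[OF k] by blast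
    then show "h k \<in> MC \<and> src (h k) = ob ?R k \<and> tgt (h k) = ob ?D k \<and>
       h k \<cdot> g k = one (ob ?D k) \<and> g k \<cdot> h k = one (ob ?R k)"
    proof cases
      case 1
      then show ?thesis by (simp add: Dob1 g1 h1 one_dsum)
    next
      case 2
      then have k1: "1 \<le> k" by simp
      show ?thesis unfolding Dob[OF 2] gk[OF 2] hk[OF 2] Rob[OF k1 2(2)] using 2 by (simp add: sgnm_def one_dsum)
    next
      case 3
      then have k1: "1 \<le> k" by simp
      show ?thesis unfolding Dob_pen[OF 3(2,1)] g_pen[OF 3(2)] h_pen[OF 3(2)] Rob_pen[OF 3(2) k1]
        by (simp add: sgnm_def one_dsum)
    next
      case 4
      show ?thesis unfolding 4 Dobn gn hn Robn by (simp add: one_dsum)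
    qed
  qed
  then have cone: "cone C SO SM n A B \<phi> \<in> N" by (rule rot_ND[OF coneseq])
  show "\<exists>\<phi>. \<phi> 1 = \<phi>1 \<and> \<phi> 2 = \<phi>2 \<and> seqmor C SM n A B \<phi> \<and> cone C SO SM n A B \<phi> \<in> N"
    using phi1 phi2 phi cone by (intro exI[of _ \<phi>]) simp
qed

end

theorem theorem4p4:
  fixes C :: "('o, 'm) addcat" and SO :: "'o \<Rightarrow> 'o" and SM :: "'m \<Rightarrow> 'm"
    and n :: nat and N :: "('o, 'm) nseq set"
  assumes "additive_cat C"
    and "cat_automorphism C SO SM"
    and "3 \<le> n"
    and "\<forall>S \<in> N. is_nseq C SO n S"
    and "N1 C SO SM n N" and "N2 C SO SM n N" and "N3 C SO SM n N"
  shows "N4 C SO SM n N \<longleftrightarrow> N4star C SO SM n N"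
proof -
  interpret pre_nangulated C SO SM n N
    using assms by unfold_locales simp_all
  show ?thesis using N4_imp_N4star N4star_imp_N4 by blast
qed

end
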